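(* Let $F$ be a free group of finite rank, let $R$ be a finite set of words in $F$ (each word being straight or cyclic), and let $X$ and $Y$ be $F$-bases. Let $h$ be the function assigning to each $F$-basis $Z$ the natural number $h(Z)=\sum_{r\in R} Z\text{-length}(r)$. If $X$ and $Y$ are both local-minimum points for $h$, then either $X^{\pm 1}=Y^{\pm 1}$, or there exists a Whitehead transform $Y'$ of $Y$ such that $h(Y')=h(Y)$ and $\operatorname{d}(X,Y')<\operatorname{d}(X,Y)$.
   Context: Throughout, $F$ is a free group of finite rank, and $\mathbb{N}=\{0,1,2,\ldots\}$. An $F$-basis is a free-generating set of $F$. For an $F$-basis $X$, write $X^{\pm1}:=X\cup X^{-1}$. **Words and lengths.** A straight word in $F$ is an element of $F$. A cyclic word in $F$ is the $F$-conjugacy class of an element of $F$. A word in $F$ is a straight-or-cyclic word in $F$. Let $Z$ be an $F$-basis. A finite sequence $(z_1,\ldots,z_\ell)$ of elements of $Z^{\pm1}$ ($\ell\ge 0$) is reduced if $z_i\neq z_{i-1}^{-1}$ for all $i\in\{2,\ldots,\ell\}$, and cyclically reduced if $(z_1,\ldots,z_\ell,z_1,\ldots,z_\ell)$ is reduced. For a straight word $r$, $Z\text{-length}(r)$ is the length $\ell$ of the unique reduced $Z^{\pm1}$-sequence $(z_1,\ldots,z_\ell)$ with $z_1\cdots z_\ell=r$. For a cyclic word $r$, $Z\text{-length}(r)$ is the length $\ell$ of any cyclically reduced $Z^{\pm1}$-sequence $(z_1,\ldots,z_\ell)$ with $z_1\cdots z_\ell\in r$ (such a sequence exists and is unique up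 to cyclic permutation). **Whitehead transforms and local minima.** For $F$-bases $X$ and $X'$, $X'$ is a Whitehead transform of $X$ if there exists $x\in X^{\pm1}$ such that $X'\subseteq\{1,x\}\cdot X\cdot\{1,x^{-1}\}$ (the set of products $a\,w\,b$ with $a\in\{1,x\}$, $w\in X$, $b\in\{1,x^{-1}\}$). An $F$-basis $X$ is a local-minimum point for $h$ if $h(X)\le h(X')$ for each Whitehead transform $X'$ of $X$. **Graphs.** Graphs have a vertex-set and an edge-set, each edge $e$ having an initial vertex $\iota e$ and a terminal vertex $\tau e$; paths may traverse edges in either direction. A tree is a nonempty graph in which any two vertices are joined by a unique reduced path (equivalently, a nonempty connected graph without cycles). Let $X,Y$ be $F$-bases and let $V\subseteq F$. - $\Gamma_X(V)$ is the graph with vertex-set $V$ and with one edge from $v$ to $xv$ for each pair $(x,v)\in X\times V$ with $xv\in V$. - $\Gamma^Y(V)$ is the graph with vertex-set $V$ and with one edge from $v$ to $vy$ for each pair $(v,y)\in V\times Y$ with $vy\in V$. - $\Gamma_X^Y(V)$ is the graph with vertex-set $V$ whose edge-set is the disjoint union of the edge-sets of $\Gamma_X(V)$ and $\Gamma^Y(V)$. The valence of a vertex $v$ in $\Gamma_X^Y(V)$ is the number of oriented edges (edges and formal inverses of edges) starting at $v$; that is, it equals $|\{x\in X^{\pm1}: xv\in V\}|+|\{y\in Y^{\pm1}: vy\in V\}|$. **Translators and $\operatorname{d}(X,Y)$.** A subset $V$ of $F$ is an $(X,Y)$-translator if $1\in V$, $V$ generates $F$, and both $\Gamma_X(V)$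 and $\Gamma^Y(V)$ are trees. For such $V$, let $(V)_{\ge3}$ denote the set of elements of $V\setminus\{1\}$ that have valence at least $3$ in $\Gamma_X^Y(V)$. One has $|V\setminus\{1\}|\ge\operatorname{rank}(F)$ for every $(X,Y)$-translator $V$, and $F$ itself is an $(X,Y)$-translator. Let $\kappa$ be the minimum of the cardinals $|V\setminus\{1\}|$ as $V$ ranges over all $(X,Y)$-translators. - If $\kappa>\operatorname{rank}(F)$, define $\operatorname{d}(X,Y):=\kappa$. - If $\kappa=\operatorname{rank}(F)$, define $\operatorname{d}(X,Y)$ to be the minimum of $|(V)_{\ge3}|$ as $V$ ranges over all $(X,Y)$-translators of cardinality $1+\operatorname{rank}(F)$. It is known (a lemma of Gersten) that $\operatorname{d}(X,Y)\in\mathbb{N}$, i.e. finite $(X,Y)$-translators exist. *)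

theory Defs
  imports "HOL-Algebra.Generated_Groups" "HOL-Library.Extended_Nat" "Graph_Theory.Arc_Walk"
begin

section \<open>Free groups and bases\<close>

definition letters :: "('a, 'b) monoid_scheme \<Rightarrow> 'a set \<Rightarrow> 'a set" where
  "letters F X = X \<union> set_inv\<^bsub>F\<^esub> X"

definition seq_prod :: "('a, 'b) monoid_scheme \<Rightarrow> 'a list \<Rightarrow> 'a" where
  "seq_prod F zs = foldr (\<otimes>\<^bsub>F\<^esub>) zs \<one>\<^bsub>F\<^esub>"

definition reduced_seq :: "('a, 'b) monoid_scheme \<Rightarrow> 'a set \<Rightarrow> 'a list \<Rightarrow> bool" where
  "reduced_seq F Z zs \<longleftrightarrow> set zs \<subseteq> letters F Z \<and> successively (\<lambda>a b. b \<noteq> inv\<^bsub>F\<^esub> a) zs"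

definition cyclically_reduced_seq :: "('a, 'b) monoid_scheme \<Rightarrow> 'a set \<Rightarrow> 'a list \<Rightarrow> bool" where
  "cyclically_reduced_seq F Z zs \<longleftrightarrow> reduced_seq F Z (zs @ zs)"

text \<open>
  A free-generating set: every element is the product of exactly one reduced sequence.
  Since the letters are taken to be elements of the group rather than formal symbols, one also
  has to demand that no letter is both a generator and the inverse of a generator; otherwise
  both \<open>{1, -1}\<close> in the integers and the generator of a group of order two would qualify.
\<close>

definition F_basis :: "('a, 'b) monoid_scheme \<Rightarrow> 'a set \<Rightarrow> bool" where
  "F_basis F X \<longleftrightarrow> X \<subseteq> carrier F \<and> X \<inter> set_inv\<^bsub>F\<^esub> X = {} \<and>
     bij_betw (seq_prod F) {zs. reduced_seq F X zs} (carrier F)"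

definition free_group_of_finite_rank :: "('a, 'b) monoid_scheme \<Rightarrow> bool" where
  "free_group_of_finite_rank F \<longleftrightarrow> group F \<and> (\<exists>B. finite B \<and> F_basis F B)"

definition free_rank :: "('a, 'b) monoid_scheme \<Rightarrow> nat" where
  "free_rank F = (THE n. \<exists>B. finite B \<and> F_basis F B \<and> card B = n)"


section \<open>Words and lengths\<close>

definition conjugacy_class :: "('a, 'b) monoid_scheme \<Rightarrow> 'a \<Rightarrow> 'a set" where
  "conjugacy_class F g = {h \<otimes>\<^bsub>F\<^esub> g \<otimes>\<^bsub>F\<^esub> inv\<^bsub>F\<^esub> h | h. h \<in> carrier F}"

datatype 'a fword = Straight 'a | Cyclic "'a set"

definition words :: "('a, 'b) monoid_scheme \<Rightarrow> 'a fword set" where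
  "words F = Straight ` carrier F \<union> (\<lambda>g. Cyclic (conjugacy_class F g)) ` carrier F"

fun word_length :: "('a, 'b) monoid_scheme \<Rightarrow> 'a set \<Rightarrow> 'a fword \<Rightarrow> nat" where
  "word_length F Z (Straight r) = length (THE zs. reduced_seq F Z zs \<and> seq_prod F zs = r)"
| "word_length F Z (Cyclic C) =
     (THE l. \<exists>zs. cyclically_reduced_seq F Z zs \<and> seq_prod F zs \<in> C \<and> length zs = l)"

definition total_length :: "('a, 'b) monoid_scheme \<Rightarrow> 'a fword set \<Rightarrow> 'a set \<Rightarrow> nat" where
  "total_length F R Z = (\<Sum>r\<in>R. word_length F Z r)"


section \<open>Whitehead transforms\<close>

text \<open>\<open>whitehead_transform F X X'\<close>: the basis \<open>X'\<close> is a Whitehead transform of the basis \<open>X\<close>.\<close>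

definition whitehead_transform :: "('a, 'b) monoid_scheme \<Rightarrow> 'a set \<Rightarrow> 'a set \<Rightarrow> bool" where
  "whitehead_transform F X X' \<longleftrightarrow> F_basis F X \<and> F_basis F X' \<and>
     (\<exists>x \<in> letters F X. X' \<subseteq> {\<one>\<^bsub>F\<^esub>, x} <#>\<^bsub>F\<^esub> X <#>\<^bsub>F\<^esub> {\<one>\<^bsub>F\<^esub>, inv\<^bsub>F\<^esub> x})"

definition local_minimum_point ::
    "('a, 'b) monoid_scheme \<Rightarrow> ('a set \<Rightarrow> nat) \<Rightarrow> 'a set \<Rightarrow> bool" where
  "local_minimum_point F h X \<longleftrightarrow> F_basis F X \<and>
     (\<forall>X'. whitehead_transform F X X' \<longrightarrow> h X \<le> h X')"


section \<open>Graphs\<close>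

text \<open>
  The library notions of walk, cycle and tree respect the orientation of arcs, whereas here paths
  may traverse edges backwards. Hence each edge \<open>e\<close> is replaced by the two oriented edges
  \<open>(e, True)\<close> and \<open>(e, False)\<close>, the latter being the formal inverse of \<open>e\<close>.
\<close>

definition oriented :: "('v, 'e) pre_digraph \<Rightarrow> ('v, 'e \<times> bool) pre_digraph" where
  "oriented G = \<lparr> verts = verts G, arcs = arcs G \<times> UNIV,
     tail = (\<lambda>(e, b). if b then tail G e else head G e),
     head = (\<lambda>(e, b). if b then head G e else tail G e) \<rparr>"

definition reduced_path ::
    "('v, 'e) pre_digraph \<Rightarrow> 'v \<Rightarrow> ('e \<times> bool) list \<Rightarrow> 'v \<Rightarrow> bool" where
  "reduced_path G u p v \<longleftrightarrow> pre_digraph.awalk (oriented G) u p v \<and>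
     successively (\<lambda>a b. b \<noteq> (fst a, \<not> snd a)) p"

definition is_tree :: "('v, 'e) pre_digraph \<Rightarrow> bool" where
  "is_tree G \<longleftrightarrow> verts G \<noteq> {} \<and> (\<forall>u \<in> verts G. \<forall>v \<in> verts G. \<exists>!p. reduced_path G u p v)"

definition valence :: "('v, 'e) pre_digraph \<Rightarrow> 'v \<Rightarrow> nat" where
  "valence G v = card (out_arcs (oriented G) v)"

definition left_graph ::
    "('a, 'b) monoid_scheme \<Rightarrow> 'a set \<Rightarrow> 'a set \<Rightarrow> ('a, 'a \<times> 'a) pre_digraph" where
  "left_graph F X V = \<lparr> verts = V, arcs = {(x, v) \<in> X \<times> V. x \<otimes>\<^bsub>F\<^esub> v \<in> V},
     tail = (\<lambda>(x, v). v), head = (\<lambda>(x, v). x \<otimes>\<^bsub>F\<^esub> v) \<rparr>"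

definition right_graph ::
    "('a, 'b) monoid_scheme \<Rightarrow> 'a set \<Rightarrow> 'a set \<Rightarrow> ('a, 'a \<times> 'a) pre_digraph" where
  "right_graph F Y V = \<lparr> verts = V, arcs = {(v, y) \<in> V \<times> Y. v \<otimes>\<^bsub>F\<^esub> y \<in> V},
     tail = (\<lambda>(v, y). v), head = (\<lambda>(v, y). v \<otimes>\<^bsub>F\<^esub> y) \<rparr>"

definition two_sided_graph ::
    "('a, 'b) monoid_scheme \<Rightarrow> 'a set \<Rightarrow> 'a set \<Rightarrow> 'a set \<Rightarrow>
     ('a, 'a \<times> 'a + 'a \<times> 'a) pre_digraph" where
  "two_sided_graph F X Y V = \<lparr> verts = V,
     arcs = arcs (left_graph F X V) <+> arcs (right_graph F Y V),
     tail = case_sum (tail (left_graph F X V)) (tail (right_graph F Y V)),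
     head = case_sum (head (left_graph F X V)) (head (right_graph F Y V)) \<rparr>"


section \<open>Translators\<close>

definition translators :: "('a, 'b) monoid_scheme \<Rightarrow> 'a set \<Rightarrow> 'a set \<Rightarrow> 'a set set" where
  "translators F X Y = {V. V \<subseteq> carrier F \<and> \<one>\<^bsub>F\<^esub> \<in> V \<and> generate F V = carrier F \<and>
     is_tree (left_graph F X V) \<and> is_tree (right_graph F Y V)}"

definition valence_ge_3 ::
    "('a, 'b) monoid_scheme \<Rightarrow> 'a set \<Rightarrow> 'a set \<Rightarrow> 'a set \<Rightarrow> 'a set" where
  "valence_ge_3 F X Y V = {v \<in> V - {\<one>\<^bsub>F\<^esub>}. 3 \<le> valence (two_sided_graph F X Y V) v}"

text \<open>
  A free group of finite rank is countable, so \<open>enat\<close> has a value for each cardinal that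
  can occur below.
\<close>

definition cardinal :: "'a set \<Rightarrow> enat" where
  "cardinal A = (if finite A then enat (card A) else \<infinity>)"

definition min_translator_card :: "('a, 'b) monoid_scheme \<Rightarrow> 'a set \<Rightarrow> 'a set \<Rightarrow> enat" where
  "min_translator_card F X Y = (INF V \<in> translators F X Y. cardinal (V - {\<one>\<^bsub>F\<^esub>}))"

text \<open>
  As \<open>enat\<close> is well-ordered, the infima are minima. The first branch is taken exactly when
  the minimal cardinal equals the rank, which is a lower bound for it.
\<close>

definition translator_dist :: "('a, 'b) monoid_scheme \<Rightarrow> 'a set \<Rightarrow> 'a set \<Rightarrow> enat" where
  "translator_dist F X Y =
     (if min_translator_card F X Y = enat (free_rank F)
      then INF V \<in> {V \<in> translators F X Y. cardinal V = enat (1 + free_rank F)}.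
             cardinal (valence_ge_3 F X Y V)
      else min_translator_card F X Y)"

end

theory Submission
  imports Defs
begin

text \<open>
  A translator \<open>V\<close> carries two trees, and every word in \<open>R\<close> is represented by a closed path in their
  union whose left and right labels are both reduced. Hence counting traversals assigns weights to
  the edges such that those of the left edges add up to \<open>h(X)\<close> and those of the right edges to \<open>h(Y)\<close>.

  Suppose first that \<open>V\<close> is minimal of more than \<open>1 + rank F\<close> elements. Then some letter labels
  several left edges; these form a tree, and a leaf of it is a left edge \<open>D\<close> that lies in the tree of
  edges of a single letter \<open>y\<close> of \<open>Y\<close>. Cutting the left tree at \<open>D\<close> yields a Whitehead transform
  \<open>Y'\<close> of \<open>Y\<close>, a smaller translator for \<open>X\<close> and \<open>Y'\<close>, and \<open>h(Y') \<le> h(Y) - |E| + |D|\<close> with a right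
  edge \<open>E\<close> that is a leaf in the same sense. As \<open>Y\<close> is a local minimum, \<open>|E| \<le> |D|\<close>. With the roles
  of \<open>X\<close> and \<open>Y\<close> exchanged, \<open>E\<close> leads to a leaf \<open>D'\<close> with \<open>|D'| \<le> |E|\<close>. So if \<open>D\<close> has least weight
  among the leaves, then \<open>h(Y') = h(Y)\<close>.

  If \<open>V\<close> has \<open>1 + rank F\<close> elements, then every letter labels exactly one edge, and the same argument
  applies to the edges between \<open>1\<close> and the vertices of valence at least three: the exchange contracts
  one of them and creates a vertex of valence two.
\<close>

section \<open>Reduced words\<close>

text \<open>The weights have to serve the exchanges on both sides, so one loop per word must measure
  both lengths at once. It is a loop with the fewest steps in all: a cancellation on one side can be
  cut short because the other tree is convex, and inversion preserves the number of steps.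

  An exchange only has to bound \<open>h(Y')\<close> from above. The loop is rewritten as a word in
  \<open>Y'\<close> that need not be reduced; the reverse inequality is the assumption on
  \<open>Y\<close>.

  The two sides of the cut are translated on the right by different elements. This respects all left
  edges but the one that is cut, and it gives a letter of \<open>Y\<close> a well-defined new value
  if all its edges start on the same side. The edges of a letter form a subtree of the other tree,
  because their initial vertices are the intersection of two subtrees. So they can meet both sides
  only if this subtree contains the edge to be cut, and for a leaf this happens for a single letter.

  That finite translators exist at all (Gersten's lemma) is proved by means of Guirardel's
  core.\<close>

definition word :: "('a, 'b) monoid_scheme \<Rightarrow> 'a set \<Rightarrow> 'a \<Rightarrow> 'a list" where
  "word F Z g = (THE zs. reduced_seq F Z zs \<and> seq_prod F zs = g)"

context group
begin

lemma mult_inv_cancel [simp]: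
  assumes "a \<in> carrier G" "b \<in> carrier G"
  shows "inv a \<otimes> (a \<otimes> b) = b" and "a \<otimes> (inv a \<otimes> b) = b"
  using assms by (simp_all add: m_assoc [symmetric])

lemma set_inv_iff: "z \<in> set_inv X \<longleftrightarrow> (\<exists>x\<in>X. z = inv x)"
  by (auto simp: SET_INV_def)

lemma basis_subset: "F_basis G Z \<Longrightarrow> Z \<subseteq> carrier G"
  by (simp add: F_basis_def)

lemma letters_subset: "Z \<subseteq> carrier G \<Longrightarrow> letters G Z \<subseteq> carrier G"
  unfolding letters_def set_inv_iff subset_iff Un_iff by (metis inv_closed)

lemma letter_closed: "F_basis G Z \<Longrightarrow> z \<in> letters G Z \<Longrightarrow> z \<in> carrier G"
  using letters_subset basis_subset by blast

lemma inv_letter: "F_basis G Z \<Longrightarrow> z \<in> letters G Z \<Longrightarrow> inv z \<in> letters G Z"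
  using basis_subset by (fastforce simp: letters_def set_inv_iff)

lemma inv_letter_iff: "F_basis G Z \<Longrightarrow> z \<in> carrier G \<Longrightarrow> inv z \<in> letters G Z \<longleftrightarrow> z \<in> letters G Z"
  using inv_letter [of Z z] inv_letter [of Z "inv z"] by auto

lemma inv_letter_neq:
  assumes Z: "F_basis G Z" and z: "z \<in> letters G Z"
  shows "inv z \<noteq> z"
proof
  assume eq: "inv z = z"
  have "z \<in> Z \<and> z \<in> set_inv Z"
    using z eq basis_subset [OF Z] by (auto simp: letters_def set_inv_iff) (metis eq)+
  then show False using Z by (auto simp: F_basis_def)
qed

lemma one_not_letter: "F_basis G Z \<Longrightarrow> \<one> \<notin> letters G Z"
  using inv_letter_neq by fastforce

lemma seq_prod_Nil [simp]: "seq_prod G [] = \<one>"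
  and seq_prod_Cons [simp]: "seq_prod G (z # zs) = z \<otimes> seq_prod G zs"
  by (simp_all add: seq_prod_def)

lemma seq_prod_closed [simp]: "set zs \<subseteq> carrier G \<Longrightarrow> seq_prod G zs \<in> carrier G"
  by (induction zs) auto

lemma seq_prod_append:
  "set xs \<subseteq> carrier G \<Longrightarrow> set ys \<subseteq> carrier G \<Longrightarrow>
    seq_prod G (xs @ ys) = seq_prod G xs \<otimes> seq_prod G ys"
  by (induction xs) (auto simp: m_assoc)

lemma seq_prod_inv:
  "set zs \<subseteq> carrier G \<Longrightarrow> inv (seq_prod G zs) = seq_prod G (rev (map (\<lambda>z. inv z) zs))"
proof (induction zs)
  case (Cons z zs)
  have "set (rev (map (\<lambda>z. inv z) zs)) \<subseteq> carrier G" using Cons.prems by auto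
  then show ?case using Cons by (simp add: inv_mult_group seq_prod_append)
qed simp

lemma reduced_seq_letters: "reduced_seq G Z zs \<Longrightarrow> set zs \<subseteq> letters G Z"
  by (simp add: reduced_seq_def)

lemma reduced_seq_carrier: "F_basis G Z \<Longrightarrow> reduced_seq G Z zs \<Longrightarrow> set zs \<subseteq> carrier G"
  using letters_subset basis_subset reduced_seq_letters by blast

lemma reduced_seq_Nil [simp]: "reduced_seq G Z []"
  by (simp add: reduced_seq_def)

lemma reduced_seq_append_iff:
  "reduced_seq G Z (xs @ ys) \<longleftrightarrow> reduced_seq G Z xs \<and> reduced_seq G Z ys \<and>
    (xs \<noteq> [] \<longrightarrow> ys \<noteq> [] \<longrightarrow> hd ys \<noteq> inv (last xs))"
  by (auto simp: reduced_seq_def successively_append_iff)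

lemma reduced_seq_snoc_iff:
  "reduced_seq G Z (xs @ [z]) \<longleftrightarrow>
    reduced_seq G Z xs \<and> z \<in> letters G Z \<and> (xs \<noteq> [] \<longrightarrow> z \<noteq> inv (last xs))"
  by (auto simp: reduced_seq_append_iff) (auto simp: reduced_seq_def)

lemma reduced_seq_butlast: "reduced_seq G Z zs \<Longrightarrow> reduced_seq G Z (butlast zs)"
  by (cases zs rule: rev_cases) (auto simp: reduced_seq_append_iff)

lemma reduced_seq_take: "reduced_seq G Z zs \<Longrightarrow> reduced_seq G Z (take n zs)"
  by (metis append_take_drop_id reduced_seq_append_iff)

lemma reduced_seq_rev_inv:
  assumes Z: "F_basis G Z" and "reduced_seq G Z zs"
  shows "reduced_seq G Z (rev (map (\<lambda>z. inv z) zs))"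
  using assms(2)
proof (induction zs)
  case (Cons z zs)
  have z: "z \<in> letters G Z" and zs: "reduced_seq G Z zs"
    using Cons.prems reduced_seq_append_iff [of Z "[z]" zs] by (auto simp: reduced_seq_def)
  have "inv z \<noteq> inv (last (rev (map (\<lambda>z. inv z) zs)))" if "zs \<noteq> []"
  proof -
    have "hd zs \<in> carrier G" "hd zs \<noteq> inv z"
      using that Cons.prems reduced_seq_append_iff [of Z "[z]" zs] reduced_seq_carrier [OF Z zs]
      by auto
    then show ?thesis using that letter_closed [OF Z z]
      by (auto simp: last_rev hd_map)
  qed
  then show ?case using Cons.IH [OF zs] inv_letter [OF Z z] 
    by (auto simp: reduced_seq_snoc_iff)
qed simp

lemma word_unique:
  assumes "F_basis G Z" "reduced_seq G Z zs"
  shows "word G Z (seq_prod G zs) = zs"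
  unfolding word_def using assms
  by (intro the_equality) (auto simp: F_basis_def bij_betw_def inj_on_def)

lemma word_exists:
  assumes "F_basis G Z" "g \<in> carrier G"
  obtains zs where "reduced_seq G Z zs" "seq_prod G zs = g"
proof -
  have "g \<in> seq_prod G ` {zs. reduced_seq G Z zs}"
    using assms by (simp add: F_basis_def bij_betw_def)
  then show ?thesis using that by blast
qed

lemma word_eqI: "F_basis G Z \<Longrightarrow> reduced_seq G Z zs \<Longrightarrow> seq_prod G zs = g \<Longrightarrow> word G Z g = zs"
  using word_unique by blast

lemma word_reduced: "F_basis G Z \<Longrightarrow> g \<in> carrier G \<Longrightarrow> reduced_seq G Z (word G Z g)"
  by (metis word_exists word_unique)

lemma word_prod [simp]: "F_basis G Z \<Longrightarrow> g \<in> carrier G \<Longrightarrow> seq_prod G (word G Z g) = g"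
  by (metis word_exists word_unique)

lemma word_letters: "F_basis G Z \<Longrightarrow> g \<in> carrier G \<Longrightarrow> set (word G Z g) \<subseteq> letters G Z"
  using word_reduced reduced_seq_letters by blast

lemma word_carrier: "F_basis G Z \<Longrightarrow> g \<in> carrier G \<Longrightarrow> set (word G Z g) \<subseteq> carrier G"
  using word_reduced reduced_seq_carrier by blast

lemma word_one [simp]: "F_basis G Z \<Longrightarrow> word G Z \<one> = []"
  by (rule word_eqI) auto

lemma word_letter [simp]: "F_basis G Z \<Longrightarrow> z \<in> letters G Z \<Longrightarrow> word G Z z = [z]"
  by (rule word_eqI) (auto simp: reduced_seq_def letter_closed)

lemma word_Nil_iff: "F_basis G Z \<Longrightarrow> g \<in> carrier G \<Longrightarrow> word G Z g = [] \<longleftrightarrow> g = \<one>"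
  by (metis word_one word_prod seq_prod_Nil)

lemma word_inv:
  assumes Z: "F_basis G Z" and g: "g \<in> carrier G"
  shows "word G Z (inv g) = rev (map (\<lambda>z. inv z) (word G Z g))"
  using assms by (intro word_eqI)
    (auto simp: reduced_seq_rev_inv word_reduced seq_prod_inv [symmetric] word_carrier)

lemma length_word_inv [simp]:
  "F_basis G Z \<Longrightarrow> g \<in> carrier G \<Longrightarrow> length (word G Z (inv g)) = length (word G Z g)"
  by (simp add: word_inv)

text \<open>Words are handled one letter at a time: a further letter either cancels the last one or
  extends the word. Many later facts on products follow from this by induction on the second
  factor.\<close>

lemma word_mult_letter:
  assumes Z: "F_basis G Z" and g: "g \<in> carrier G" and z: "z \<in> letters G Z"
  shows "word G Z (g \<otimes> z) =
    (if word G Z g \<noteq> [] \<and> last (word G Z g) = inv z then butlast (word G Z g) else word G Z g @ [z])"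
proof -
  have zc: "z \<in> carrier G" using letter_closed [OF Z z] .
  let ?w = "word G Z g"
  have r: "reduced_seq G Z ?w" and p: "seq_prod G ?w = g" and c: "set ?w \<subseteq> carrier G"
    using word_reduced word_carrier Z g by auto
  show ?thesis
  proof (cases "?w \<noteq> [] \<and> last ?w = inv z")
    case True
    then have w: "?w = butlast ?w @ [inv z]" by (metis append_butlast_last_id)
    have b: "set (butlast ?w) \<subseteq> carrier G" using c by (auto dest: in_set_butlastD)
    have "g = seq_prod G (butlast ?w) \<otimes> inv z"
      using p w b zc by (metis seq_prod_append seq_prod_Cons seq_prod_Nil inv_closed r_one
          empty_set empty_subsetI insert_subset list.simps(15))
    then have "g \<otimes> z = seq_prod G (butlast ?w)" using b zc
      by (metis inv_closed l_inv m_assoc r_one seq_prod_closed)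
    then show ?thesis using True reduced_seq_butlast [OF r] word_eqI Z by simp
  next
    case False
    moreover have "last ?w \<in> carrier G" if "?w \<noteq> []" using c that last_in_set by blast
    ultimately have "reduced_seq G Z (?w @ [z])" using r z zc
      by (auto simp: reduced_seq_snoc_iff)
    moreover have "seq_prod G (?w @ [z]) = g \<otimes> z" using c zc p by (simp add: seq_prod_append)
    ultimately have "word G Z (g \<otimes> z) = ?w @ [z]" by (rule word_eqI [OF Z])
    then show ?thesis using False by auto
  qed
qed

lemma length_seq_prod_le:
  assumes Z: "F_basis G Z" 
  shows "set zs \<subseteq> letters G Z \<Longrightarrow> length (word G Z (seq_prod G zs)) \<le> length zs"
proof (induction zs rule: rev_induct)
  case (snoc z zs)
  have c: "set zs \<subseteq> carrier G" "z \<in> carrier G" using snoc.prems letter_closed [OF Z] by auto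
  have "length (word G Z (seq_prod G zs \<otimes> z)) \<le> Suc (length (word G Z (seq_prod G zs)))"
    using word_mult_letter [OF Z seq_prod_closed [OF c(1)]] snoc.prems by auto
  then show ?case using snoc c by (simp add: seq_prod_append)
qed (use Z in simp)

lemma length_word_mult_le:
  assumes Z: "F_basis G Z" and "g \<in> carrier G" "h \<in> carrier G"
  shows "length (word G Z (g \<otimes> h)) \<le> length (word G Z g) + length (word G Z h)"
  using length_seq_prod_le [OF Z, of "word G Z g @ word G Z h"] word_letters [OF Z] word_carrier [OF Z] 
    assms by (simp add: seq_prod_append)

lemma word_mult_reduced:
  assumes Z: "F_basis G Z" and g: "g \<in> carrier G" and h: "h \<in> carrier G"
    and "word G Z g = [] \<or> word G Z h = [] \<or> hd (word G Z h) \<noteq> inv (last (word G Z g))"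
  shows "word G Z (g \<otimes> h) = word G Z g @ word G Z h"
  using assms word_carrier [OF Z g] word_carrier [OF Z h]
  by (intro word_eqI) (auto simp: reduced_seq_append_iff word_reduced seq_prod_append)

text \<open>Cancellation by \<open>h\<close> reaches at most \<open>length (word G Z h)\<close>
  letters into \<open>g\<close>, so the first one survives.\<close>

lemma hd_word_mult:
  assumes Z: "F_basis G Z" and g: "g \<in> carrier G" and h: "h \<in> carrier G"
    and less: "length (word G Z h) < length (word G Z g)"
  shows "hd (word G Z (g \<otimes> h)) = hd (word G Z g)"
proof -
  \<comment> \<open>The length bound is carried along: before each letter at least two letters of
    the product remain, so \<open>butlast\<close> keeps the head.\<close>
  have *: "hd (word G Z (g \<otimes> seq_prod G zs)) = hd (word G Z g) \<and>
      length (word G Z g) \<le> length (word G Z (g \<otimes> seq_prod G zs)) + length zs"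
    if "set zs \<subseteq> letters G Z" "length zs < length (word G Z g)" for zs
    using that
  proof (induction zs rule: rev_induct)
    case (snoc z zs)
    have c: "set zs \<subseteq> carrier G" "z \<in> carrier G" using snoc.prems letter_closed [OF Z] by auto
    let ?u = "g \<otimes> seq_prod G zs"
    have u: "?u \<in> carrier G" using g c by simp
    have eq: "g \<otimes> seq_prod G (zs @ [z]) = ?u \<otimes> z"
      using g c by (simp add: seq_prod_append m_assoc)
    have IH: "hd (word G Z ?u) = hd (word G Z g)"
      "length (word G Z g) \<le> length (word G Z ?u) + length zs" using snoc by auto
    have len: "length (word G Z ?u) \<ge> 2" using IH snoc.prems by auto
    have "hd (word G Z (?u \<otimes> z)) = hd (word G Z ?u) \<and>
        length (word G Z ?u) \<le> Suc (length (word G Z (?u \<otimes> z)))"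
      using word_mult_letter [OF Z u] snoc.prems len
      by (cases "word G Z ?u"; cases "tl (word G Z ?u)") auto
    then show ?case using IH eq by auto
  qed (use g in simp)
  show ?thesis using * [OF word_letters [OF Z h] less] Z h by simp
qed

end

section \<open>Connected subsets of Cayley trees\<close>

definition adj :: "('a, 'b) monoid_scheme \<Rightarrow> 'a set \<Rightarrow> 'a set \<Rightarrow> ('a \<times> 'a) set" where
  "adj F Z V = {(u, v). u \<in> V \<and> v \<in> V \<and> (\<exists>z\<in>letters F Z. v = u \<otimes>\<^bsub>F\<^esub> z)}"

text \<open>A subset of the Cayley tree of a basis spans a tree as soon as it is connected, because
  the Cayley graph has no cycles. So this predicate can replace \<open>is_tree\<close>, see
  \<open>is_tree_iff_conn\<close>.\<close>

definition conn :: "('a, 'b) monoid_scheme \<Rightarrow> 'a set \<Rightarrow> 'a set \<Rightarrow> bool" where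
  "conn F Z V \<longleftrightarrow> (\<forall>u\<in>V. \<forall>v\<in>V. (u, v) \<in> (adj F Z V)\<^sup>*)"

text \<open>Edges labelled \<open>z\<close>, recorded by their initial vertices. For an inverse
  letter these are the terminal vertices of the edges of the letter itself, see
  \<open>ends_inv\<close>.\<close>

definition ends :: "('a, 'b) monoid_scheme \<Rightarrow> 'a set \<Rightarrow> 'a \<Rightarrow> 'a set" where
  "ends F V z = {v \<in> V. v \<otimes>\<^bsub>F\<^esub> z \<in> V}"

context group
begin

lemma sym_adj:
  assumes "F_basis G Z" "V \<subseteq> carrier G"
  shows "sym (adj G Z V)"
  unfolding sym_def adj_def
proof clarsimp
  fix u z assume "u \<in> V" "z \<in> letters G Z"
  then have "inv z \<in> letters G Z" "u = u \<otimes> z \<otimes> inv z"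
    using assms inv_letter letter_closed by (auto simp: m_assoc subset_iff)
  then show "\<exists>za\<in>letters G Z. u = u \<otimes> z \<otimes> za" by blast
qed

text \<open>Prefixes of the word of \<open>inv u \<otimes> v\<close> give the vertices on the
  geodesic from \<open>u\<close> to \<open>v\<close>. Follow any path in \<open>V\<close> from
  \<open>u\<close>: a step either drops the last letter of that word or appends one, and the vertex
  that is appended lies in \<open>V\<close>.\<close>

lemma conn_convex:
  assumes Z: "F_basis G Z" and V: "V \<subseteq> carrier G" and "conn G Z V" and u: "u \<in> V" and "v \<in> V"
  shows "u \<otimes> seq_prod G (take n (word G Z (inv u \<otimes> v))) \<in> V"
proof -
  have "(u, v) \<in> (adj G Z V)\<^sup>*" using assms by (simp add: conn_def)
  then show ?thesis
  proof (induction arbitrary: n)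
    case base
    then show ?case using u V Z by (auto simp: subset_iff)
  next
    case (step v v')
    then obtain z where z: "z \<in> letters G Z" "v' = v \<otimes> z" "v \<in> V" "v' \<in> V"
      by (auto simp: adj_def)
    have c: "u \<in> carrier G" "v \<in> carrier G" "z \<in> carrier G"
      using u V z letter_closed [OF Z] by auto
    let ?w = "word G Z (inv u \<otimes> v)"
    have eq: "inv u \<otimes> v' = inv u \<otimes> v \<otimes> z" using c z by (simp add: m_assoc)
    consider "word G Z (inv u \<otimes> v') = butlast ?w" | "word G Z (inv u \<otimes> v') = ?w @ [z]"
      unfolding eq using word_mult_letter [OF Z _ z(1), of "inv u \<otimes> v"] c by (simp split: if_splits)
    then show ?case
    proof cases
      case 1
      then show ?thesis using step.IH [of "min n (length ?w - 1)"]
        by (simp add: butlast_conv_take take_take)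
    next
      case 2
      show ?thesis
      proof (cases "n \<le> length ?w")
        case True
        then show ?thesis using 2 step.IH [of n] by simp
      next
        case False
        then have "length (word G Z (inv u \<otimes> v')) \<le> n" using 2 by simp
        moreover have "inv u \<otimes> v' \<in> carrier G" using c z by simp
        ultimately have "seq_prod G (take n (word G Z (inv u \<otimes> v'))) = inv u \<otimes> v'"
          using word_prod [OF Z] by simp
        then show ?thesis using z c by simp
      qed
    qed
  qed
qed

lemma conn_hd:
  assumes Z: "F_basis G Z" and V: "V \<subseteq> carrier G" and "conn G Z V" and u: "u \<in> V" and v: "v \<in> V"
    and "u \<noteq> v"
  shows "u \<otimes> hd (word G Z (inv u \<otimes> v)) \<in> V" and "hd (word G Z (inv u \<otimes> v)) \<in> letters G Z"
proof -
  have c: "u \<in> carrier G" "v \<in> carrier G" using u v V by auto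
  then have "inv u \<otimes> v \<noteq> \<one>" using \<open>u \<noteq> v\<close> by (metis inv_equality inv_inv inv_closed)
  then have ne: "word G Z (inv u \<otimes> v) \<noteq> []" using word_Nil_iff [OF Z] c by simp
  show l: "hd (word G Z (inv u \<otimes> v)) \<in> letters G Z"
    using word_letters [OF Z, of "inv u \<otimes> v"] c hd_in_set [OF ne] by auto
  have "take 1 (word G Z (inv u \<otimes> v)) = [hd (word G Z (inv u \<otimes> v))]"
    using ne by (cases "word G Z (inv u \<otimes> v)") auto
  then show "u \<otimes> hd (word G Z (inv u \<otimes> v)) \<in> V"
    using conn_convex [OF assms(1-5), of 1] letter_closed [OF Z l] c by simp
qed

text \<open>With \<open>u\<close> as root this is the parent of \<open>v\<close>. It is the first
  vertex on the geodesic back from \<open>v\<close>, since inverting a word exchanges its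
  ends.\<close>

lemma conn_last:
  assumes Z: "F_basis G Z" and V: "V \<subseteq> carrier G" and "conn G Z V" and u: "u \<in> V" and v: "v \<in> V"
    and "u \<noteq> v"
  shows "v \<otimes> inv (last (word G Z (inv u \<otimes> v))) \<in> V"
proof -
  have c: "u \<in> carrier G" "v \<in> carrier G" using u v V by auto
  then have uv: "inv u \<otimes> v \<in> carrier G" by simp
  have "inv u \<otimes> v \<noteq> \<one>" using c \<open>u \<noteq> v\<close> by (metis inv_equality inv_inv inv_closed)
  then have ne: "word G Z (inv u \<otimes> v) \<noteq> []" using word_Nil_iff [OF Z] c by simp
  have "hd (word G Z (inv v \<otimes> u)) = inv (last (word G Z (inv u \<otimes> v)))"
    using word_inv [OF Z uv] ne c by (simp add: inv_mult_group hd_rev last_map)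
  then show ?thesis using conn_hd(1) [OF assms(1-3) v u] \<open>u \<noteq> v\<close> by simp
qed

lemma conn_rootI:
  assumes Z: "F_basis G Z" and V: "V \<subseteq> carrier G" and u: "u \<in> V"
    and "\<And>v. v \<in> V \<Longrightarrow> (u, v) \<in> (adj G Z V)\<^sup>*"
  shows "conn G Z V"
  unfolding conn_def using assms(4) sym_rtrancl [OF sym_adj [OF Z V]]
  by (meson rtrancl_trans symD)

lemma adj_rtrancl_mono: "U \<subseteq> V \<Longrightarrow> (adj G Z U)\<^sup>* \<subseteq> (adj G Z V)\<^sup>*"
  by (rule rtrancl_mono) (auto simp: adj_def)

lemma length_word_parent:
  assumes Z: "F_basis G Z" and g: "g \<in> carrier G" and ne: "g \<noteq> \<one>"
  shows "word G Z (g \<otimes> inv (last (word G Z g))) = butlast (word G Z g)"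
    and "last (word G Z g) \<in> letters G Z"
    and "length (word G Z (g \<otimes> inv (last (word G Z g)))) < length (word G Z g)"
proof -
  have n: "word G Z g \<noteq> []" using word_Nil_iff [OF Z g] ne by simp
  show l: "last (word G Z g) \<in> letters G Z" using word_letters [OF Z g] last_in_set [OF n] by auto
  show b: "word G Z (g \<otimes> inv (last (word G Z g))) = butlast (word G Z g)"
    using word_mult_letter [OF Z g inv_letter [OF Z l]] n letter_closed [OF Z l] by simp
  show "length (word G Z (g \<otimes> inv (last (word G Z g)))) < length (word G Z g)"
    using n by (simp add: b)
qed

text \<open>Converse of \<open>conn_last\<close>: following parents shortens the word and so reaches
  the root. Several subtrees below are recognised by this closure property.\<close>

lemma conn_parentI:
  assumes Z: "F_basis G Z" and V: "V \<subseteq> carrier G" and u: "u \<in> V"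
    and parent: "\<And>v. v \<in> V \<Longrightarrow> v \<noteq> u \<Longrightarrow> v \<otimes> inv (last (word G Z (inv u \<otimes> v))) \<in> V"
  shows "conn G Z V"
proof (rule conn_rootI [OF Z V u])
  fix v assume "v \<in> V"
  then show "(u, v) \<in> (adj G Z V)\<^sup>*"
  proof (induction "length (word G Z (inv u \<otimes> v))" arbitrary: v rule: less_induct)
    case less
    show ?case
    proof (cases "v = u")
      case False
      have c: "u \<in> carrier G" "v \<in> carrier G" using u less.prems V by auto
      then have uv: "inv u \<otimes> v \<in> carrier G" "inv u \<otimes> v \<noteq> \<one>" using False
        by (simp, metis inv_equality inv_inv inv_closed)
      let ?l = "last (word G Z (inv u \<otimes> v))"
      have l: "?l \<in> letters G Z" and lc: "?l \<in> carrier G"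
        using length_word_parent(2) [OF Z uv] letter_closed [OF Z] by auto
      have p: "v \<otimes> inv ?l \<in> V" using parent less.prems False by blast
      have "length (word G Z (inv u \<otimes> (v \<otimes> inv ?l))) < length (word G Z (inv u \<otimes> v))"
        using length_word_parent(3) [OF Z uv] c lc by (simp add: m_assoc)
      then have "(u, v \<otimes> inv ?l) \<in> (adj G Z V)\<^sup>*" using less.hyps p by blast
      moreover have "(v \<otimes> inv ?l, v) \<in> adj G Z V"
        using p less.prems l lc c by (auto simp: adj_def m_assoc intro!: bexI [of _ ?l])
      ultimately show ?thesis by simp
    qed simp
  qed
qed

lemma conn_Int:
  assumes Z: "F_basis G Z" and V: "V \<subseteq> carrier G" "conn G Z V" and U: "U \<subseteq> carrier G" "conn G Z U"
  shows "conn G Z (V \<inter> U)"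
proof (cases "V \<inter> U = {}")
  case False
  then obtain u where u: "u \<in> V \<inter> U" by blast
  show ?thesis
    by (rule conn_parentI [OF Z _ u]) (use u V U conn_last [OF Z] in auto)
qed (simp add: conn_def)

lemma conn_left_translate:
  assumes g: "g \<in> carrier G" and V: "V \<subseteq> carrier G" "conn G Z V" and Z: "F_basis G Z"
  shows "conn G Z ((\<lambda>v. g \<otimes> v) ` V)"
proof -
  have "(g \<otimes> u, g \<otimes> v) \<in> (adj G Z ((\<lambda>v. g \<otimes> v) ` V))\<^sup>*" if "(u, v) \<in> (adj G Z V)\<^sup>*" for u v
    using that
  proof induction
    case (step y z)
    have "(g \<otimes> y, g \<otimes> z) \<in> adj G Z ((\<lambda>v. g \<otimes> v) ` V)"
      using step.hyps(2) g V Z letter_closed by (fastforce simp: adj_def m_assoc subset_iff)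
    then show ?case using step.IH by simp
  qed simp
  then show ?thesis using V by (auto simp: conn_def)
qed

lemma ends_inv:
  assumes "V \<subseteq> carrier G" "z \<in> carrier G"
  shows "ends G V (inv z) = (\<lambda>v. v \<otimes> z) ` ends G V z"
proof (intro equalityI subsetI)
  fix v assume "v \<in> ends G V (inv z)"
  then show "v \<in> (\<lambda>v. v \<otimes> z) ` ends G V z" using assms
    by (auto simp: ends_def m_assoc subset_iff intro!: image_eqI [of _ _ "v \<otimes> inv z"])
qed (use assms in \<open>auto simp: ends_def m_assoc subset_iff\<close>)

text \<open>A tree has one edge fewer than vertices: with root \<open>\<one>\<close>, each other
  vertex corresponds to the edge towards its parent (\<open>f\<close>), and each edge to its end
  with the longer word (\<open>g\<close>).\<close>

lemma card_edges:
  assumes Z: "F_basis G Z" and V: "V \<subseteq> carrier G" "conn G Z V" "\<one> \<in> V" and "finite V"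
  shows "card (SIGMA z:Z. ends G V z) = card (V - {\<one>})"
proof -
  \<comment> \<open>Edges carry labels from \<open>Z\<close> only. If the last letter of
    \<open>v\<close> is the inverse of such a label, the edge to the parent is recorded as starting
    at \<open>v\<close>.\<close>
  define f where "f v = (if last (word G Z v) \<in> Z then (last (word G Z v), v \<otimes> inv (last (word G Z v)))
    else (inv (last (word G Z v)), v))" for v
  define g where "g = (\<lambda>(z, v). if length (word G Z v) < length (word G Z (v \<otimes> z)) then v \<otimes> z else v)"
  have Zc: "\<And>z. z \<in> Z \<Longrightarrow> z \<in> carrier G" and Zl: "\<And>z. z \<in> Z \<Longrightarrow> z \<in> letters G Z"
    using basis_subset [OF Z] by (auto simp: letters_def)
  have disj: "inv z \<in> Z \<Longrightarrow> z \<in> Z \<Longrightarrow> False" for z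
    using Z set_inv_iff [of "inv z" Z] unfolding F_basis_def by blast
  have "bij_betw f (V - {\<one>}) (SIGMA z:Z. ends G V z)"
  proof (rule bij_betw_byWitness [where f' = g])
    show "\<forall>a\<in>V - {\<one>}. g (f a) = a"
    proof
      fix v assume v: "v \<in> V - {\<one>}"
      then have vc: "v \<in> carrier G" and ne: "v \<noteq> \<one>" using V by auto
      let ?l = "last (word G Z v)"
      note p = length_word_parent [OF Z vc ne]
      have lc: "?l \<in> carrier G" using p letter_closed Z by blast
      show "g (f v) = v" using p(3) vc lc by (simp add: f_def g_def m_assoc)
    qed
    show "\<forall>a\<in>SIGMA z:Z. ends G V z. f (g a) = a"
    proof clarify
      fix z v assume z: "z \<in> Z" and v: "v \<in> ends G V z"
      then have vc: "v \<in> carrier G" using V by (auto simp: ends_def)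
      note zc = Zc [OF z]
      note m = word_mult_letter [OF Z vc Zl [OF z]]
      show "f (g (z, v)) = (z, v)"
      proof (cases "word G Z v \<noteq> [] \<and> last (word G Z v) = inv z")
        case True
        then show ?thesis using m z zc disj by (auto simp: f_def g_def)
      next
        case False
        then show ?thesis using m z zc vc by (auto simp: f_def g_def m_assoc)
      qed
    qed
    show "f ` (V - {\<one>}) \<subseteq> (SIGMA z:Z. ends G V z)"
    proof (rule image_subsetI)
      fix v assume "v \<in> V - {\<one>}"
      then have v: "v \<in> V" "v \<noteq> \<one>" by auto
      then have vc: "v \<in> carrier G" using V by auto
      let ?l = "last (word G Z v)"
      note p = length_word_parent [OF Z vc v(2)]
      have lc: "?l \<in> carrier G" using p letter_closed Z by blast
      have "v \<otimes> inv ?l \<in> V" using conn_last [OF Z V v(1)] v vc by auto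
      moreover have "inv ?l \<in> Z" if "?l \<notin> Z"
        using that p(2) Zc by (auto simp: letters_def set_inv_iff)
      ultimately show "f v \<in> (SIGMA z:Z. ends G V z)"
        using v vc lc by (auto simp: f_def ends_def m_assoc)
    qed
    show "g ` (SIGMA z:Z. ends G V z) \<subseteq> V - {\<one>}"
    proof (rule image_subsetI)
      fix p assume "p \<in> (SIGMA z:Z. ends G V z)"
      then obtain z v where p: "p = (z, v)" and z: "z \<in> Z" and v: "v \<in> ends G V z" by blast
      then have vc: "v \<in> carrier G" using V by (auto simp: ends_def)
      have "v \<otimes> z \<noteq> \<one>" if "length (word G Z v) < length (word G Z (v \<otimes> z))"
        using that Z by auto
      moreover have "v \<noteq> \<one>" if "\<not> length (word G Z v) < length (word G Z (v \<otimes> z))"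
        using that Z Zl [OF z] Zc [OF z] by auto
      ultimately show "g p \<in> V - {\<one>}" using v by (auto simp: p g_def ends_def)
    qed
  qed
  then show ?thesis by (simp add: bij_betw_same_card)
qed

lemma sum_card_ends:
  assumes Z: "F_basis G Z" "finite Z" and V: "V \<subseteq> carrier G" "conn G Z V" "\<one> \<in> V" and "finite V"
  shows "(\<Sum>z\<in>Z. card (ends G V z)) = card (V - {\<one>})"
proof -
  have "card (SIGMA z:Z. ends G V z) = (\<Sum>z\<in>Z. card (ends G V z))"
    using assms by (intro card_SigmaI) (auto simp: ends_def)
  then show ?thesis using card_edges assms by simp
qed

section \<open>Generators and rank\<close>

lemma set_word_mult:
  assumes Z: "F_basis G Z" and g: "g \<in> carrier G" and h: "h \<in> carrier G"
  shows "set (word G Z (g \<otimes> h)) \<subseteq> set (word G Z g) \<union> set (word G Z h)"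
proof -
  have "set (word G Z (g \<otimes> seq_prod G zs)) \<subseteq> set (word G Z g) \<union> set zs"
    if "set zs \<subseteq> letters G Z" for zs
    using that
  proof (induction zs rule: rev_induct)
    case (snoc z zs)
    have c: "set zs \<subseteq> carrier G" "z \<in> carrier G" using snoc.prems letter_closed [OF Z] by auto
    have eq: "g \<otimes> seq_prod G (zs @ [z]) = g \<otimes> seq_prod G zs \<otimes> z"
      using g c by (simp add: seq_prod_append m_assoc)
    show ?case using snoc word_mult_letter [OF Z, of "g \<otimes> seq_prod G zs" z] g c
      unfolding eq by (auto dest: in_set_butlastD)
  qed (use g in simp)
  from this [OF word_letters [OF Z h]] show ?thesis using Z h by simp
qed

lemma generate_basis:
  assumes Z: "F_basis G Z"
  shows "generate G Z = carrier G"
proof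
  show "generate G Z \<subseteq> carrier G" using basis_subset [OF Z] by (rule generate_incl)
  have l: "z \<in> generate G Z" if "z \<in> letters G Z" for z
    using that generate.incl generate.inv by (force simp: letters_def set_inv_iff)
  have "seq_prod G zs \<in> generate G Z" if "set zs \<subseteq> letters G Z" for zs
    using that by (induction zs) (auto intro: generate.one generate.eng l)
  then show "carrier G \<subseteq> generate G Z" using word_letters [OF Z] word_prod [OF Z] by (metis subsetI)
qed

text \<open>The reduced word of a product uses only letters of its factors, so \<open>z\<close> can
  be generated only if the word of some generator contains it or its inverse.\<close>

lemma generate_word_support:
  assumes Z: "F_basis G Z" and A: "A \<subseteq> carrier G" and z: "z \<in> letters G Z"
    and "\<And>a. a \<in> A \<Longrightarrow> z \<notin> set (word G Z a) \<and> inv z \<notin> set (word G Z a)"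
  shows "z \<notin> generate G A"
proof -
  have zc: "z \<in> carrier G" using letter_closed [OF Z z] .
  have "g \<in> carrier G \<and> z \<notin> set (word G Z g) \<and> inv z \<notin> set (word G Z g)" if "g \<in> generate G A" for g
    using that
  proof induction
    case (inv a)
    then show ?case using assms word_inv [OF Z, of a] word_carrier [OF Z, of a] zc 
      by (auto simp: subset_iff dest!: inv_inv [symmetric])
  next
    case (eng g h)
    then show ?case using set_word_mult [OF Z, of g h] by blast
  qed (use assms in auto)
  then show ?thesis using z Z by fastforce
qed

text \<open>By \<open>generate_word_support\<close> every letter occurs, up to inversion, in one of
  finitely many finite words.\<close>

lemma basis_finite:
  assumes Z: "F_basis G Z" and A: "A \<subseteq> carrier G" "generate G A = carrier G" "finite A"
  shows "finite Z"
proof -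
  let ?S = "(\<Union>a\<in>A. set (word G Z a))"
  have "Z \<subseteq> ?S \<union> (\<lambda>z. inv z) ` ?S"
  proof
    fix z assume z: "z \<in> Z"
    then have l: "z \<in> letters G Z" and c: "z \<in> carrier G"
      using basis_subset [OF Z] by (auto simp: letters_def)
    have "z \<in> generate G A" using c A by simp
    then obtain a where a: "a \<in> A" "z \<in> set (word G Z a) \<or> inv z \<in> set (word G Z a)"
      using generate_word_support [OF Z A(1) l] by blast
    then show "z \<in> ?S \<union> (\<lambda>z. inv z) ` ?S" using c
      by (auto intro!: image_eqI [of z _ "inv z"])
  qed
  then show ?thesis using A(3) by (meson List.finite_set finite_UN finite_Un finite_imageI finite_subset)
qed

text \<open>These are homomorphisms to the group of order two, with inequality of truth values as
  addition.\<close>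

lemma hom_determined:
  assumes Z: "F_basis G Z" 
    and "\<And>g h. g \<in> carrier G \<Longrightarrow> h \<in> carrier G \<Longrightarrow> f (g \<otimes> h) = (f g \<noteq> (f h :: bool))"
    and "\<And>g h. g \<in> carrier G \<Longrightarrow> h \<in> carrier G \<Longrightarrow> f' (g \<otimes> h) = (f' g \<noteq> (f' h :: bool))"
    and "\<And>z. z \<in> Z \<Longrightarrow> f z = f' z" and g: "g \<in> carrier G"
  shows "f g = f' g"
proof -
  have zc: "z \<in> carrier G" if "z \<in> Z" for z using that basis_subset [OF Z] by auto
  have one: "f \<one> = f' \<one>" using assms(2,3) [of \<one> \<one>] by simp
  have "f (inv z) = f' (inv z)" if "z \<in> Z" for z
    using assms(2,3) [of z "inv z"] assms(4) [OF that] zc [OF that] one by auto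
  then have l: "f z = f' z" if "z \<in> letters G Z" for z
    using that assms(4) by (auto simp: letters_def set_inv_iff)
  have "f (seq_prod G zs) = f' (seq_prod G zs)" if "set zs \<subseteq> letters G Z" for zs
    using that
  proof (induction zs)
    case (Cons z zs)
    then have "z \<in> carrier G" "seq_prod G zs \<in> carrier G"
      using letters_subset [OF basis_subset [OF Z]] by auto
    then show ?case using Cons assms(2,3) l by simp
  qed (use one in simp)
  then show ?thesis using word_letters [OF Z g] word_prod [OF Z g] by metis
qed

text \<open>The rank is determined by the number \<open>2\<^sup>n\<close> of homomorphisms to the group of order two.\<close>

lemma card_homs_order_two:
  assumes Z: "F_basis G Z" and "finite Z"
  shows "card {f. (\<forall>g\<in>carrier G. \<forall>h\<in>carrier G. f (g \<otimes> h) = (f g \<noteq> (f h :: bool))) \<and>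
    (\<forall>g. g \<notin> carrier G \<longrightarrow> \<not> f g)} = 2 ^ card Z" (is "card ?H = _")
proof -
  have zc: "z \<in> carrier G" if "z \<in> Z" for z using that basis_subset [OF Z] by auto
  have "bij_betw (\<lambda>f. {z \<in> Z. f z}) ?H (Pow Z)"
  proof (rule bij_betw_imageI)
    show "inj_on (\<lambda>f. {z \<in> Z. f z}) ?H"
    proof (rule inj_onI, rule ext)
      fix f f' g assume "f \<in> ?H" "f' \<in> ?H" "{z \<in> Z. f z} = {z \<in> Z. f' z}"
      then show "f g = f' g"
        using hom_determined [OF Z, of f f' g] by (cases "g \<in> carrier G") auto
    qed
    show "(\<lambda>f. {z \<in> Z. f z}) ` ?H = Pow Z"
    proof (intro equalityI subsetI)
      fix S assume S: "S \<in> Pow Z"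
      define T where "T a \<longleftrightarrow> a \<in> S \<or> inv a \<in> S" for a
      \<comment> \<open>The homomorphism with prescribed values on \<open>Z\<close>: count the
        letters from \<open>S\<close> and their inverses modulo two. Cancellation removes two such
        letters or none, by \<open>T_inv\<close>.\<close>
      define f where "f g \<longleftrightarrow> g \<in> carrier G \<and> odd (length (filter T (word G Z g)))" for g
      have T_inv: "T (inv a) = T a" if "a \<in> carrier G" for a using that by (auto simp: T_def)
      have step: "f (g \<otimes> z) = (f g \<noteq> T z)" if g: "g \<in> carrier G" and z: "z \<in> letters G Z" for g z
      proof -
        have c: "z \<in> carrier G" using z letter_closed [OF Z] by auto
        show ?thesis
        proof (cases "word G Z g \<noteq> [] \<and> last (word G Z g) = inv z")
          case True
          then have "word G Z g = butlast (word G Z g) @ [inv z]" by (metis append_butlast_last_id)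
          then have "length (filter T (word G Z g)) =
              length (filter T (butlast (word G Z g))) + length (filter T [inv z])"
            by (metis filter_append length_append)
          then show ?thesis using word_mult_letter [OF Z g z] True g c T_inv by (auto simp: f_def)
        next
          case False
          then show ?thesis using word_mult_letter [OF Z g z] g c by (auto simp: f_def)
        qed
      qed
      have "f (g \<otimes> seq_prod G zs) = (f g \<noteq> f (seq_prod G zs))"
        if "g \<in> carrier G" "set zs \<subseteq> letters G Z" for g zs
        using that
      proof (induction zs rule: rev_induct)
        case Nil
        then show ?case using Z by (simp add: f_def)
      next
        case (snoc z zs)
        then have c: "z \<in> carrier G" "set zs \<subseteq> carrier G" "z \<in> letters G Z"
          using letters_subset [OF basis_subset [OF Z]] by auto
        have "f (g \<otimes> seq_prod G zs \<otimes> z) = (f (g \<otimes> seq_prod G zs) \<noteq> T z)"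
          using snoc.prems c by (intro step) simp_all
        moreover have "f (seq_prod G zs \<otimes> z) = (f (seq_prod G zs) \<noteq> T z)"
          using snoc.prems c by (intro step) simp_all
        ultimately show ?case using snoc c by (auto simp: seq_prod_append m_assoc)
      qed
      then have "f (g \<otimes> h) = (f g \<noteq> f h)" if "g \<in> carrier G" "h \<in> carrier G" for g h
        using that word_letters [OF Z] word_prod [OF Z] by metis
      then have "f \<in> ?H" by (auto simp: f_def)
      moreover have "{z \<in> Z. f z} = S"
      proof -
        have "f z \<longleftrightarrow> z \<in> S" if z: "z \<in> Z" for z
        proof -
          have "inv z \<notin> S" using S z Z set_inv_iff [of "inv z" Z] unfolding F_basis_def by blast
          moreover have "word G Z z = [z]" using z Z by (simp add: letters_def)
          ultimately show ?thesis using zc [OF z] by (simp add: f_def T_def)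
        qed
        then show ?thesis using S by auto
      qed
      ultimately show "S \<in> (\<lambda>f. {z \<in> Z. f z}) ` ?H" by blast
    qed auto
  qed
  then show ?thesis using assms by (simp add: bij_betw_same_card card_Pow)
qed

lemma free_rank_eq:
  assumes "F_basis G Z" "finite Z"
  shows "free_rank G = card Z"
  unfolding free_rank_def
proof (rule the_equality)
  show "\<exists>B. finite B \<and> F_basis G B \<and> card B = card Z" using assms by blast
  fix n assume "\<exists>B. finite B \<and> F_basis G B \<and> card B = n"
  then obtain B where "finite B" "F_basis G B" "card B = n" by blast
  then have "(2 :: nat) ^ n = 2 ^ card Z"
    using card_homs_order_two [of B] card_homs_order_two [OF assms] by simp
  then show "n = card Z" by simp
qed

text \<open>Without an edge labelled \<open>z\<close>, a path in \<open>V\<close> from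
  \<open>\<one>\<close> never picks up \<open>z\<close> or its inverse. Conversely, an edge from
  \<open>v\<close> to \<open>v \<otimes> z\<close> exhibits \<open>z\<close> as a product of
  \<open>inv v\<close> and an element of \<open>V\<close>. In this form generation can be checked
  after an exchange.\<close>

lemma generate_iff_labels:
  assumes Z: "F_basis G Z" and V: "V \<subseteq> carrier G" "conn G Z V" "\<one> \<in> V"
  shows "generate G V = carrier G \<longleftrightarrow> (\<forall>z\<in>letters G Z. ends G V z \<noteq> {})"
proof
  assume gen: "generate G V = carrier G"
  show "\<forall>z\<in>letters G Z. ends G V z \<noteq> {}"
  proof (rule ballI, rule notI)
    fix z assume z: "z \<in> letters G Z" and empty: "ends G V z = {}"
    have zc: "z \<in> carrier G" using letter_closed [OF Z z] .
    have empty': "ends G V (inv z) = {}" using ends_inv [OF V(1) zc] empty by simp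
    have "z \<notin> set (word G Z v) \<and> inv z \<notin> set (word G Z v)" if "v \<in> V" for v
    proof -
      have "(\<one>, v) \<in> (adj G Z V)\<^sup>*" using V that by (simp add: conn_def)
      then show ?thesis
      proof induction
        case (step u v)
        then obtain a where a: "a \<in> letters G Z" "v = u \<otimes> a" "u \<in> V" "v \<in> V"
          by (auto simp: adj_def)
        have "a \<noteq> z" "a \<noteq> inv z" using a empty empty' by (auto simp: ends_def)
        then show ?case using step.IH set_word_mult [OF Z, of u a] a V Z letter_closed [OF Z a(1)]
          by auto
      qed (use Z in simp)
    qed
    then show False using generate_word_support [OF Z V(1) z] gen zc by blast
  qed
next
  assume labels: "\<forall>z\<in>letters G Z. ends G V z \<noteq> {}"
  have sub: "subgroup (generate G V) G" using V by (intro generate_is_subgroup)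
  have "Z \<subseteq> generate G V"
  proof
    fix z assume z: "z \<in> Z"
    then obtain v where v: "v \<in> V" "v \<otimes> z \<in> V" using labels by (auto simp: letters_def ends_def)
    then have "inv v \<otimes> (v \<otimes> z) \<in> generate G V"
      by (intro generate.eng generate.inv generate.incl) auto
    then show "z \<in> generate G V" using v z V basis_subset [OF Z] by (simp add: subset_iff)
  qed
  then have "generate G Z \<subseteq> generate G V" using sub by (intro generate_subgroup_incl)
  then show "generate G V = carrier G"
    using generate_basis [OF Z] generate_incl [OF V(1)] by auto
qed

end

section \<open>Finite translators\<close>

text \<open>Inversion turns left edges into right edges, so that only right Cayley trees are needed.\<close>

definition translator :: "('a, 'b) monoid_scheme \<Rightarrow> 'a set \<Rightarrow> 'a set \<Rightarrow> 'a set \<Rightarrow> bool" where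
  "translator F X Y V \<longleftrightarrow> V \<subseteq> carrier F \<and> \<one>\<^bsub>F\<^esub> \<in> V \<and> conn F Y V \<and>
    conn F X ((\<lambda>v. inv\<^bsub>F\<^esub> v) ` V) \<and> generate F V = carrier F"

text \<open>The half-tree at \<open>\<one>\<close> that remains when the branch beginning with
  \<open>z\<close> is removed.\<close>

definition not_from :: "('a, 'b) monoid_scheme \<Rightarrow> 'a set \<Rightarrow> 'a \<Rightarrow> 'a set" where
  "not_from F Z z = {g \<in> carrier F. word F Z g = [] \<or> hd (word F Z g) \<noteq> z}"

text \<open>
  The slice over \<open>1\<close> of the core (in the sense of Guirardel) of the product of the Cayley trees of
  \<open>X\<close> and \<open>Y\<close>, thickened by \<open>S\<close>: the vertices \<open>b\<close> such that every half-tree of \<open>Y\<close> at \<open>b\<close> meets the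
  \<open>S\<close>-neighbourhood of every half-tree of \<open>X\<close> at \<open>1\<close>.
\<close>

definition core :: "('a, 'b) monoid_scheme \<Rightarrow> 'a set \<Rightarrow> 'a set \<Rightarrow> 'a set \<Rightarrow> 'a set" where
  "core F X Y S = {b \<in> carrier F. \<forall>x\<in>letters F X. \<forall>y\<in>letters F Y.
     \<exists>g\<in>not_from F X x. \<exists>s\<in>S. \<exists>h\<in>not_from F Y y. b = g \<otimes>\<^bsub>F\<^esub> s \<otimes>\<^bsub>F\<^esub> inv\<^bsub>F\<^esub> h}"

context group
begin

abbreviation inverses :: "'a set \<Rightarrow> 'a set" where
  "inverses V \<equiv> (\<lambda>v. inv v) ` V"

lemma inverses_inverses [simp]:
  "V \<subseteq> carrier G \<Longrightarrow> inverses (inverses V) = V"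
  by (force simp: image_image)

lemma generate_inverses:
  assumes V: "V \<subseteq> carrier G"
  shows "generate G (inverses V) = generate G V"
proof -
  have *: "generate G (inverses U) \<subseteq> generate G U" if "U \<subseteq> carrier G" for U
    using that generate_is_subgroup [OF that]
    by (intro generate_subgroup_incl) (auto intro: generate.inv)
  have c: "inverses V \<subseteq> carrier G" using V by auto
  show ?thesis using * [OF V] * [OF c] V by simp
qed

lemma translator_swap: "translator G X Y V \<Longrightarrow> translator G Y X (inverses V)"
  by (auto simp: translator_def generate_inverses intro!: image_eqI [of \<one> _ \<one>])

text \<open>Inverting \<open>g \<otimes> s \<otimes> inv h\<close> exchanges the two half-trees. So
  left connectedness of the core reduces to \<open>conn_core\<close>.\<close>

lemma core_inv:
  assumes "S \<subseteq> carrier G"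
  shows "(\<lambda>b. inv b) ` core G X Y S \<subseteq> core G Y X ((\<lambda>s. inv s) ` S)"
proof (intro image_subsetI)
  fix b assume b: "b \<in> core G X Y S"
  show "inv b \<in> core G Y X ((\<lambda>s. inv s) ` S)"
    unfolding core_def
  proof (intro CollectI conjI ballI)
    fix y x assume "y \<in> letters G Y" "x \<in> letters G X"
    then obtain g s h where gsh: "g \<in> not_from G X x" "s \<in> S" "h \<in> not_from G Y y"
      "b = g \<otimes> s \<otimes> inv h" using b unfolding core_def by blast
    then have "inv b = h \<otimes> inv s \<otimes> inv g" using assms
      by (auto simp: not_from_def inv_mult_group m_assoc subset_iff)
    then show "\<exists>h\<in>not_from G Y y. \<exists>s'\<in>(\<lambda>s. inv s) ` S. \<exists>g\<in>not_from G X x. inv b = h \<otimes> s' \<otimes> inv g"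
      using gsh by blast
  qed (use b in \<open>auto simp: core_def\<close>)
qed

lemma core_inv_eq:
  assumes "S \<subseteq> carrier G"
  shows "(\<lambda>b. inv b) ` core G X Y S = core G Y X ((\<lambda>s. inv s) ` S)"
proof
  have "(\<lambda>s. inv s) ` S \<subseteq> carrier G" using assms by auto
  from core_inv [OF this, of Y X]
  have "(\<lambda>b. inv b) ` core G Y X ((\<lambda>s. inv s) ` S) \<subseteq> core G X Y S" using assms by simp
  then have "(\<lambda>b. inv b) ` (\<lambda>b. inv b) ` core G Y X ((\<lambda>s. inv s) ` S) \<subseteq> (\<lambda>b. inv b) ` core G X Y S"
    by blast
  then show "core G Y X ((\<lambda>s. inv s) ` S) \<subseteq> (\<lambda>b. inv b) ` core G X Y S"
    by (subst (asm) inverses_inverses) (auto simp: core_def)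
qed (rule core_inv [OF assms])

lemma subset_core:
  assumes X: "F_basis G X" and Y: "F_basis G Y" and S: "S \<subseteq> carrier G"
  shows "S \<subseteq> core G X Y S"
proof
  fix s assume "s \<in> S"
  moreover from this have "s \<in> carrier G" "s = \<one> \<otimes> s \<otimes> inv \<one>" using S by auto
  moreover have "\<one> \<in> not_from G X x" "\<one> \<in> not_from G Y x" for x
    using X Y by (simp_all add: not_from_def)
  ultimately show "s \<in> core G X Y S" unfolding core_def by blast
qed

text \<open>The core is closed under parents. At the parent of \<open>v\<close>, the half-tree that
  avoids the direction of \<open>v\<close> contains \<open>\<one>\<close>, which serves as witness.
  Any other half-tree there contains the one at \<open>v\<close> that points away from the parent,
  and its witness is reused.\<close>

lemma conn_core:
  assumes X: "F_basis G X" and Y: "F_basis G Y" and S: "S \<subseteq> carrier G" "\<one> \<in> S"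
  shows "conn G Y (core G X Y S)"
proof (rule conn_parentI [OF Y, of _ \<one>])
  show "core G X Y S \<subseteq> carrier G" by (auto simp: core_def)
  show "\<one> \<in> core G X Y S" using subset_core [OF X Y S(1)] S by blast
  fix v assume v: "v \<in> core G X Y S" and ne: "v \<noteq> \<one>"
  then have vc: "v \<in> carrier G" by (simp add: core_def)
  let ?l = "last (word G Y v)"
  let ?v = "v \<otimes> inv ?l"
  note p = length_word_parent [OF Y vc ne]
  have lc: "?l \<in> carrier G" using p letter_closed Y by blast
  have wdne: "word G Y v \<noteq> []" using word_Nil_iff [OF Y vc] ne by simp
  have "?v \<in> core G X Y S"
    unfolding core_def
  proof (intro CollectI conjI ballI)
    show "?v \<in> carrier G" using vc lc by simp
    fix x y assume x: "x \<in> letters G X" and y: "y \<in> letters G Y"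
    show "\<exists>g\<in>not_from G X x. \<exists>s\<in>S. \<exists>h\<in>not_from G Y y. ?v = g \<otimes> s \<otimes> inv h"
    proof (cases "y = ?l")
      case True
      have "butlast (word G Y v) \<noteq> [] \<Longrightarrow> ?l \<noteq> inv (last (butlast (word G Y v)))"
        using word_reduced [OF Y vc] reduced_seq_snoc_iff [of Y "butlast (word G Y v)" ?l] wdne by simp
      then have "inv ?v \<in> not_from G Y y"
        using word_inv [OF Y, of ?v] p vc lc True by (auto simp: not_from_def hd_rev last_map)
      moreover have "\<one> \<in> not_from G X x" using X by (simp add: not_from_def)
      moreover have "?v = \<one> \<otimes> \<one> \<otimes> inv (inv ?v)" using vc lc by simp
      ultimately show ?thesis using S by blast
    next
      case False
      obtain g s h where gsh: "g \<in> not_from G X x" "s \<in> S" "h \<in> not_from G Y (inv ?l)"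
        "v = g \<otimes> s \<otimes> inv h" using v x inv_letter [OF Y p(2)] unfolding core_def by blast
      then have c: "g \<in> carrier G" "s \<in> carrier G" "h \<in> carrier G" using S by (auto simp: not_from_def)
      have "word G Y (?l \<otimes> h) = [?l] @ word G Y h"
        using gsh(3) c lc Y p(2) by (subst word_mult_reduced) (auto simp: not_from_def)
      then have "?l \<otimes> h \<in> not_from G Y y" using False c lc by (simp add: not_from_def)
      moreover have "?v = g \<otimes> s \<otimes> inv (?l \<otimes> h)"
        using c lc unfolding gsh(4) [symmetric] by (subst gsh(4)) (simp add: m_assoc inv_mult_group)
      ultimately show ?thesis using gsh by blast
    qed
  qed
  then show "v \<otimes> inv (last (word G Y (inv \<one> \<otimes> v))) \<in> core G X Y S" using vc by simp
qed

lemma finite_letters: "finite Z \<Longrightarrow> finite (letters G Z)"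
  by (auto simp: letters_def SET_INV_def)

lemma finite_ball:
  assumes Z: "F_basis G Z" and fin: "finite Z"
  shows "finite {g \<in> carrier G. length (word G Z g) \<le> n}"
proof (rule finite_subset)
  show "{g \<in> carrier G. length (word G Z g) \<le> n} \<subseteq>
      seq_prod G ` {zs. set zs \<subseteq> letters G Z \<and> length zs \<le> n}"
    using word_letters [OF Z] word_prod [OF Z] by (auto intro!: image_eqI [of _ _ "word G Z _"])
  show "finite (seq_prod G ` {zs. set zs \<subseteq> letters G Z \<and> length zs \<le> n})"
    using finite_lists_length_le [OF finite_letters [OF fin]] by blast
qed

text \<open>
  Right multiplication by a bounded element changes the first \<open>X\<close>-letter only near \<open>1\<close>. Hence for
  all but finitely many \<open>b\<close>, the \<open>S\<close>-neighbourhood of the half-tree of \<open>Y\<close> at \<open>b\<close> pointing away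
  from \<open>1\<close> lies in a single half-tree of \<open>X\<close>.
\<close>

lemma finite_core:
  assumes X: "F_basis G X" "finite X" and Y: "F_basis G Y" "finite Y"
    and S: "S \<subseteq> carrier G" "finite S"
  shows "finite (core G X Y S)"
proof -
  let ?len = "\<lambda>g. length (word G X g)"
  have "finite (letters G Y \<union> S)" using finite_letters Y(2) S(2) by simp
  then have "finite (?len ` (letters G Y \<union> S))" by (rule finite_imageI)
  then obtain L where "\<forall>n\<in>?len ` (letters G Y \<union> S). n \<le> L"
    unfolding finite_nat_set_iff_bounded_le by blast
  then have L: "?len u \<le> L" if "u \<in> letters G Y \<union> S" for u using that by blast
  define Bad where "Bad = {g \<in> carrier G. ?len g \<le> L}"
  \<comment> \<open>Apart from \<open>\<one>\<close>, a core element is a prefix, as a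
    \<open>Y\<close>-word, of one of the finitely many elements whose \<open>X\<close>-word has
    length at most \<open>L\<close>.\<close>
  have "core G X Y S \<subseteq> insert \<one> ((\<lambda>(t, n). seq_prod G (take n (word G Y t))) ` (SIGMA t:Bad. {..length (word G Y t)}))"
  proof
    fix b assume b: "b \<in> core G X Y S"
    then have bc: "b \<in> carrier G" by (simp add: core_def)
    show "b \<in> insert \<one> ((\<lambda>(t, n). seq_prod G (take n (word G Y t))) ` (SIGMA t:Bad. {..length (word G Y t)}))"
    proof (rule ccontr)
      assume nb: "\<not> ?thesis"
      then have ne: "b \<noteq> \<one>" by simp
      let ?l = "last (word G Y b)"
      note p = length_word_parent [OF Y(1) bc ne]
      have lc: "?l \<in> carrier G" using p letter_closed Y by blast
      have wdne: "word G Y b \<noteq> []" using word_Nil_iff [OF Y(1) bc] ne by simp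
      \<comment> \<open>No cancellation takes place in this half-tree, so if
        \<open>b \<otimes> h\<close> were short in \<open>X\<close>, then \<open>b\<close> would be
        a \<open>Y\<close>-prefix of an element of \<open>Bad\<close>.\<close>
      have far: "L < ?len (b \<otimes> h)" if h: "h \<in> not_from G Y (inv ?l)" for h
      proof (rule ccontr)
        assume "\<not> ?thesis"
        then have "b \<otimes> h \<in> Bad" using bc h by (simp add: Bad_def not_from_def)
        moreover have "word G Y (b \<otimes> h) = word G Y b @ word G Y h"
          using h bc Y by (intro word_mult_reduced) (auto simp: not_from_def)
        then have "b = seq_prod G (take (length (word G Y b)) (word G Y (b \<otimes> h)))"
          "length (word G Y b) \<le> length (word G Y (b \<otimes> h))" using bc Y by auto
        ultimately show False using nb by force
      qed
      \<comment> \<open>Each step within the half-tree multiplies a long \<open>X\<close>-word by an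
        element of \<open>X\<close>-length at most \<open>L\<close>, so the first letter never
        changes.\<close>
      have same: "hd (word G X (b \<otimes> seq_prod G hs)) = hd (word G X b)"
        if "reduced_seq G Y hs" "hs = [] \<or> hd hs \<noteq> inv ?l" for hs
        using that
      proof (induction hs rule: rev_induct)
        case (snoc y hs)
        have y: "y \<in> letters G Y" and hs: "reduced_seq G Y hs" "hs = [] \<or> hd hs \<noteq> inv ?l"
          using snoc.prems by (auto simp: reduced_seq_snoc_iff hd_append split: if_splits)
        have c: "y \<in> carrier G" "set hs \<subseteq> carrier G"
          using y hs letter_closed reduced_seq_carrier Y by blast+
        have "seq_prod G hs \<in> not_from G Y (inv ?l)"
          using hs word_unique [OF Y(1) hs(1)] c by (auto simp: not_from_def)
        then have "?len y < ?len (b \<otimes> seq_prod G hs)" using far L y by (meson UnI1 le_less_trans)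
        then have "hd (word G X (b \<otimes> seq_prod G hs \<otimes> y)) = hd (word G X (b \<otimes> seq_prod G hs))"
          using c bc by (intro hd_word_mult X) auto
        then show ?case using snoc.IH hs c bc by (simp add: seq_prod_append m_assoc)
      qed (use bc in simp)
      have "\<one> \<in> not_from G Y (inv ?l)" using Y by (simp add: not_from_def)
      from far [OF this] have "word G X b \<noteq> []" using bc by auto
      then have "hd (word G X b) \<in> letters G X" using word_letters [OF X(1) bc] hd_in_set by blast
      \<comment> \<open>The core condition is applied to the first \<open>X\<close>-letter of
        \<open>b\<close> and to the half-tree pointing away from \<open>\<one>\<close>. The
        resulting \<open>g\<close> will turn out to begin with the very letter that it must
        avoid.\<close>
      then obtain g s h where gsh: "g \<in> not_from G X (hd (word G X b))" "s \<in> S"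
        "h \<in> not_from G Y (inv ?l)" "b = g \<otimes> s \<otimes> inv h"
        using b inv_letter [OF Y(1) p(2)] unfolding core_def by blast
      have c: "g \<in> carrier G" "s \<in> carrier G" "h \<in> carrier G" using gsh S by (auto simp: not_from_def)
      have g: "b \<otimes> h \<otimes> inv s = g" using c by (simp add: gsh(4) m_assoc)
      have hdbh: "hd (word G X (b \<otimes> h)) = hd (word G X b)"
        using same [of "word G Y h"] word_reduced [OF Y(1)] c gsh(3) Y by (auto simp: not_from_def)
      have "?len (inv s) < ?len (b \<otimes> h)"
        using far [OF gsh(3)] L [of s] gsh(2) c X by simp
      then have "hd (word G X g) = hd (word G X b)"
        using hd_word_mult [OF X(1), of "b \<otimes> h" "inv s"] hdbh c bc g by simp
      moreover have "word G X g \<noteq> []"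
      proof
        assume "word G X g = []"
        then have "g = \<one>" using word_Nil_iff X c by blast
        then have "b \<otimes> h = s" using g c bc by (metis inv_equality inv_inv inv_closed m_closed r_one m_assoc)
        then show False using far [OF gsh(3)] L [of s] gsh(2) by simp
      qed
      ultimately show False using gsh(1) by (simp add: not_from_def)
    qed
  qed
  note sub = this
  have "finite Bad" unfolding Bad_def by (rule finite_ball [OF X])
  then show ?thesis by (intro finite_subset [OF sub]) simp
qed

text \<open>Gersten's lemma. Thickening by a basis puts that basis into the core, so the core
  generates the group.\<close>

lemma finite_translator_exists:
  assumes X: "F_basis G X" "finite X" and Y: "F_basis G Y" "finite Y"
  obtains V where "translator G X Y V" "finite V"
proof
  let ?S = "insert \<one> X"
  have S: "?S \<subseteq> carrier G" "finite ?S" using basis_subset X by auto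
  have S': "(\<lambda>s. inv s) ` ?S \<subseteq> carrier G" "\<one> \<in> (\<lambda>s. inv s) ` ?S"
    using basis_subset X by (auto intro!: image_eqI [of \<one> _ \<one>])
  let ?V = "core G X Y ?S"
  have sub: "?S \<subseteq> ?V" using subset_core X Y S by blast
  have c: "?V \<subseteq> carrier G" by (auto simp: core_def)
  have "conn G X (inverses ?V)"
    using conn_core [OF Y(1) X(1) S'] core_inv_eq [OF S(1)] by simp
  moreover have "generate G ?V = carrier G"
  proof -
    have "generate G X \<subseteq> generate G ?V" using sub by (intro mono_generate) auto
    then show ?thesis using generate_basis [OF X(1)] generate_incl [OF c] by auto
  qed
  ultimately show "translator G X Y ?V" using conn_core [OF X(1) Y(1) S(1)] sub c by (simp add: translator_def)
  show "finite ?V" using finite_core X Y S by blast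
qed

end

section \<open>Automorphisms and bases\<close>

text \<open>The endomorphism with values \<open>\<phi>\<close> on the letters, inverse letters
  included; hence \<open>ext_mult\<close> asks \<open>\<phi>\<close> to respect inverses.\<close>

definition ext :: "('a, 'b) monoid_scheme \<Rightarrow> 'a set \<Rightarrow> ('a \<Rightarrow> 'a) \<Rightarrow> 'a \<Rightarrow> 'a" where
  "ext F Z \<phi> g = seq_prod F (map \<phi> (word F Z g))"

context group
begin

lemma ext_letter: "F_basis G Z \<Longrightarrow> z \<in> letters G Z \<Longrightarrow> \<phi> z \<in> carrier G \<Longrightarrow> ext G Z \<phi> z = \<phi> z"
  by (simp add: ext_def)

lemma ext_closed:
  assumes Z: "F_basis G Z" and "\<And>z. z \<in> letters G Z \<Longrightarrow> \<phi> z \<in> carrier G" and g: "g \<in> carrier G"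
  shows "ext G Z \<phi> g \<in> carrier G"
  unfolding ext_def
proof (rule seq_prod_closed)
  show "set (map \<phi> (word G Z g)) \<subseteq> carrier G" using assms(2) word_letters [OF Z g] by auto
qed

lemma ext_mult:
  assumes Z: "F_basis G Z" and \<phi>: "\<And>z. z \<in> letters G Z \<Longrightarrow> \<phi> z \<in> carrier G"
    and \<phi>_inv: "\<And>z. z \<in> letters G Z \<Longrightarrow> \<phi> (inv z) = inv (\<phi> z)"
    and g: "g \<in> carrier G" and h: "h \<in> carrier G"
  shows "ext G Z \<phi> (g \<otimes> h) = ext G Z \<phi> g \<otimes> ext G Z \<phi> h"
proof -
  have step: "ext G Z \<phi> (g \<otimes> z) = ext G Z \<phi> g \<otimes> \<phi> z" if g: "g \<in> carrier G" and z: "z \<in> letters G Z"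
    for g z
  proof -
    let ?w = "word G Z g"
    have c: "set (map \<phi> ?w) \<subseteq> carrier G" using \<phi> word_letters [OF Z g] by auto
    show ?thesis
    proof (cases "?w \<noteq> [] \<and> last ?w = inv z")
      case True
      let ?u = "seq_prod G (map \<phi> (butlast ?w))"
      have "?w = butlast ?w @ [inv z]" using True by (metis append_butlast_last_id)
      then have "map \<phi> ?w = map \<phi> (butlast ?w) @ [inv (\<phi> z)]"
        using \<phi>_inv [OF z] by (metis list.simps(8,9) map_append)
      moreover have b: "set (map \<phi> (butlast ?w)) \<subseteq> carrier G" using c by (auto dest: in_set_butlastD)
      ultimately have "ext G Z \<phi> g = ?u \<otimes> inv (\<phi> z)"
        using \<phi> [OF z] unfolding ext_def by (simp add: seq_prod_append)
      moreover have "?u \<in> carrier G" using b by (rule seq_prod_closed)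
      ultimately have "ext G Z \<phi> g \<otimes> \<phi> z = ?u" using \<phi> [OF z] by (simp add: m_assoc)
      moreover have "ext G Z \<phi> (g \<otimes> z) = ?u"
        using word_mult_letter [OF Z g z] True by (simp add: ext_def)
      ultimately show ?thesis by simp
    next
      case False
      then show ?thesis using word_mult_letter [OF Z g z] c \<phi> [OF z]
        by (auto simp: ext_def seq_prod_append)
    qed
  qed
  have "ext G Z \<phi> (g \<otimes> seq_prod G zs) = ext G Z \<phi> g \<otimes> seq_prod G (map \<phi> zs)"
    if "set zs \<subseteq> letters G Z" for zs
    using that
  proof (induction zs rule: rev_induct)
    case Nil
    then show ?case using g ext_closed [OF Z \<phi> g] by simp
  next
    case (snoc z zs)
    then have c: "z \<in> carrier G" "set zs \<subseteq> carrier G" "z \<in> letters G Z" "\<phi> z \<in> carrier G"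
      "set (map \<phi> zs) \<subseteq> carrier G"
      using letters_subset [OF basis_subset [OF Z]] \<phi> by auto
    have "g \<otimes> seq_prod G (zs @ [z]) = g \<otimes> seq_prod G zs \<otimes> z"
      using c g by (simp add: seq_prod_append m_assoc)
    then show ?case using snoc c g step [of "g \<otimes> seq_prod G zs" z] ext_closed [OF Z \<phi> g]
      by (simp add: seq_prod_append m_assoc)
  qed
  from this [OF word_letters [OF Z h]] show ?thesis using Z h by (simp add: ext_def)
qed

lemma basis_image:
  assumes Z: "F_basis G Z" and bij: "bij_betw f (carrier G) (carrier G)"
    and mult: "\<And>g h. g \<in> carrier G \<Longrightarrow> h \<in> carrier G \<Longrightarrow> f (g \<otimes> h) = f g \<otimes> f h"
  shows "F_basis G (f ` Z)" and "letters G (f ` Z) = f ` letters G Z"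
proof -
  have fc: "f g \<in> carrier G" if "g \<in> carrier G" for g using bij that by (auto simp: bij_betw_def)
  have inj: "f g = f h \<longleftrightarrow> g = h" if "g \<in> carrier G" "h \<in> carrier G" for g h
    using bij that by (auto simp: bij_betw_def inj_on_def)
  interpret f: group_hom G G f
    by unfold_locales (auto simp: hom_def fc mult)
  note Zc = basis_subset [OF Z]
  have finv: "f (inv z) = inv (f z)" if "z \<in> carrier G" for z using that by simp
  have set_inv: "set_inv (f ` Z) = f ` (set_inv Z)"
    using Zc finv by (force simp: SET_INV_def)
  then show letters: "letters G (f ` Z) = f ` letters G Z" by (auto simp: letters_def)
  have lc: "letters G Z \<subseteq> carrier G" using letters_subset Zc by blast
  have red: "reduced_seq G (f ` Z) (map f zs) \<longleftrightarrow> reduced_seq G Z zs" if zs: "set zs \<subseteq> letters G Z" for zs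
  proof -
    have "successively (\<lambda>a b. b \<noteq> inv a) (map f zs) \<longleftrightarrow> successively (\<lambda>a b. b \<noteq> inv a) zs"
      using zs
    proof (induction zs rule: induct_list012)
      case (3 a b zs)
      then have "a \<in> carrier G" "b \<in> carrier G" using lc by auto
      then have "f b = inv (f a) \<longleftrightarrow> b = inv a" using inj [of b "inv a"] finv by simp
      then show ?case using 3 by simp
    qed auto
    then show ?thesis using zs by (auto simp: reduced_seq_def letters)
  qed
  have sp: "seq_prod G (map f zs) = f (seq_prod G zs)" if "set zs \<subseteq> carrier G" for zs
    using that by (induction zs) auto
  have lift: "\<exists>us. reduced_seq G Z us \<and> zs = map f us" if "reduced_seq G (f ` Z) zs" for zs
  proof -
    have "set zs \<subseteq> f ` letters G Z" using that by (simp add: reduced_seq_def letters)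
    then have "zs \<in> lists (f ` letters G Z)" by auto
    then obtain us where "us \<in> lists (letters G Z)" "zs = map f us" by (auto simp: lists_image)
    then show ?thesis using red that by auto
  qed
  show "F_basis G (f ` Z)"
    unfolding F_basis_def
  proof (intro conjI)
    show "f ` Z \<subseteq> carrier G" using Zc fc by auto
    show "f ` Z \<inter> set_inv (f ` Z) = {}"
    proof -
      have "set_inv Z \<subseteq> carrier G" "Z \<inter> set_inv Z = {}" using lc Z by (auto simp: letters_def F_basis_def)
      then show ?thesis unfolding set_inv using Zc inj by blast
    qed
    show "bij_betw (seq_prod G) {zs. reduced_seq G (f ` Z) zs} (carrier G)"
    proof (rule bij_betw_imageI)
      show "inj_on (seq_prod G) {zs. reduced_seq G (f ` Z) zs}"
      proof (rule inj_onI, clarify)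
        fix zs zs' assume "reduced_seq G (f ` Z) zs" "reduced_seq G (f ` Z) zs'"
          and eq: "seq_prod G zs = seq_prod G zs'"
        then obtain us us' where us: "reduced_seq G Z us" "zs = map f us"
          and us': "reduced_seq G Z us'" "zs' = map f us'" using lift by metis
        have c: "set us \<subseteq> carrier G" "set us' \<subseteq> carrier G"
          using reduced_seq_carrier [OF Z] us us' by auto
        then have "seq_prod G us = seq_prod G us'" using eq us us' sp inj by simp
        then show "zs = zs'" using word_unique [OF Z] us us' by metis
      qed
      show "seq_prod G ` {zs. reduced_seq G (f ` Z) zs} = carrier G"
      proof (intro equalityI subsetI)
        fix g assume "g \<in> seq_prod G ` {zs. reduced_seq G (f ` Z) zs}"
        then show "g \<in> carrier G" using lift sp reduced_seq_carrier [OF Z] fc by force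
      next
        fix g assume "g \<in> carrier G"
        then obtain g' where g': "g' \<in> carrier G" "g = f g'" using bij by (auto simp: bij_betw_def)
        then have "g = seq_prod G (map f (word G Z g'))" using sp word_carrier [OF Z] Z by simp
        moreover have "reduced_seq G (f ` Z) (map f (word G Z g'))"
          using red word_letters [OF Z] word_reduced [OF Z] g' by blast
        ultimately show "g \<in> seq_prod G ` {zs. reduced_seq G (f ` Z) zs}" by blast
      qed
    qed
  qed
qed

section \<open>Cyclic lengths\<close>

lemma word_length_Straight: "word_length G Z (Straight r) = length (word G Z r)"
  by (simp add: word_def)

lemma reduced_seq_power:
  assumes "reduced_seq G Z (us @ us)"
  shows "reduced_seq G Z (concat (replicate k us))"
proof (induction k)
  case (Suc k)
  have "hd (concat (replicate k us)) = hd us" if "concat (replicate k us) \<noteq> []"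
    using that by (cases k; cases us) auto
  then show ?case using Suc assms by (auto simp: reduced_seq_append_iff)
qed simp

lemma seq_prod_power:
  "set us \<subseteq> carrier G \<Longrightarrow> seq_prod G (concat (replicate k us)) = seq_prod G us [^] k"
proof (induction k)
  case (Suc k)
  have "set (concat (replicate k us)) \<subseteq> carrier G" using Suc.prems by auto
  then show ?case using Suc by (simp add: seq_prod_append nat_pow_Suc2 [symmetric] del: nat_pow_Suc)
qed simp

lemma conj_power:
  "h \<in> carrier G \<Longrightarrow> v \<in> carrier G \<Longrightarrow> (h \<otimes> v \<otimes> inv h) [^] (k :: nat) = h \<otimes> v [^] k \<otimes> inv h"
  by (induction k) (simp_all add: m_assoc)

lemma conjugate_in_class:
  assumes "g \<in> carrier G" "u \<in> conjugacy_class G g" "v \<in> conjugacy_class G g"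
  obtains h where "h \<in> carrier G" "u = h \<otimes> v \<otimes> inv h" "v \<in> carrier G"
proof -
  obtain a b where ab: "a \<in> carrier G" "b \<in> carrier G" "u = a \<otimes> g \<otimes> inv a" "v = b \<otimes> g \<otimes> inv b"
    using assms(2,3) by (auto simp: conjugacy_class_def)
  have "u = (a \<otimes> inv b) \<otimes> v \<otimes> inv (a \<otimes> inv b)" using ab assms(1)
    by (simp add: m_assoc inv_mult_group)
  moreover have "a \<otimes> inv b \<in> carrier G" "v \<in> carrier G" using ab assms(1) by simp_all
  ultimately show ?thesis using that by blast
qed

lemma conj_conjugacy_class:
  assumes g: "g \<in> carrier G" and u: "u \<in> conjugacy_class G g" and h: "h \<in> carrier G"
  shows "inv h \<otimes> u \<otimes> h \<in> conjugacy_class G g"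
proof -
  obtain a where a: "a \<in> carrier G" "u = a \<otimes> g \<otimes> inv a"
    using u by (auto simp: conjugacy_class_def)
  have "inv h \<otimes> u \<otimes> h = (inv h \<otimes> a) \<otimes> g \<otimes> inv (inv h \<otimes> a)"
    using a h g by (simp add: m_assoc inv_mult_group)
  then show ?thesis using a h unfolding conjugacy_class_def by blast
qed

text \<open>Compare the lengths of the \<open>k\<close>th powers of the two conjugate elements as \<open>k\<close> grows.\<close>

lemma cyclically_reduced_length_le:
  assumes Z: "F_basis G Z" and us: "cyclically_reduced_seq G Z us" and zs: "set zs \<subseteq> letters G Z"
    and g: "g \<in> carrier G"
    and mem: "seq_prod G us \<in> conjugacy_class G g" "seq_prod G zs \<in> conjugacy_class G g"
  shows "length us \<le> length zs"
proof (rule ccontr)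
  assume less: "\<not> ?thesis"
  obtain h where h: "h \<in> carrier G" "seq_prod G us = h \<otimes> seq_prod G zs \<otimes> inv h"
    using conjugate_in_class [OF g mem] by blast
  \<comment> \<open>Conjugation by \<open>h\<close> changes a length by at most
    \<open>2 * length (word G Z h)\<close>. The exponent exceeds this, while a difference between
    the lengths of \<open>us\<close> and \<open>zs\<close> is multiplied by it.\<close>
  define k where "k = Suc (2 * length (word G Z h))"
  have red: "reduced_seq G Z (us @ us)" using us by (simp add: cyclically_reduced_seq_def)
  have uc: "set us \<subseteq> carrier G" using reduced_seq_carrier [OF Z red] by simp
  have zc: "set zs \<subseteq> carrier G" using zs letters_subset basis_subset [OF Z] by blast
  have "length (word G Z (seq_prod G us [^] k)) = k * length us"
    using word_unique [OF Z reduced_seq_power [OF red, of k]] seq_prod_power [OF uc, of k]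
    by (simp add: length_concat sum_list_replicate)
  moreover have "length (word G Z (seq_prod G zs [^] k)) \<le> k * length zs"
  proof -
    have "set (concat (replicate k zs)) \<subseteq> letters G Z" using zs by auto
    from length_seq_prod_le [OF Z this] show ?thesis
      using seq_prod_power [OF zc, of k] by (simp add: length_concat sum_list_replicate)
  qed
  moreover have "seq_prod G us [^] k = h \<otimes> seq_prod G zs [^] k \<otimes> inv h"
    using h zc by (simp add: conj_power)
  moreover have "length (word G Z (h \<otimes> seq_prod G zs [^] k \<otimes> inv h)) \<le>
      length (word G Z h) + length (word G Z (seq_prod G zs [^] k)) + length (word G Z h)"
    using length_word_mult_le [OF Z, of "h \<otimes> seq_prod G zs [^] k" "inv h"]
      length_word_mult_le [OF Z, of h "seq_prod G zs [^] k"] h zc Z by simp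
  ultimately have "k * length us \<le> k * length zs + 2 * length (word G Z h)" by simp
  moreover have "k * Suc (length zs) \<le> k * length us"
    using less by (intro mult_le_mono2) simp
  ultimately show False by (simp add: k_def)
qed

text \<open>Take a conjugate of least length: if the two ends of its word cancelled, conjugating by
  its first letter would remove both.\<close>

lemma cyclically_reduced_exists:
  assumes Z: "F_basis G Z" and g: "g \<in> carrier G"
  obtains us where "cyclically_reduced_seq G Z us" "seq_prod G us \<in> conjugacy_class G g"
proof -
  define P where "P u \<longleftrightarrow> u \<in> conjugacy_class G g" for u
  have "g = \<one> \<otimes> g \<otimes> inv \<one>" using g by simp
  then have "P g" unfolding P_def conjugacy_class_def by blast
  then obtain u where u: "P u" and least: "\<And>v. P v \<Longrightarrow> length (word G Z u) \<le> length (word G Z v)"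
    using ex_has_least_nat [of P g "\<lambda>v. length (word G Z v)"] by blast
  have uc: "u \<in> carrier G" using u g by (auto simp: P_def conjugacy_class_def)
  let ?w = "word G Z u"
  have red: "reduced_seq G Z ?w" using word_reduced Z uc by blast
  have "hd ?w \<noteq> inv (last ?w)" if ne: "?w \<noteq> []"
  proof
    assume eq: "hd ?w = inv (last ?w)"
    let ?z = "hd ?w"
    have z: "?z \<in> letters G Z" using word_letters [OF Z uc] hd_in_set [OF ne] by auto
    have lc: "last ?w \<in> letters G Z" using word_letters [OF Z uc] last_in_set [OF ne] by auto
    have zc: "?z \<in> carrier G" using letter_closed [OF Z z] .
    have last: "last ?w = inv ?z" using eq letter_closed [OF Z lc] by simp
    then have tl: "tl ?w \<noteq> []" using ne inv_letter_neq [OF Z z] by (cases ?w) auto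
    have w: "?w = ?z # tl ?w" using ne by simp
    have tlc: "set (tl ?w) \<subseteq> carrier G" and tll: "set (tl ?w) \<subseteq> letters G Z"
      using word_carrier [OF Z uc] word_letters [OF Z uc] list.set_sel(2) [OF ne] by blast+
    have "tl ?w = butlast (tl ?w) @ [inv ?z]"
      using tl last ne by (metis append_butlast_last_id last_tl)
    then have sp: "seq_prod G (tl ?w) = seq_prod G (butlast (tl ?w)) \<otimes> inv ?z"
      and bc: "set (butlast (tl ?w)) \<subseteq> carrier G" and bl: "set (butlast (tl ?w)) \<subseteq> letters G Z"
      using tlc tll zc by (metis seq_prod_append seq_prod_Cons seq_prod_Nil r_one inv_closed
          empty_subsetI insert_subset list.set le_sup_iff set_append, auto dest: in_set_butlastD)
    have cancel: "inv z \<otimes> u \<otimes> z = b"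
      if "z \<in> carrier G" "b \<in> carrier G" "u = z \<otimes> (b \<otimes> inv z)" for z b u
      using that by (simp add: m_assoc)
    have "u = ?z \<otimes> seq_prod G (tl ?w)" using word_prod [OF Z uc] w by (metis seq_prod_Cons)
    then have "inv ?z \<otimes> u \<otimes> ?z = seq_prod G (butlast (tl ?w))"
      using sp bc zc by (intro cancel) simp_all
    moreover have "P (inv ?z \<otimes> u \<otimes> ?z)" using conj_conjugacy_class g u zc by (auto simp: P_def)
    ultimately have "length ?w \<le> length (butlast (tl ?w))"
      using least length_seq_prod_le [OF Z bl] by (metis le_trans)
    then show False using ne by (cases ?w) auto
  qed
  then have "cyclically_reduced_seq G Z ?w"
    using red by (auto simp: cyclically_reduced_seq_def reduced_seq_append_iff)
  then show ?thesis using that u word_prod [OF Z uc] by (auto simp: P_def)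
qed

lemma word_length_Cyclic:
  assumes Z: "F_basis G Z" and g: "g \<in> carrier G"
    and us: "cyclically_reduced_seq G Z us" "seq_prod G us \<in> conjugacy_class G g"
  shows "word_length G Z (Cyclic (conjugacy_class G g)) = length us"
  unfolding word_length.simps
proof (rule the_equality)
  fix l assume "\<exists>zs. cyclically_reduced_seq G Z zs \<and> seq_prod G zs \<in> conjugacy_class G g \<and> length zs = l"
  then obtain zs where zs: "cyclically_reduced_seq G Z zs" "seq_prod G zs \<in> conjugacy_class G g"
    "length zs = l" by blast
  have "set us \<subseteq> letters G Z" "set zs \<subseteq> letters G Z"
    using us zs by (auto simp: cyclically_reduced_seq_def reduced_seq_def)
  then show "l = length us"
    using cyclically_reduced_length_le [OF Z _ _ g] us zs by (metis le_antisym)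
qed (use us in blast)

text \<open>An arbitrary word gives an upper bound, so the loops rewritten by an exchange can be
  measured without reducing them.\<close>

lemma word_length_Cyclic_le:
  assumes Z: "F_basis G Z" and g: "g \<in> carrier G"
    and zs: "set zs \<subseteq> letters G Z" "seq_prod G zs \<in> conjugacy_class G g"
  shows "word_length G Z (Cyclic (conjugacy_class G g)) \<le> length zs"
proof -
  obtain us where us: "cyclically_reduced_seq G Z us" "seq_prod G us \<in> conjugacy_class G g"
    using cyclically_reduced_exists [OF Z g] by blast
  then show ?thesis
    using word_length_Cyclic [OF Z g us] cyclically_reduced_length_le [OF Z us(1) zs(1) g us(2) zs(2)]
    by simp
qed

end

section \<open>Trees and valences\<close>

context group
begin

text \<open>Common treatment of left and right graphs: \<open>\<rho>\<close> places the vertices in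
  the Cayley tree of \<open>Z\<close>, and \<open>l\<close> labels the oriented edges. By
  \<open>det\<close> and \<open>ex\<close> the graph is the full subgraph on the image, so reduced
  paths correspond to reduced words, and uniqueness of paths is uniqueness of words.\<close>

lemma is_tree_iff_conn:
  fixes H :: "('v, 'e) pre_digraph" and \<rho> :: "'v \<Rightarrow> 'a" and l :: "'e \<times> bool \<Rightarrow> 'a"
  assumes Z: "F_basis G Z" and inj: "inj_on \<rho> (verts H)" and \<rho>: "\<rho> ` verts H \<subseteq> carrier G"
    and arcs: "\<And>a. a \<in> arcs (oriented H) \<Longrightarrow> tail (oriented H) a \<in> verts H \<and>
      head (oriented H) a \<in> verts H \<and> l a \<in> letters G Z \<and>
      \<rho> (head (oriented H) a) = \<rho> (tail (oriented H) a) \<otimes> l a \<and> l (fst a, \<not> snd a) = inv (l a)"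
    and det: "\<And>a b. a \<in> arcs (oriented H) \<Longrightarrow> b \<in> arcs (oriented H) \<Longrightarrow>
      tail (oriented H) a = tail (oriented H) b \<Longrightarrow> l a = l b \<Longrightarrow> a = b"
    and ex: "\<And>u v z. u \<in> verts H \<Longrightarrow> v \<in> verts H \<Longrightarrow> z \<in> letters G Z \<Longrightarrow> \<rho> v = \<rho> u \<otimes> z \<Longrightarrow>
      \<exists>a\<in>arcs (oriented H). tail (oriented H) a = u \<and> l a = z"
  shows "is_tree H \<longleftrightarrow> verts H \<noteq> {} \<and> conn G Z (\<rho> ` verts H)"
proof -
  let ?O = "oriented H"
  interpret O: pre_digraph ?O .
  have rev_arc: "(fst a, \<not> snd a) \<in> arcs ?O" "tail ?O (fst a, \<not> snd a) = head ?O a"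
    if "a \<in> arcs ?O" for a
    using that by (auto simp: oriented_def split: prod.splits)
  have verts_O [simp]: "verts ?O = verts H" by (simp add: oriented_def)
  have cas: "v \<in> verts H \<and> \<rho> v = \<rho> u \<otimes> seq_prod G (map l p) \<and> set (map l p) \<subseteq> letters G Z \<and>
      (\<rho> u, \<rho> v) \<in> (adj G Z (\<rho> ` verts H))\<^sup>*"
    if "O.cas u p v" "u \<in> verts H" "set p \<subseteq> arcs ?O" for u p v
    using that
  proof (induction p arbitrary: u)
    case Nil
    then show ?case using \<rho> by auto
  next
    case (Cons a p)
    have a: "a \<in> arcs ?O" "tail ?O a = u" "O.cas (head ?O a) p v" using Cons.prems by auto
    note A = arcs [OF a(1)]
    have IH: "v \<in> verts H" "\<rho> v = \<rho> (head ?O a) \<otimes> seq_prod G (map l p)"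
      "set (map l p) \<subseteq> letters G Z" "(\<rho> (head ?O a), \<rho> v) \<in> (adj G Z (\<rho> ` verts H))\<^sup>*"
      using Cons.IH [OF a(3)] A Cons.prems(3) by auto
    have "set (map l p) \<subseteq> carrier G" "l a \<in> carrier G" "\<rho> u \<in> carrier G"
      using IH(3) A letter_closed [OF Z] Cons.prems(2) \<rho> by blast+
    moreover from this have "seq_prod G (map l p) \<in> carrier G" by (intro seq_prod_closed)
    moreover have "(\<rho> u, \<rho> (head ?O a)) \<in> adj G Z (\<rho> ` verts H)"
    proof -
      have "\<rho> (head ?O a) \<in> \<rho> ` verts H" "\<rho> u \<in> \<rho> ` verts H"
        using A a(2) by (intro imageI; simp)+
      moreover have "\<rho> (head ?O a) = \<rho> u \<otimes> l a" using A a(2) by simp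
      ultimately show ?thesis unfolding adj_def using A by blast
    qed
    ultimately show ?case using IH A a(2) by (auto simp: m_assoc intro: converse_rtrancl_into_rtrancl)
  qed
  have red: "successively (\<lambda>a b. b \<noteq> (fst a, \<not> snd a)) p \<longleftrightarrow>
      successively (\<lambda>a b. b \<noteq> inv a) (map l p)"
    if "O.cas u p v" "set p \<subseteq> arcs ?O" for u p v
    using that
  proof (induction p arbitrary: u rule: induct_list012)
    case (3 a b p)
    have ab: "a \<in> arcs ?O" "b \<in> arcs ?O" "tail ?O b = head ?O a" "O.cas (head ?O a) (b # p) v"
      using 3 by auto
    have "b = (fst a, \<not> snd a) \<longleftrightarrow> l b = inv (l a)"
      using det [OF ab(2) rev_arc(1) [OF ab(1)]] rev_arc(2) [OF ab(1)] arcs [OF ab(1)] ab(3) by auto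
    then show ?case using 3(2) [OF ab(4)] 3 by auto
  qed auto
  have uniq: "p = q" if "O.cas u p v" "O.cas u q v" "set p \<subseteq> arcs ?O" "set q \<subseteq> arcs ?O"
    "map l p = map l q" for u p q v
    using that(5) that(1-4)
  proof (induction "map l p" arbitrary: u p q)
    case (Cons c cs)
    then obtain a p' b q' where pq: "p = a # p'" "q = b # q'" "l a = l b" "map l p' = map l q'" "cs = map l p'"
      by (cases p; cases q) auto
    then have "a = b" using det [of a b] Cons.prems by auto
    then show ?case using Cons.hyps(1) [of p' q' "head ?O a"] Cons.prems pq by auto
  qed auto
  have exist: "\<exists>p v. O.cas u p v \<and> set p \<subseteq> arcs ?O \<and> map l p = zs"
    if "u \<in> verts H" "set zs \<subseteq> letters G Z"
      "\<And>n. \<rho> u \<otimes> seq_prod G (take n zs) \<in> \<rho> ` verts H" for u zs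
    using that
  proof (induction zs arbitrary: u)
    case (Cons z zs)
    have c: "z \<in> carrier G" "set zs \<subseteq> carrier G" "\<rho> u \<in> carrier G"
      using Cons.prems letters_subset [OF basis_subset [OF Z]] \<rho> by auto
    obtain v where v: "v \<in> verts H" "\<rho> v = \<rho> u \<otimes> z" using Cons.prems(3) [of 1] c by auto
    obtain a where a: "a \<in> arcs ?O" "tail ?O a = u" "l a = z"
      using ex [OF Cons.prems(1) v(1) _ v(2)] Cons.prems(2) by auto
    have "head ?O a = v"
      using arcs [OF a(1)] a(2,3) v by (intro inj_onD [OF inj, of "head ?O a" v]) simp_all
    moreover have "\<rho> v \<otimes> seq_prod G (take n zs) \<in> \<rho> ` verts H" for n
    proof -
      have "set (take n zs) \<subseteq> carrier G" using c(2) set_take_subset by fastforce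
      then show ?thesis using Cons.prems(3) [of "Suc n"] c v(2) by (simp add: m_assoc)
    qed
    ultimately obtain p w where "O.cas (head ?O a) p w" "set p \<subseteq> arcs ?O" "map l p = zs"
      using Cons.IH [of v] v(1) Cons.prems(2) by auto
    then show ?case using a by (intro exI [of _ "a # p"] exI [of _ w]) auto
  qed (auto intro!: exI [of _ "[]"])
  show ?thesis
  proof (intro iffI conjI)
    assume tree: "is_tree H"
    then show "verts H \<noteq> {}" by (simp add: is_tree_def)
    show "conn G Z (\<rho> ` verts H)"
      unfolding conn_def
    proof (intro ballI; clarify)
      fix u v assume uv: "u \<in> verts H" "v \<in> verts H"
      then obtain p where "reduced_path H u p v" using tree unfolding is_tree_def by blast
      then show "(\<rho> u, \<rho> v) \<in> (adj G Z (\<rho> ` verts H))\<^sup>*"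
        using cas [of u p v] by (auto simp: reduced_path_def O.awalk_def)
    qed
  next
    assume H: "verts H \<noteq> {} \<and> conn G Z (\<rho> ` verts H)"
    have "\<exists>!p. reduced_path H u p v" if uv: "u \<in> verts H" "v \<in> verts H" for u v
    proof (rule ex_ex1I)
      have c: "\<rho> u \<in> carrier G" "\<rho> v \<in> carrier G" using uv \<rho> by auto
      let ?zs = "word G Z (inv (\<rho> u) \<otimes> \<rho> v)"
      have r: "reduced_seq G Z ?zs" using word_reduced [OF Z] c by simp
      have "\<rho> u \<otimes> seq_prod G (take n ?zs) \<in> \<rho> ` verts H" for n
        using conn_convex [OF Z \<rho>, of "\<rho> u" "\<rho> v" n] H uv by auto
      then obtain p w where p: "O.cas u p w" "set p \<subseteq> arcs ?O" "map l p = ?zs"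
        using exist [of u ?zs] uv reduced_seq_letters [OF r] by blast
      then have "\<rho> w = \<rho> v" using cas [of u p w] uv c Z by simp
      moreover have "w \<in> verts H" using cas [of u p w] uv p by simp
      ultimately have "w = v" using uv by (intro inj_onD [OF inj, of w v]) simp_all
      then show "\<exists>p. reduced_path H u p v" using p r red [of u p w] uv
        by (auto simp: reduced_path_def O.awalk_def reduced_seq_def)
      fix p q assume "reduced_path H u p v" "reduced_path H u q v"
      then have pq: "O.cas u p v" "set p \<subseteq> arcs ?O" "O.cas u q v" "set q \<subseteq> arcs ?O"
        "reduced_seq G Z (map l p)" "reduced_seq G Z (map l q)"
        using cas [of u p v] cas [of u q v] red [of u p v] red [of u q v]
        by (auto simp: reduced_path_def O.awalk_def reduced_seq_def)
      have pc: "seq_prod G (map l p) \<in> carrier G" "seq_prod G (map l q) \<in> carrier G"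
        using reduced_seq_carrier [OF Z] pq by (auto intro!: seq_prod_closed)
      have "\<rho> u \<otimes> seq_prod G (map l p) = \<rho> u \<otimes> seq_prod G (map l q)"
        using cas [OF pq(1) uv(1) pq(2)] cas [OF pq(3) uv(1) pq(4)] by metis
      then have "seq_prod G (map l p) = seq_prod G (map l q)" using pc c by simp
      then have "map l p = map l q" by (metis word_unique [OF Z pq(5)] word_unique [OF Z pq(6)])
      then show "p = q" by (rule uniq [OF pq(1,3,2,4)])
    qed
    then show "is_tree H" using H by (simp add: is_tree_def)
  qed
qed

lemma is_tree_right_graph:
  assumes Z: "F_basis G Z" and V: "V \<subseteq> carrier G"
  shows "is_tree (right_graph G Z V) \<longleftrightarrow> V \<noteq> {} \<and> conn G Z V"
proof -
  have disj: "inv z \<in> Z \<Longrightarrow> z \<in> Z \<Longrightarrow> False" for z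
    using Z set_inv_iff [of "inv z" Z] unfolding F_basis_def by blast
  have zc: "z \<in> Z \<Longrightarrow> z \<in> carrier G" for z using basis_subset [OF Z] by auto
  have "is_tree (right_graph G Z V) \<longleftrightarrow>
      verts (right_graph G Z V) \<noteq> {} \<and> conn G Z ((\<lambda>v. v) ` verts (right_graph G Z V))"
  proof (rule is_tree_iff_conn [OF Z, where l = "\<lambda>((v, y), b). if b then y else inv y"], goal_cases)
    case (3 a)
    then show ?case using V zc
      by (auto simp: oriented_def right_graph_def letters_def set_inv_iff m_assoc subset_iff
          split: prod.splits if_splits)
  next
    case (4 a b)
    have inv_eq: "inv x = inv y \<Longrightarrow> x \<in> Z \<Longrightarrow> y \<in> Z \<Longrightarrow> x = y" for x y using zc by (metis inv_inv)
    from 4 show ?case using V zc disj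
      by (auto simp: oriented_def right_graph_def subset_iff split: prod.splits if_splits
          dest!: inv_eq)
  next
    case (5 u v z)
    have vc: "v \<in> carrier G" "u \<in> carrier G" using 5 V by (auto simp: right_graph_def)
    show ?case
    proof (cases "z \<in> Z")
      case True
      then show ?thesis using 5 
        by (intro bexI [of _ "((u, z), True)"]) (auto simp: oriented_def right_graph_def)
    next
      case False
      then have z: "inv z \<in> Z" "z \<in> carrier G" using 5 zc by (auto simp: letters_def set_inv_iff)
      have "u = v \<otimes> inv z" using 5 z vc by (simp add: m_assoc)
      then show ?thesis using 5 z
        by (intro bexI [of _ "((v, inv z), False)"]) (auto simp: oriented_def right_graph_def)
    qed
  qed (use V in \<open>auto simp: right_graph_def\<close>)
  then show ?thesis by (simp add: right_graph_def)
qed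

lemma is_tree_left_graph:
  assumes Z: "F_basis G Z" and V: "V \<subseteq> carrier G"
  shows "is_tree (left_graph G Z V) \<longleftrightarrow> V \<noteq> {} \<and> conn G Z (inverses V)"
proof -
  have disj: "inv z \<in> Z \<Longrightarrow> z \<in> Z \<Longrightarrow> False" for z
    using Z set_inv_iff [of "inv z" Z] unfolding F_basis_def by blast
  have zc: "z \<in> Z \<Longrightarrow> z \<in> carrier G" for z using basis_subset [OF Z] by auto
  have "is_tree (left_graph G Z V) \<longleftrightarrow>
      verts (left_graph G Z V) \<noteq> {} \<and> conn G Z (inverses (verts (left_graph G Z V)))"
  \<comment> \<open>After inversion, the left step from \<open>v\<close> to
    \<open>x \<otimes> v\<close> is right multiplication by \<open>inv x\<close>; hence this label
    for the forward orientation.\<close>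
  proof (rule is_tree_iff_conn [OF Z, where l = "\<lambda>((x, v), b). if b then inv x else x"], goal_cases)
    case 1
    then show ?case using V by (auto simp: left_graph_def inj_on_def subset_iff) (metis inv_inv)
  next
    case (3 a)
    then show ?case using V zc
      by (auto simp: oriented_def left_graph_def letters_def set_inv_iff m_assoc subset_iff inv_mult_group
          split: prod.splits if_splits)
  next
    case (4 a b)
    then show ?case using V zc disj
      by (auto simp: oriented_def left_graph_def subset_iff split: prod.splits if_splits)
        (metis inv_inv)+
  next
    case (5 u v z)
    have vc: "v \<in> carrier G" "u \<in> carrier G" and zl: "z \<in> carrier G"
      using 5 V letter_closed [OF Z] by (auto simp: left_graph_def)
    have "v = inv (inv u \<otimes> z)" using 5 vc by (metis inv_inv)
    then have v: "v = inv z \<otimes> u" using vc zl by (simp add: inv_mult_group)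
    show ?case
    proof (cases "z \<in> Z")
      case True
      moreover have "z \<otimes> v = u" using v vc zl by simp
      ultimately show ?thesis using 5
        by (intro bexI [of _ "((z, v), False)"]) (auto simp: oriented_def left_graph_def)
    next
      case False
      then have z: "inv z \<in> Z" using 5 zc by (auto simp: letters_def set_inv_iff)
      then show ?thesis using 5 z v zl
        by (intro bexI [of _ "((inv z, u), True)"]) (auto simp: oriented_def left_graph_def)
    qed
  qed (use V in \<open>auto simp: left_graph_def\<close>)
  then show ?thesis by (simp add: left_graph_def)
qed

lemma translators_iff:
  assumes "F_basis G X" "F_basis G Y"
  shows "V \<in> translators G X Y \<longleftrightarrow> translator G X Y V"
proof (cases "V \<subseteq> carrier G")
  case True
  then show ?thesis
    using is_tree_left_graph [OF assms(1) True] is_tree_right_graph [OF assms(2) True]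
    by (auto simp: translators_def translator_def)
qed (simp add: translators_def translator_def)

lemma valence_two_sided_graph:
  assumes X: "F_basis G X" "finite X" and Y: "F_basis G Y" "finite Y" and V: "V \<subseteq> carrier G" and v: "v \<in> V"
  shows "valence (two_sided_graph G X Y V) v =
    card {x \<in> letters G X. x \<otimes> v \<in> V} + card {y \<in> letters G Y. v \<otimes> y \<in> V}"
proof -
  have vc: "v \<in> carrier G" using V v by auto
  have Xc: "x \<in> X \<Longrightarrow> x \<in> carrier G" and Yc: "y \<in> Y \<Longrightarrow> y \<in> carrier G" for x y
    using X Y basis_subset by auto
  have Xd: "inv x \<in> X \<Longrightarrow> x \<in> X \<Longrightarrow> False" for x
    using X set_inv_iff [of "inv x" X] unfolding F_basis_def by blast
  have Yd: "inv x \<in> Y \<Longrightarrow> x \<in> Y \<Longrightarrow> False" for x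
    using Y set_inv_iff [of "inv x" Y] unfolding F_basis_def by blast
  let ?A = "{x \<in> letters G X. x \<otimes> v \<in> V}" and ?B = "{y \<in> letters G Y. v \<otimes> y \<in> V}"
  define f :: "'a + 'a \<Rightarrow> ('a \<times> 'a + 'a \<times> 'a) \<times> bool" where "f = case_sum (\<lambda>x. if x \<in> X then (Inl (x, v), True) else (Inl (inv x, x \<otimes> v), False))
    (\<lambda>y. if y \<in> Y then (Inr (v, y), True) else (Inr (v \<otimes> y, inv y), False))"
  define g :: "('a \<times> 'a + 'a \<times> 'a) \<times> bool \<Rightarrow> 'a + 'a" where "g = (\<lambda>(e, b). case e of Inl (x, u) \<Rightarrow> Inl (if b then x else inv x)
    | Inr (u, y) \<Rightarrow> Inr (if b then y else inv y))"
  have "bij_betw f (?A <+> ?B) (out_arcs (oriented (two_sided_graph G X Y V)) v)"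
  proof (rule bij_betw_byWitness [where f' = g])
    show "\<forall>a\<in>?A <+> ?B. g (f a) = a" using Xc Yc
      by (auto simp: f_def g_def letters_def set_inv_iff)
    show "\<forall>a\<in>out_arcs (oriented (two_sided_graph G X Y V)) v. f (g a) = a"
      using Xc Yc Xd Yd V
      by (auto simp: f_def g_def out_arcs_def oriented_def two_sided_graph_def left_graph_def
          right_graph_def m_assoc subset_iff split: if_splits)
    show "f ` (?A <+> ?B) \<subseteq> out_arcs (oriented (two_sided_graph G X Y V)) v"
      using Xc Yc v vc
      by (auto simp: f_def out_arcs_def oriented_def two_sided_graph_def left_graph_def
          right_graph_def letters_def set_inv_iff m_assoc split: if_splits)
    show "g ` out_arcs (oriented (two_sided_graph G X Y V)) v \<subseteq> ?A <+> ?B"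
      using Xc Yc V
      by (auto simp: g_def out_arcs_def oriented_def two_sided_graph_def left_graph_def
          right_graph_def letters_def set_inv_iff m_assoc subset_iff split: if_splits)
  qed
  then have "valence (two_sided_graph G X Y V) v = card (?A <+> ?B)"
    by (simp add: valence_def bij_betw_same_card)
  then show ?thesis using finite_letters X Y by (simp add: card_Plus)
qed

end

section \<open>Loops in a translator\<close>

datatype 'a step = Lft 'a | Rgt 'a

fun step_letter :: "('a, 'b) monoid_scheme \<Rightarrow> 'a set \<Rightarrow> 'a set \<Rightarrow> 'a step \<Rightarrow> bool" where
  "step_letter F X Y (Lft x) \<longleftrightarrow> x \<in> letters F X"
| "step_letter F X Y (Rgt y) \<longleftrightarrow> y \<in> letters F Y"

fun target :: "('a, 'b) monoid_scheme \<Rightarrow> 'a step \<Rightarrow> 'a \<Rightarrow> 'a" where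
  "target F (Lft x) v = x \<otimes>\<^bsub>F\<^esub> v"
| "target F (Rgt y) v = v \<otimes>\<^bsub>F\<^esub> y"

fun is_path :: "('a, 'b) monoid_scheme \<Rightarrow> 'a set \<Rightarrow> 'a set \<Rightarrow> 'a set \<Rightarrow> 'a \<Rightarrow> 'a step list \<Rightarrow> 'a \<Rightarrow> bool" where
  "is_path F X Y V u [] v \<longleftrightarrow> u = v \<and> v \<in> V"
| "is_path F X Y V u (s # p) v \<longleftrightarrow> u \<in> V \<and> step_letter F X Y s \<and> is_path F X Y V (target F s u) p v"

fun lefts :: "'a step list \<Rightarrow> 'a list" where
  "lefts [] = []"
| "lefts (Lft x # p) = x # lefts p"
| "lefts (Rgt y # p) = lefts p"

fun rights :: "'a step list \<Rightarrow> 'a list" where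
  "rights [] = []"
| "rights (Lft x # p) = rights p"
| "rights (Rgt y # p) = y # rights p"

text \<open>The step induced on inverses: \<open>inv (x \<otimes> v)\<close> is
  \<open>inv v \<otimes> inv x\<close>.\<close>

fun swap_step :: "('a, 'b) monoid_scheme \<Rightarrow> 'a step \<Rightarrow> 'a step" where
  "swap_step F (Lft x) = Rgt (inv\<^bsub>F\<^esub> x)"
| "swap_step F (Rgt y) = Lft (inv\<^bsub>F\<^esub> y)"

text \<open>
  The right letters along a path which starts and ends at \<open>1\<close> multiply to the element that it
  represents; its left letters then multiply, in reverse order, to the inverse of that element.
\<close>

definition loop :: "('a, 'b) monoid_scheme \<Rightarrow> 'a set \<Rightarrow> 'a set \<Rightarrow> 'a set \<Rightarrow> 'a fword \<Rightarrow> 'a \<Rightarrow> 'a step list \<Rightarrow> bool" where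
  "loop F X Y V r u p \<longleftrightarrow> is_path F X Y V u p u \<and>
    (case r of Straight g \<Rightarrow> u = \<one>\<^bsub>F\<^esub> \<and> seq_prod F (rights p) = g
     | Cyclic C \<Rightarrow> seq_prod F (rights p) \<in> C)"

text \<open>The recursion carries the current vertex \<open>u\<close>. Both directions count, so the
  weight belongs to the unoriented edge, see \<open>cross_left_inv\<close>.\<close>

fun cross_left :: "('a, 'b) monoid_scheme \<Rightarrow> 'a \<Rightarrow> 'a \<Rightarrow> 'a \<Rightarrow> 'a step list \<Rightarrow> nat" where
  "cross_left F w x u [] = 0"
| "cross_left F w x u (Lft z # p) =
    (if u = w \<and> z = x \<or> u = x \<otimes>\<^bsub>F\<^esub> w \<and> z = inv\<^bsub>F\<^esub> x then 1 else 0) + cross_left F w x (z \<otimes>\<^bsub>F\<^esub> u) p"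
| "cross_left F w x u (Rgt z # p) = cross_left F w x (u \<otimes>\<^bsub>F\<^esub> z) p"

fun cross_right :: "('a, 'b) monoid_scheme \<Rightarrow> 'a \<Rightarrow> 'a \<Rightarrow> 'a \<Rightarrow> 'a step list \<Rightarrow> nat" where
  "cross_right F e y u [] = 0"
| "cross_right F e y u (Lft z # p) = cross_right F e y (z \<otimes>\<^bsub>F\<^esub> u) p"
| "cross_right F e y u (Rgt z # p) =
    (if u = e \<and> z = y \<or> u = e \<otimes>\<^bsub>F\<^esub> y \<and> z = inv\<^bsub>F\<^esub> y then 1 else 0) + cross_right F e y (u \<otimes>\<^bsub>F\<^esub> z) p"

lemma lefts_append [simp]: "lefts (p @ q) = lefts p @ lefts q"
  by (induction p rule: lefts.induct) auto

lemma rights_append [simp]: "rights (p @ q) = rights p @ rights q"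
  by (induction p rule: rights.induct) auto

lemma length_lefts_rights: "length (lefts p) + length (rights p) = length p"
  by (induction p rule: lefts.induct) auto

lemma lefts_map_Rgt [simp]: "lefts (map Rgt ys) = []"
  and rights_map_Rgt [simp]: "rights (map Rgt ys) = ys"
  by (induction ys) auto

lemma rights_split:
  assumes "rights p = b # bs"
  obtains q p' where "p = q @ Rgt b # p'" "rights q = []" "rights p' = bs"
proof -
  have "\<exists>q p'. p = q @ Rgt b # p' \<and> rights q = [] \<and> rights p' = bs"
    using assms
  proof (induction p rule: rights.induct)
    case (2 x p)
    then obtain q p' where "p = q @ Rgt b # p'" "rights q = []" "rights p' = bs" by auto
    then show ?case by (intro exI [of _ "Lft x # q"] exI [of _ p']) auto
  next
    case (3 y p)
    then show ?case by (intro exI [of _ "[]"] exI [of _ p]) auto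
  qed auto
  then show ?thesis using that by blast
qed

lemma rights_split_last:
  assumes "rights p = bs @ [b]"
  obtains q p' where "p = p' @ Rgt b # q" "rights q = []" "rights p' = bs"
proof -
  have "\<exists>q p'. p = p' @ Rgt b # q \<and> rights q = [] \<and> rights p' = bs"
    using assms
  proof (induction p arbitrary: bs rule: rights.induct)
    case (2 x p)
    then obtain q p' where "p = p' @ Rgt b # q" "rights q = []" "rights p' = bs" by fastforce
    then show ?case by (intro exI [of _ q] exI [of _ "Lft x # p'"]) auto
  next
    case (3 y p)
    show ?case
    proof (cases bs)
      case Nil
      then show ?thesis using 3 by (intro exI [of _ p] exI [of _ "[]"]) auto
    next
      case (Cons c cs)
      then obtain q p' where "p = p' @ Rgt b # q" "rights q = []" "rights p' = cs"
        using 3(1) [of cs] 3(2) by auto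
      then show ?thesis using Cons 3(2) by (intro exI [of _ q] exI [of _ "Rgt y # p'"]) auto
    qed
  qed auto
  then show ?thesis using that by blast
qed

text \<open>Consecutive right letters are separated in the path by left steps only; such a stretch
  is what \<open>shorten_rights\<close> replaces.\<close>

lemma not_successively_rights:
  assumes "\<not> successively P (rights p)"
  obtains p1 a q b p2 where "p = p1 @ Rgt a # q @ Rgt b # p2" "rights q = []" "\<not> P a b"
proof -
  have "\<exists>p1 a q b p2. p = p1 @ Rgt a # q @ Rgt b # p2 \<and> rights q = [] \<and> \<not> P a b"
    using assms
  proof (induction p rule: rights.induct)
    case (2 x p)
    then obtain p1 a q b p2 where "p = p1 @ Rgt a # q @ Rgt b # p2 \<and> rights q = [] \<and> \<not> P a b"
      by auto
    then show ?case by (intro exI [of _ "Lft x # p1"]) auto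
  next
    case (3 y p)
    show ?case
    proof (cases "successively P (rights p)")
      case True
      then obtain b bs where b: "rights p = b # bs" "\<not> P y b"
        using 3(2) by (cases "rights p") auto
      then obtain q p' where "p = q @ Rgt b # p'" "rights q = []" using rights_split by metis
      then show ?thesis using b
        by (intro exI [of _ "[]"] exI [of _ y] exI [of _ q] exI [of _ b] exI [of _ p']) auto
    next
      case False
      then obtain p1 a q b p2 where "p = p1 @ Rgt a # q @ Rgt b # p2 \<and> rights q = [] \<and> \<not> P a b"
        using 3(1) by auto
      then show ?thesis by (intro exI [of _ "Rgt y # p1"]) auto
    qed
  qed auto
  then show ?thesis using that by blast
qed

context group
begin

lemma is_path_append:
  "is_path G X Y V u (p @ q) w \<longleftrightarrow> (\<exists>v. is_path G X Y V u p v \<and> is_path G X Y V v q w)"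
proof (induction p arbitrary: u)
  case Nil
  show ?case by (cases q) auto
qed auto

lemma is_path_mem: "is_path G X Y V u p v \<Longrightarrow> u \<in> V \<and> v \<in> V"
  by (induction p arbitrary: u) auto

lemma is_path_letters:
  "is_path G X Y V u p v \<Longrightarrow> set (lefts p) \<subseteq> letters G X \<and> set (rights p) \<subseteq> letters G Y"
proof (induction p arbitrary: u)
  case (Cons s p)
  then show ?case by (cases s) auto
qed simp

lemma is_path_target:
  assumes X: "F_basis G X" and Y: "F_basis G Y" and V: "V \<subseteq> carrier G" and "is_path G X Y V u p v"
  shows "v = seq_prod G (rev (lefts p)) \<otimes> u \<otimes> seq_prod G (rights p)"
  using assms(4)
proof (induction p arbitrary: u)
  case Nil
  then show ?case using V by auto
next
  case (Cons s p)
  have uc: "u \<in> carrier G" using Cons.prems V by auto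
  have sub: "set (lefts p) \<subseteq> letters G X" "set (rights p) \<subseteq> letters G Y"
    using is_path_letters [of X Y V "target G s u" p v] Cons.prems by auto
  have lc: "letters G X \<subseteq> carrier G" "letters G Y \<subseteq> carrier G"
    using letters_subset basis_subset X Y by auto
  have c: "set (rev (lefts p)) \<subseteq> carrier G" "set (rights p) \<subseteq> carrier G"
    using sub lc by auto
  have IH: "v = seq_prod G (rev (lefts p)) \<otimes> target G s u \<otimes> seq_prod G (rights p)"
    using Cons by auto
  show ?case
  proof (cases s)
    case (Lft x)
    then have "x \<in> carrier G" using Cons.prems letter_closed [OF X] by auto
    then show ?thesis using IH Lft uc c by (simp add: seq_prod_append m_assoc)
  next
    case (Rgt y)
    then have "y \<in> carrier G" using Cons.prems letter_closed [OF Y] by auto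
    then show ?thesis using IH Rgt uc c by (simp add: m_assoc)
  qed
qed

lemma is_path_swap:
  assumes X: "F_basis G X" and Y: "F_basis G Y" and V: "V \<subseteq> carrier G" and "is_path G X Y V u p v"
  shows "is_path G Y X (inverses V) (inv u) (map (swap_step G) p) (inv v)"
  using assms(4)
proof (induction p arbitrary: u)
  case (Cons s p)
  have uc: "u \<in> carrier G" using Cons.prems V by auto
  have s: "step_letter G X Y s" using Cons.prems by simp
  have "step_letter G Y X (swap_step G s)" "target G (swap_step G s) (inv u) = inv (target G s u)"
    using s uc inv_letter X Y letter_closed by (cases s; auto simp: inv_mult_group)+
  then show ?case using Cons by auto
qed auto

lemma swap_swap_path:
  assumes X: "F_basis G X" and Y: "F_basis G Y" and "is_path G X Y V u p v"
  shows "map (swap_step G) (map (swap_step G) p) = p"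
  using assms(3)
proof (induction p arbitrary: u)
  case (Cons s p)
  then show ?case using letter_closed X Y by (cases s) auto
qed simp

lemma rights_swap: "rights (map (swap_step G) p) = map (\<lambda>x. inv x) (lefts p)"
  by (induction p rule: lefts.induct) auto

lemma right_path_exists:
  assumes Y: "F_basis G Y" and V: "V \<subseteq> carrier G" "conn G Y V" and u: "u \<in> V" and v: "v \<in> V"
  shows "is_path G X Y V u (map Rgt (word G Y (inv u \<otimes> v))) v"
proof -
  have "is_path G X Y V u (map Rgt zs) (u \<otimes> seq_prod G zs)"
    if "set zs \<subseteq> letters G Y" "\<And>n. u \<otimes> seq_prod G (take n zs) \<in> V" "u \<in> V" for zs u
    using that
  proof (induction zs arbitrary: u)
    case Nil
    then show ?case using V by auto
  next
    case (Cons z zs)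
    have c: "z \<in> carrier G" "set zs \<subseteq> carrier G" "u \<in> carrier G"
      using Cons.prems letter_closed [OF Y] V by auto
    have n: "u \<otimes> z \<otimes> seq_prod G (take n zs) \<in> V" for n
    proof -
      have "set (take n zs) \<subseteq> carrier G" using c set_take_subset by fastforce
      then show ?thesis using Cons.prems(2) [of "Suc n"] c by (simp add: m_assoc)
    qed
    from n [of 0] have "u \<otimes> z \<in> V" using c by simp
    then have "is_path G X Y V (u \<otimes> z) (map Rgt zs) (u \<otimes> z \<otimes> seq_prod G zs)"
      using Cons.IH n Cons.prems by auto
    then show ?case using Cons.prems c by (simp add: m_assoc)
  qed
  moreover have c: "u \<in> carrier G" "v \<in> carrier G" "inv u \<otimes> v \<in> carrier G" using u v V by auto
  ultimately have "is_path G X Y V u (map Rgt (word G Y (inv u \<otimes> v))) (u \<otimes> seq_prod G (word G Y (inv u \<otimes> v)))"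
    using word_letters [OF Y c(3)] conn_convex [OF Y V u v] u by blast
  then show ?thesis using c Y by simp
qed

lemma left_path_exists:
  assumes X: "F_basis G X" and Y: "F_basis G Y" and V: "V \<subseteq> carrier G" "conn G X (inverses V)"
    and u: "u \<in> V" and v: "v \<in> V"
  obtains p where "is_path G X Y V u p v" "rights p = []" "length p = length (word G X (u \<otimes> inv v))"
proof
  have c: "u \<in> carrier G" "v \<in> carrier G" "inverses V \<subseteq> carrier G" using u v V by auto
  let ?p = "map Rgt (word G X (inv (inv u) \<otimes> inv v)) :: 'a step list"
  have "is_path G Y X (inverses V) (inv u) ?p (inv v)"
    using right_path_exists [OF X c(3) V(2), of "inv u" "inv v"] u v by blast
  from is_path_swap [OF Y X c(3) this]
  show "is_path G X Y V u (map (swap_step G) ?p) v" using c V by simp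
  show "rights (map (swap_step G) ?p) = []"
    "length (map (swap_step G) ?p) = length (word G X (u \<otimes> inv v))"
    using c by (simp_all add: rights_swap del: map_map)
qed

text \<open>
  Crossing a right edge and coming back after left steps only is a detour, as the left tree on
  \<open>V\<close> is convex.
\<close>

lemma shorten_rights:
  assumes X: "F_basis G X" and Y: "F_basis G Y" and V: "translator G X Y V"
    and p: "is_path G X Y V u p v" and nred: "\<not> reduced_seq G Y (rights p)"
  obtains p' where "is_path G X Y V u p' v" "length p' < length p"
    "seq_prod G (rights p') = seq_prod G (rights p)"
proof -
  have Vc: "V \<subseteq> carrier G" "conn G X (inverses V)" using V by (auto simp: translator_def)
  have "\<not> successively (\<lambda>a b. b \<noteq> inv a) (rights p)"
    using nred is_path_letters [OF p] by (simp add: reduced_seq_def)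
  then obtain p1 a q b p2 where split: "p = p1 @ Rgt a # q @ Rgt b # p2" "rights q = []" "b = inv a"
    by (rule not_successively_rights) auto
  obtain v1 v2 where P: "is_path G X Y V u p1 v1" "is_path G X Y V (v1 \<otimes> a) q v2"
    "is_path G X Y V (v2 \<otimes> b) p2 v" "a \<in> letters G Y" "v1 \<in> V"
    using p unfolding split(1) by (auto simp: is_path_append)
  have c: "v1 \<in> carrier G" "a \<in> carrier G" using P Vc letter_closed [OF Y] by auto
  have lq: "set (lefts q) \<subseteq> letters G X" using is_path_letters [OF P(2)] by simp
  then have lqc: "set (lefts q) \<subseteq> carrier G" using letters_subset basis_subset [OF X] by blast
  let ?A = "seq_prod G (rev (lefts q))"
  have Ac: "?A \<in> carrier G" using lqc by simp
  have "v2 = ?A \<otimes> (v1 \<otimes> a)" using is_path_target [OF X Y Vc(1) P(2)] split c Ac by simp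
  then have v2: "v2 \<otimes> b = ?A \<otimes> v1" using split c Ac by (simp add: m_assoc)
  \<comment> \<open>The detour performs left translation by \<open>?A\<close> at
    \<open>v1 \<otimes> a\<close>. Its counterpart at \<open>v1\<close> also has both ends in
    \<open>V\<close>, so by convexity it can be performed there, with no more left steps and without
    the two right steps.\<close>
  have "?A \<otimes> v1 \<in> V" using is_path_mem [OF P(3)] v2 by simp
  then obtain q' where q': "is_path G X Y V v1 q' (?A \<otimes> v1)" "rights q' = []"
    "length q' = length (word G X (v1 \<otimes> inv (?A \<otimes> v1)))"
    using left_path_exists [OF X Y Vc P(5)] by blast
  have "v1 \<otimes> inv (?A \<otimes> v1) = inv ?A" using c Ac by (simp add: inv_mult_group)
  then have "length q' = length (word G X ?A)" using q'(3) Ac X by simp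
  also have "\<dots> \<le> length (rev (lefts q))" using lq by (intro length_seq_prod_le X) simp
  also have "\<dots> \<le> length q" using length_lefts_rights [of q] by simp
  finally have "length (p1 @ q' @ p2) < length p" using split by simp
  moreover have "is_path G X Y V u (p1 @ q' @ p2) v"
    using P q' v2 by (auto simp: is_path_append)
  moreover have "seq_prod G (rights (p1 @ q' @ p2)) = seq_prod G (rights p)"
  proof -
    have "letters G Y \<subseteq> carrier G" using letters_subset basis_subset [OF Y] by blast
    then have "set (rights p1) \<subseteq> carrier G" "set (rights p2) \<subseteq> carrier G"
      using is_path_letters [OF P(1)] is_path_letters [OF P(3)] by blast+
    then show ?thesis using split q'(2) c by (simp add: seq_prod_append)
  qed
  ultimately show ?thesis using that by blast
qed

text \<open>Moving the starting point along the loop conjugates the element represented.\<close>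

lemma rotate_path:
  assumes Y: "F_basis G Y" and p: "is_path G X Y V u (p1 @ p2) u"
    and g: "g \<in> carrier G" and mem: "seq_prod G (rights (p1 @ p2)) \<in> conjugacy_class G g"
  obtains v where "is_path G X Y V v (p2 @ p1) v" "seq_prod G (rights (p2 @ p1)) \<in> conjugacy_class G g"
proof -
  obtain v where v: "is_path G X Y V u p1 v" "is_path G X Y V v p2 u"
    using p by (auto simp: is_path_append)
  have "letters G Y \<subseteq> carrier G" using letters_subset basis_subset [OF Y] by blast
  then have c: "set (rights p1) \<subseteq> carrier G" "set (rights p2) \<subseteq> carrier G"
    using is_path_letters [OF v(1)] is_path_letters [OF v(2)] by blast+
  let ?b = "seq_prod G (rights p1)"
  have "seq_prod G (rights (p2 @ p1)) = inv ?b \<otimes> seq_prod G (rights (p1 @ p2)) \<otimes> ?b"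
    using c by (simp add: seq_prod_append m_assoc)
  then have "seq_prod G (rights (p2 @ p1)) \<in> conjugacy_class G g"
    using conj_conjugacy_class [OF g mem, of ?b] c by simp
  then show ?thesis using that v by (auto simp: is_path_append)
qed

text \<open>An element \<open>v\<close> of \<open>V\<close> is represented by the right path from
  \<open>\<one>\<close> to \<open>v\<close> followed by the left path back, and its inverse by the
  reverse tour. As \<open>V\<close> generates, concatenation yields all elements.\<close>

lemma loop_exists:
  assumes X: "F_basis G X" and Y: "F_basis G Y" and V: "translator G X Y V" and r: "r \<in> words G"
  obtains u p where "loop G X Y V r u p"
proof -
  have Vc: "V \<subseteq> carrier G" "conn G X (inverses V)" "conn G Y V" "\<one> \<in> V"
    using V by (auto simp: translator_def)
  have letc: "letters G Y \<subseteq> carrier G" using letters_subset basis_subset [OF Y] by blast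
  have rc: "set (rights p) \<subseteq> carrier G" if "is_path G X Y V u p v" for u p v
    using is_path_letters [OF that] letc by blast
  have *: "\<exists>p. is_path G X Y V \<one> p \<one> \<and> seq_prod G (rights p) = g" if "g \<in> generate G V" for g
    using that
  proof induction
    case one
    show ?case using Vc by (intro exI [of _ "[]"]) auto
  next
    case (incl v)
    obtain q where "is_path G X Y V v q \<one>" "rights q = []"
      using left_path_exists [OF X Y Vc(1,2) incl Vc(4)] by blast
    moreover have "v \<in> carrier G" using incl Vc by auto
    ultimately show ?case using right_path_exists [OF Y Vc(1,3,4) incl, of X] Y
      by (intro exI [of _ "map Rgt (word G Y (inv \<one> \<otimes> v)) @ q"]) (auto simp: is_path_append)
  next
    case (inv v)
    obtain q where "is_path G X Y V \<one> q v" "rights q = []"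
      using left_path_exists [OF X Y Vc(1,2,4) inv] by blast
    moreover have "v \<in> carrier G" using inv Vc by auto
    ultimately show ?case using right_path_exists [OF Y Vc(1,3) inv Vc(4), of X] Y
      by (intro exI [of _ "q @ map Rgt (word G Y (inv v \<otimes> \<one>))"]) (auto simp: is_path_append)
  next
    case (eng g h)
    then obtain p q where pq: "is_path G X Y V \<one> p \<one>" "seq_prod G (rights p) = g"
      "is_path G X Y V \<one> q \<one>" "seq_prod G (rights q) = h" by blast
    then show ?case using rc [OF pq(1)] rc [OF pq(3)]
      by (intro exI [of _ "p @ q"]) (auto simp: is_path_append seq_prod_append)
  qed
  have gen: "generate G V = carrier G" using V by (simp add: translator_def)
  consider g where "r = Straight g" "g \<in> carrier G"
    | g where "r = Cyclic (conjugacy_class G g)" "g \<in> carrier G"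
    using r by (auto simp: words_def)
  then show ?thesis
  proof cases
    case 1
    then show ?thesis using * [of g] gen that by (auto simp: loop_def)
  next
    case 2
    have "g = \<one> \<otimes> g \<otimes> inv \<one>" using 2 by simp
    then have "g \<in> conjugacy_class G g" unfolding conjugacy_class_def by blast
    then show ?thesis using 2 * [of g] gen that [of \<one>] by (auto simp: loop_def)
  qed
qed

text \<open>For a path closed at \<open>u\<close>, the left product \<open>?A\<close> and the right
  product \<open>?B\<close> satisfy \<open>?A \<otimes> u \<otimes> ?B = u\<close>. So
  \<open>inv ?A\<close> is a conjugate of \<open>?B\<close>, and equal to it if
  \<open>u = \<one>\<close>: both sides represent the same word.\<close>

lemma loop_swap:
  assumes X: "F_basis G X" and Y: "F_basis G Y" and V: "V \<subseteq> carrier G" and r: "r \<in> words G"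
    and p: "loop G X Y V r u p"
  shows "loop G Y X (inverses V) r (inv u) (map (swap_step G) p)"
proof -
  have path: "is_path G X Y V u p u" using p by (simp add: loop_def)
  have uc: "u \<in> carrier G" using is_path_mem [OF path] V by auto
  have "letters G X \<subseteq> carrier G" "letters G Y \<subseteq> carrier G"
    using letters_subset basis_subset X Y by blast+
  then have c: "set (lefts p) \<subseteq> carrier G" "set (rights p) \<subseteq> carrier G"
    using is_path_letters [OF path] by blast+
  let ?A = "seq_prod G (rev (lefts p))" and ?B = "seq_prod G (rights p)"
  have AB: "?A \<in> carrier G" "?B \<in> carrier G" using c by simp_all
  have "?A \<otimes> u \<otimes> ?B = u" using is_path_target [OF X Y V path] by simp
  then have "inv ?A \<otimes> (?A \<otimes> u \<otimes> ?B) \<otimes> inv u = inv ?A \<otimes> u \<otimes> inv u" by simp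
  then have "inv ?A = u \<otimes> ?B \<otimes> inv u" using AB uc by (simp add: m_assoc)
  moreover have "seq_prod G (rights (map (swap_step G) p)) = inv ?A"
    using seq_prod_inv [of "rev (lefts p)"] c by (simp add: rights_swap rev_map)
  ultimately have eq: "seq_prod G (rights (map (swap_step G) p)) = u \<otimes> ?B \<otimes> inv u" by simp
  have "is_path G Y X (inverses V) (inv u) (map (swap_step G) p) (inv u)"
    by (rule is_path_swap [OF X Y V path])
  moreover have "u \<otimes> ?B \<otimes> inv u \<in> C" if "?B \<in> C" "C = conjugacy_class G g" "g \<in> carrier G" for C g
    using conj_conjugacy_class [of g ?B "inv u"] that uc by simp
  ultimately show ?thesis using p r eq AB by (auto simp: loop_def words_def)
qed

lemma shortest_loop_rights:
  assumes X: "F_basis G X" and Y: "F_basis G Y" and V: "translator G X Y V" and r: "r \<in> words G"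
    and p: "loop G X Y V r u p" and shortest: "\<And>u' p'. loop G X Y V r u' p' \<Longrightarrow> length p \<le> length p'"
  shows "length (rights p) = word_length G Y r"
proof -
  have path: "is_path G X Y V u p u" using p by (simp add: loop_def)
  have red: "reduced_seq G Y (rights p)"
  proof (rule ccontr)
    assume "\<not> ?thesis"
    then obtain p' where "is_path G X Y V u p' u" "length p' < length p"
      "seq_prod G (rights p') = seq_prod G (rights p)" using shorten_rights [OF X Y V path] by blast
    then show False using p shortest [of u p'] by (auto simp: loop_def split: fword.splits)
  qed
  consider g where "r = Straight g" "g \<in> carrier G"
    | g where "r = Cyclic (conjugacy_class G g)" "g \<in> carrier G"
    using r by (auto simp: words_def)
  then show ?thesis
  proof cases
    case 1
    then show ?thesis using p word_unique [OF Y red] by (auto simp: loop_def word_length_Straight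
          simp del: word_length.simps)
  next
    case 2
    have mem: "seq_prod G (rights p) \<in> conjugacy_class G g" using p 2 by (simp add: loop_def)
    have "hd (rights p) \<noteq> inv (last (rights p))" if ne: "rights p \<noteq> []"
    proof
      assume eq: "hd (rights p) = inv (last (rights p))"
      let ?b = "last (rights p)"
      have bl: "?b \<in> letters G Y" using is_path_letters [OF path] last_in_set [OF ne] by blast
      have "rights p = butlast (rights p) @ [?b]" using ne by simp
      then obtain q p0 where split: "p = p0 @ Rgt ?b # q" "rights q = []" "rights p0 = butlast (rights p)"
        by (rule rights_split_last)
      have ne': "rights p0 \<noteq> []"
      proof
        assume "rights p0 = []"
        then have "hd (rights p) = ?b" using split(3) ne by (cases "rights p") (auto split: if_splits)
        then show False using eq inv_letter_neq [OF Y bl] by simp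
      qed
      then have hd: "hd (rights p0) = inv ?b" using split(3) eq by (cases "rights p") (auto split: if_splits)
      \<comment> \<open>Rotate the loop so that its last right step comes first. The cyclic
        cancellation then happens inside a path, and \<open>shorten_rights\<close> yields a shorter
        loop.\<close>
      obtain v where v: "is_path G X Y V v ((Rgt ?b # q) @ p0) v"
        "seq_prod G (rights ((Rgt ?b # q) @ p0)) \<in> conjugacy_class G g"
        using rotate_path [OF Y, of X V u p0 "Rgt ?b # q" g] path mem split(1) 2 by metis
      have "rights ((Rgt ?b # q) @ p0) = [?b] @ rights p0" using split by simp
      then have "\<not> reduced_seq G Y (rights ((Rgt ?b # q) @ p0))"
        using reduced_seq_append_iff [of Y "[?b]" "rights p0"] ne' hd by simp
      then obtain p' where p': "is_path G X Y V v p' v" "length p' < length ((Rgt ?b # q) @ p0)"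
        "seq_prod G (rights p') = seq_prod G (rights ((Rgt ?b # q) @ p0))"
        using shorten_rights [OF X Y V v(1)] by blast
      then have "loop G X Y V r v p'" using v 2 by (simp add: loop_def)
      moreover have "length ((Rgt ?b # q) @ p0) = length p" by (subst split(1)) simp
      ultimately show False using shortest [of v p'] p' by simp
    qed
    then have "cyclically_reduced_seq G Y (rights p)"
      using red by (auto simp: cyclically_reduced_seq_def reduced_seq_append_iff)
    then show ?thesis using word_length_Cyclic [OF Y 2(2) _ mem] 2 by metis
  qed
qed

text \<open>Minimise the number of all steps, left and right. This number is invariant under
  inversion, so \<open>shortest_loop_rights\<close> applies to both sides of the same loop.\<close>

lemma tight_loop_exists:
  assumes X: "F_basis G X" and Y: "F_basis G Y" and V: "translator G X Y V" and r: "r \<in> words G"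
  obtains u p where "loop G X Y V r u p" "length (rights p) = word_length G Y r"
    "length (lefts p) = word_length G X r"
proof -
  obtain u0 p0 where "loop G X Y V r u0 p0" using loop_exists [OF X Y V r] by blast
  then obtain z where z: "loop G X Y V r (fst z) (snd z)"
    and least: "\<And>z'. loop G X Y V r (fst z') (snd z') \<Longrightarrow> length (snd z) \<le> length (snd z')"
    using ex_has_least_nat [of "\<lambda>z. loop G X Y V r (fst z) (snd z)" "(u0, p0)" "\<lambda>z. length (snd z)"]
    by auto
  obtain u p where up: "loop G X Y V r u p"
    and shortest: "\<And>u' p'. loop G X Y V r u' p' \<Longrightarrow> length p \<le> length p'"
    using z least [of "(_, _)"] by auto
  have Vc: "V \<subseteq> carrier G" "inverses V \<subseteq> carrier G" using V by (auto simp: translator_def)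
  have "length (rights p) = word_length G Y r"
    using shortest_loop_rights [OF X Y V r up] shortest by blast
  moreover have "length (rights (map (swap_step G) p)) = word_length G X r"
  proof (rule shortest_loop_rights [OF Y X translator_swap [OF V] r loop_swap [OF X Y Vc(1) r up]])
    fix u' p' assume "loop G Y X (inverses V) r u' p'"
    from loop_swap [OF Y X Vc(2) r this] Vc(1) have "loop G X Y V r (inv u') (map (swap_step G) p')"
      by simp
    from shortest [OF this] show "length (map (swap_step G) p) \<le> length p'" by simp
  qed
  ultimately show ?thesis using that up by (simp add: rights_swap)
qed

lemma cross_left_swap:
  assumes X: "F_basis G X" and Y: "F_basis G Y" and V: "V \<subseteq> carrier G" and "is_path G X Y V u p v"
    and "w \<in> carrier G" "x \<in> carrier G"
  shows "cross_right G (inv w) (inv x) (inv u) (map (swap_step G) p) = cross_left G w x u p"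
  using assms(4)
proof (induction p arbitrary: u)
  case (Cons s p)
  have uc: "u \<in> carrier G" using Cons.prems V by auto
  show ?case
  proof (cases s)
    case (Lft z)
    have zc: "z \<in> carrier G" using Lft Cons.prems letter_closed [OF X] by auto
    have "inv z = inv x \<longleftrightarrow> z = x" "inv u = inv w \<longleftrightarrow> u = w" "inv z = inv (inv x) \<longleftrightarrow> z = inv x"
      "inv u = inv (x \<otimes> w) \<longleftrightarrow> u = x \<otimes> w" using zc uc assms(5,6) by (metis inv_inv inv_closed m_closed)+
    then show ?thesis using Lft Cons.IH [of "z \<otimes> u"] Cons.prems zc uc assms(5,6)
      by (simp add: inv_mult_group)
  next
    case (Rgt z)
    have zc: "z \<in> carrier G" using Rgt Cons.prems letter_closed [OF Y] by auto
    then show ?thesis using Rgt Cons.IH [of "u \<otimes> z"] Cons.prems uc by (simp add: inv_mult_group)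
  qed
qed simp

lemma cross_left_inv:
  assumes V: "V \<subseteq> carrier G" and "is_path G X Y V u p v" and "w \<in> carrier G" "x \<in> carrier G"
  shows "cross_left G (x \<otimes> w) (inv x) u p = cross_left G w x u p"
  using assms(2)
proof (induction p arbitrary: u)
  case (Cons s p)
  then show ?case using assms(3,4) by (cases s) auto
qed simp

end

section \<open>The exchange\<close>

text \<open>
  The vertices that the edge from \<open>w\<close> to \<open>x w\<close> separates from \<open>w\<close> in the left tree on \<open>V\<close>.
\<close>

definition far :: "('a, 'b) monoid_scheme \<Rightarrow> 'a set \<Rightarrow> 'a set \<Rightarrow> 'a \<Rightarrow> 'a \<Rightarrow> 'a set" where
  "far F X V w x = {v \<in> V. v \<noteq> w \<and> last (word F X (v \<otimes>\<^bsub>F\<^esub> inv\<^bsub>F\<^esub> w)) = x}"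

context group
begin

lemma word_letter_mult:
  assumes Z: "F_basis G Z" and g: "g \<in> carrier G" and z: "z \<in> letters G Z"
  shows "word G Z (z \<otimes> g) =
    (if word G Z g \<noteq> [] \<and> hd (word G Z g) = inv z then tl (word G Z g) else z # word G Z g)"
proof -
  have zc: "z \<in> carrier G" using letter_closed [OF Z z] .
  have c: "set (word G Z g) \<subseteq> carrier G" using word_carrier Z g by blast
  show ?thesis
  proof (cases "word G Z g \<noteq> [] \<and> hd (word G Z g) = inv z")
    case True
    then have split: "word G Z g = [inv z] @ tl (word G Z g)" by (metis append_Cons append_Nil list.collapse)
    have tc: "set (tl (word G Z g)) \<subseteq> carrier G" using c True by (meson list.set_sel(2) subset_iff)
    have "g = inv z \<otimes> seq_prod G (tl (word G Z g))"
      using word_prod [OF Z g] split by (metis append_Cons append_Nil seq_prod_Cons)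
    then have "seq_prod G (tl (word G Z g)) = z \<otimes> g" using zc tc by (metis mult_inv_cancel(2) seq_prod_closed)
    moreover have "reduced_seq G Z (tl (word G Z g))"
      using word_reduced [OF Z g] split by (metis reduced_seq_append_iff)
    ultimately show ?thesis using word_eqI [OF Z] True by simp
  next
    case False
    have "word G Z (z \<otimes> g) = word G Z z @ word G Z g"
      using False Z z g zc by (intro word_mult_reduced) auto
    then show ?thesis using False Z z by auto
  qed
qed

text \<open>A left step changes the word of \<open>v \<otimes> inv w\<close> at its front. Its last
  letter is the first edge on the way from \<open>w\<close> to \<open>v\<close>, and it stays the
  same unless the word is empty before or after the step.\<close>

lemma far_crossing:
  assumes X: "F_basis G X" and V: "V \<subseteq> carrier G" and w: "w \<in> V" and v: "v \<in> V" and z: "z \<in> letters G X"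
    and "v \<notin> far G X V w x" "z \<otimes> v \<in> far G X V w x"
  shows "v = w \<and> z = x"
proof -
  have c: "w \<in> carrier G" "v \<in> carrier G" "z \<in> carrier G" using w v V letter_closed [OF X z] by auto
  let ?g = "v \<otimes> inv w"
  have gc: "?g \<in> carrier G" using c by simp
  have eq: "z \<otimes> v \<otimes> inv w = z \<otimes> ?g" using c by (simp add: m_assoc)
  have zv: "z \<otimes> v \<noteq> w" "last (word G X (z \<otimes> ?g)) = x" using assms(7) eq by (auto simp: far_def)
  have "word G X (z \<otimes> ?g) \<noteq> []"
  proof
    assume "word G X (z \<otimes> ?g) = []"
    then have "z \<otimes> v \<otimes> inv w = \<one>" using word_Nil_iff [OF X] gc c eq by simp
    then show False using zv(1) c by (metis inv_equality inv_inv inv_closed m_closed)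
  qed
  then have "last (word G X (z \<otimes> ?g)) = (if word G X ?g = [] then z else last (word G X ?g))"
    using word_letter_mult [OF X gc z] by (auto simp: last_tl split: if_splits)
  moreover have "v = w" if "word G X ?g = []"
    using that word_Nil_iff [OF X gc] c by (metis inv_equality inv_inv inv_closed)
  ultimately show ?thesis using zv(2) assms(6) v by (auto simp: far_def split: if_splits)
      (metis c(1) list.simps(3) r_inv word_one [OF X])+
qed

lemma far_crossing_back:
  assumes X: "F_basis G X" and V: "V \<subseteq> carrier G" and w: "w \<in> V" and v: "z \<otimes> v \<in> V" and z: "z \<in> letters G X"
    and "v \<in> far G X V w x" "z \<otimes> v \<notin> far G X V w x"
  shows "z \<otimes> v = w \<and> z = inv x"
proof -
  have c: "v \<in> carrier G" "z \<in> carrier G" using assms(6) V letter_closed [OF X z] by (auto simp: far_def)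
  then have "inv z \<otimes> (z \<otimes> v) \<in> far G X V w x" using assms(6) by simp
  from far_crossing [OF X V w v inv_letter [OF X z] assms(7) this] show ?thesis using c by auto
qed

lemma conn_Un:
  assumes "conn G Z A" "conn G Z B" "A \<inter> B \<noteq> {}"
  shows "conn G Z (A \<union> B)"
proof -
  obtain c where c: "c \<in> A" "c \<in> B" using assms(3) by blast
  have "(adj G Z A)\<^sup>* \<subseteq> (adj G Z (A \<union> B))\<^sup>*" "(adj G Z B)\<^sup>* \<subseteq> (adj G Z (A \<union> B))\<^sup>*"
    by (intro adj_rtrancl_mono; blast)+
  then have "(u, c) \<in> (adj G Z (A \<union> B))\<^sup>* \<and> (c, u) \<in> (adj G Z (A \<union> B))\<^sup>*" if "u \<in> A \<union> B" for u
    using that assms(1,2) c unfolding conn_def by blast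
  then show ?thesis unfolding conn_def by (meson rtrancl_trans)
qed

lemma conn_insert:
  assumes Z: "F_basis G Z" and A: "conn G Z A" "A \<subseteq> carrier G" and a: "a \<in> A" and z: "z \<in> letters G Z"
  shows "conn G Z (insert (a \<otimes> z) A)"
proof -
  have c: "a \<in> carrier G" "z \<in> carrier G" using a A letter_closed [OF Z z] by auto
  have "conn G Z {a, a \<otimes> z}"
  proof (rule conn_rootI [OF Z, of _ a])
    fix v assume "v \<in> {a, a \<otimes> z}"
    moreover have "(a, a \<otimes> z) \<in> adj G Z {a, a \<otimes> z}" using z by (auto simp: adj_def)
    ultimately show "(a, v) \<in> (adj G Z {a, a \<otimes> z})\<^sup>*" by auto
  qed (use c in auto)
  from conn_Un [OF A(1) this] have "conn G Z (A \<union> {a, a \<otimes> z})" using a by blast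
  moreover have "A \<union> {a, a \<otimes> z} = insert (a \<otimes> z) A" using a by blast
  ultimately show ?thesis by simp
qed

end

text \<open>
  In Whitehead's model, the sphere of \<open>y\<close> is cut along its intersection with the disc given by the
  edge from \<open>w\<close> to \<open>x w\<close> of the left tree, and its part on the far side \<open>Q\<close> is replaced by that
  disc. On \<open>V\<close> this means to cut the left tree at this edge and to glue \<open>Q\<close> to the remainder along
  the right edges labelled \<open>y\<close> that start in \<open>Q\<close>: the part \<open>Q\<close> is right translated by \<open>cQ\<close> and the
  remainder by \<open>cP\<close>, where \<open>cQ = y cP\<close> makes the ends of those edges coincide and the part with
  \<open>1\<close> stays fixed. A letter \<open>z\<close> of \<open>Y\<close> then becomes \<open>\<phi> z\<close>; the letter \<open>y\<close> now labels the edge at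
  which the left tree was cut.
\<close>

locale exchange = group G for G (structure) +
  fixes X Y V :: "'a set" and w x y e :: 'a
  assumes X: "F_basis G X" and Y: "F_basis G Y" and translator: "translator G X Y V" and fin: "finite V"
    and x: "x \<in> letters G X" and w: "w \<in> V" and xw: "x \<otimes> w \<in> V"
    and y: "y \<in> letters G Y" and e: "e \<in> far G X V w x" "e \<otimes> y \<in> V"
    and sep: "\<And>z. z \<in> letters G Y \<Longrightarrow> z \<noteq> y \<Longrightarrow>
      ends G V z \<subseteq> far G X V w x \<or> ends G V z \<inter> far G X V w x = {}"
    and inv_y: "ends G V (inv y) \<inter> far G X V w x = {}"
begin

definition Q where "Q = far G X V w x"
definition cP where "cP = (if \<one> \<in> Q then inv y else \<one>)"
definition cQ where "cQ = (if \<one> \<in> Q then \<one> else y)"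
definition c where "c v = (if v \<in> Q then cQ else cP)"
definition f where "f v = v \<otimes> c v"
text \<open>The value of \<open>c\<close> at the start of the edges labelled \<open>z\<close>. For
  \<open>z \<noteq> y\<close> it depends on \<open>z\<close> alone, by \<open>sep\<close>. The
  letter \<open>y\<close> gets \<open>cP\<close>: its edges starting in \<open>Q\<close> are
  collapsed, and those that survive start outside \<open>Q\<close>.\<close>

definition sd where "sd z = (if z \<noteq> y \<and> ends G V z \<inter> Q \<noteq> {} then cQ else cP)"
definition \<phi> where "\<phi> z = inv (sd z) \<otimes> z \<otimes> sd (inv z)"
text \<open>Extends to the inverse of the extension of \<open>\<phi>\<close>: both multiply letters
  by powers of \<open>y\<close> and fix \<open>y\<close> itself.\<close>

definition \<psi> where "\<psi> z = sd z \<otimes> z \<otimes> inv (sd (inv z))"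
definition Y' where "Y' = ext G Y \<phi> ` Y"
text \<open>The extra vertex makes up for the cut: it equals \<open>f w \<otimes> y\<close>, and its
  left edge labelled \<open>x\<close> leads to \<open>f (x \<otimes> w)\<close>. So both labels are
  present.\<close>

definition V' where "V' = insert (w \<otimes> cQ) (f ` V)"

lemma Vc: "V \<subseteq> carrier G" and oneV: "\<one> \<in> V" and connY: "conn G Y V"
  and connX: "conn G X (inverses V)" and gen: "generate G V = carrier G"
  using translator by (auto simp: translator_def)

lemma closed [simp]: "x \<in> carrier G" "y \<in> carrier G" "w \<in> carrier G" "e \<in> carrier G"
  "cP \<in> carrier G" "cQ \<in> carrier G" "c v \<in> carrier G" "sd z \<in> carrier G"
  using letter_closed X Y x y w e Vc by (auto simp: cP_def cQ_def c_def sd_def far_def)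

lemma V_closed: "v \<in> V \<Longrightarrow> v \<in> carrier G"
  using Vc by auto

lemma Y_closed: "z \<in> letters G Y \<Longrightarrow> z \<in> carrier G"
  using letter_closed [OF Y] .

text \<open>This keeps \<open>\<one>\<close> in the translator, and it lets a loop based at
  \<open>\<one>\<close> represent the same straight word after the exchange.\<close>

lemma c_one: "c \<one> = \<one>"
  by (simp add: c_def cP_def cQ_def)

lemma cP_cQ: "y \<otimes> cP = cQ" "cP \<otimes> y = cQ" "inv cP \<otimes> cQ = y" "inv cQ \<otimes> cP = inv y"
  "inv cQ \<otimes> (y \<otimes> cP) = \<one>" "inv cP \<otimes> (y \<otimes> cP) = y" "inv cP \<otimes> (inv y \<otimes> cQ) = \<one>"
  by (auto simp: cP_def cQ_def)

lemma Q_subset: "Q \<subseteq> V"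
  by (auto simp: Q_def far_def)

lemma w_notin_Q: "w \<notin> Q" and xw_Q: "x \<otimes> w \<in> Q"
proof -
  show "w \<notin> Q" by (auto simp: Q_def far_def)
  have "x \<noteq> \<one>" using one_not_letter [OF X] x by blast
  then have "x \<otimes> w \<noteq> w" by simp
  then show "x \<otimes> w \<in> Q" using xw x X by (simp add: Q_def far_def m_assoc)
qed

text \<open>The shift is constant on each side, so along left edges it jumps only at the cut, by
  \<open>y\<close> or \<open>inv y\<close>.\<close>

lemma cross_left_edge:
  assumes v: "v \<in> V" and z: "z \<in> letters G X" and zv: "z \<otimes> v \<in> V"
  shows "inv (c v) \<otimes> c (z \<otimes> v) =
    (if v = w \<and> z = x then y else if v = x \<otimes> w \<and> z = inv x then inv y else \<one>)"
proof -
  have vc: "v \<in> carrier G" "z \<in> carrier G" using v Vc letter_closed [OF X z] by auto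
  have ne: "x \<otimes> w \<noteq> w" using xw_Q w_notin_Q by auto
  show ?thesis
  proof (cases "v \<in> Q"; cases "z \<otimes> v \<in> Q")
    assume "v \<in> Q" "z \<otimes> v \<in> Q"
    then show ?thesis using w_notin_Q by (auto simp: c_def m_assoc)
  next
    assume a: "v \<in> Q" "z \<otimes> v \<notin> Q"
    then have "z \<otimes> v = w \<and> z = inv x" using far_crossing_back [OF X Vc w zv z] by (simp add: Q_def)
    then have "v = x \<otimes> w" "z = inv x" using vc by (auto simp: m_assoc)
    then show ?thesis using a ne by (auto simp: c_def cP_cQ)
  next
    assume a: "v \<notin> Q" "z \<otimes> v \<in> Q"
    then have "v = w \<and> z = x" using far_crossing [OF X Vc w v z] by (simp add: Q_def)
    then show ?thesis using a by (auto simp: c_def cP_cQ)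
  next
    assume a: "v \<notin> Q" "z \<otimes> v \<notin> Q"
    then show ?thesis using xw_Q by (auto simp: c_def)
  qed
qed

lemma ey_notin_Q: "e \<otimes> y \<notin> Q"
proof
  assume "e \<otimes> y \<in> Q"
  moreover have "e \<otimes> y \<in> ends G V (inv y)" using e by (auto simp: ends_def far_def m_assoc)
  ultimately show False using inv_y by (auto simp: Q_def)
qed

lemma eQ: "e \<in> Q" using e by (simp add: Q_def)

text \<open>The new label of a right edge. Edges labelled \<open>y\<close> that start in
  \<open>Q\<close> become trivial, which glues the two sides; for all others the shifts at both ends
  are determined by the label.\<close>

lemma right_edge:
  assumes v: "v \<in> V" and z: "z \<in> letters G Y" and vz: "v \<otimes> z \<in> V"
  shows "inv (c v) \<otimes> z \<otimes> c (v \<otimes> z) =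
    (if z = y \<and> v \<in> Q \<or> z = inv y \<and> v \<otimes> z \<in> Q then \<one> else \<phi> z)"
proof -
  have vc: "v \<in> carrier G" "z \<in> carrier G" using v z V_closed Y_closed by auto
  have m: "v \<in> ends G V z" "v \<otimes> z \<in> ends G V (inv z)" using v vz vc by (auto simp: ends_def m_assoc)
  have sd: "c u = sd a" if "a \<in> letters G Y" "u \<in> ends G V a" "\<not> (a = y \<and> u \<in> Q)" for a u
    using that sep [of a] by (auto simp: c_def sd_def Q_def)
  show ?thesis
  proof (cases "z = y \<and> v \<in> Q")
    case True
    then have "v \<otimes> y \<notin> Q" using m inv_y by (auto simp: Q_def)
    then show ?thesis using True by (simp add: c_def cP_cQ m_assoc)
  next
    case False
    show ?thesis
    proof (cases "z = inv y \<and> v \<otimes> z \<in> Q")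
      case True
      then have "v \<notin> Q" using m inv_y by (auto simp: Q_def)
      moreover have "inv cP \<otimes> inv y \<otimes> cQ = \<one>" using cP_cQ(7) by (simp add: m_assoc)
      ultimately show ?thesis using True by (auto simp: c_def)
    next
      case ne: False
      have "c v = sd z" by (rule sd [OF z m(1) False])
      moreover have "c (v \<otimes> z) = sd (inv z)"
        
      proof (rule sd [OF inv_letter [OF Y z] m(2)])
        show "\<not> (inv z = y \<and> v \<otimes> z \<in> Q)" using ne vc by auto
      qed
      ultimately show ?thesis using False ne by (auto simp: \<phi>_def)
    qed
  qed
qed

section \<open>The new basis \<open>Y'\<close>\<close>

lemma \<phi>_closed: "z \<in> letters G Y \<Longrightarrow> \<phi> z \<in> carrier G"
  and \<psi>_closed: "z \<in> letters G Y \<Longrightarrow> \<psi> z \<in> carrier G"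
  using Y_closed by (simp_all add: \<phi>_def \<psi>_def)

lemma \<phi>_inv: "z \<in> letters G Y \<Longrightarrow> \<phi> (inv z) = inv (\<phi> z)"
  and \<psi>_inv: "z \<in> letters G Y \<Longrightarrow> \<psi> (inv z) = inv (\<psi> z)"
  using Y_closed by (simp_all add: \<phi>_def \<psi>_def m_assoc inv_mult_group)

lemma sd_y: "sd y = cP" "sd (inv y) = cP"
  using inv_y by (auto simp: sd_def Q_def)

lemma \<phi>_y: "\<phi> y = y" and \<psi>_y: "\<psi> y = y"
proof -
  show "\<phi> y = y" by (simp add: \<phi>_def sd_y cP_cQ m_assoc)
  have "cP \<otimes> y = y \<otimes> cP" by (simp add: cP_cQ)
  then show "\<psi> y = y" by (simp add: \<psi>_def sd_y m_assoc)
qed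

lemma ext_bij:
  "bij_betw (ext G Y \<phi>) (carrier G) (carrier G)"
proof -
  \<comment> \<open>Stated for arbitrary \<open>a\<close> and \<open>b\<close> to serve both orders
    of composition: \<open>a\<close> fixes the powers of \<open>y\<close> by which \<open>b\<close>
    multiplies, so it undoes \<open>b\<close> letter by letter.\<close>
  have *: "ext G Y a (ext G Y b g) = g"
    if a: "\<And>z. z \<in> letters G Y \<Longrightarrow> a z \<in> carrier G" "\<And>z. z \<in> letters G Y \<Longrightarrow> a (inv z) = inv (a z)"
      and b: "\<And>z. z \<in> letters G Y \<Longrightarrow> b z \<in> carrier G"
      and ay: "a y = y" 
      and ab: "\<And>z. z \<in> letters G Y \<Longrightarrow> \<exists>s\<in>{\<one>, y, inv y}. \<exists>t\<in>{\<one>, y, inv y}. b z = s \<otimes> z \<otimes> t \<and> s \<otimes> a z \<otimes> t = z"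
      and g: "g \<in> carrier G" for a b g
  proof -
    have am: "ext G Y a (g \<otimes> h) = ext G Y a g \<otimes> ext G Y a h" if "g \<in> carrier G" "h \<in> carrier G" for g h
      by (rule ext_mult [OF Y]) (simp_all add: a that)
    have a1: "ext G Y a \<one> = \<one>" using Y by (simp add: ext_def)
    have al: "ext G Y a z = a z" if "z \<in> letters G Y" for z
      using ext_letter [OF Y that] a that by simp
    have ac: "ext G Y a t = t" if "t \<in> {\<one>, y, inv y}" for t
      using that a1 al [OF y] al [OF inv_letter [OF Y y]] ay a(2) [OF y] by auto
    have abz: "ext G Y a (b z) = z" if z: "z \<in> letters G Y" for z
    proof -
      obtain s t where st: "s \<in> {\<one>, y, inv y}" "t \<in> {\<one>, y, inv y}" "b z = s \<otimes> z \<otimes> t" "s \<otimes> a z \<otimes> t = z"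
        using ab [OF z] by blast
      then have "s \<in> carrier G" "t \<in> carrier G" by auto
      then show ?thesis using st ac [OF st(1)] ac [OF st(2)] al [OF z] am Y_closed [OF z] by simp
    qed
    have "ext G Y a (seq_prod G (map b zs)) = seq_prod G zs" if "set zs \<subseteq> letters G Y" for zs
      using that
    proof (induction zs)
      case (Cons z zs)
      have "set (map b zs) \<subseteq> carrier G" using Cons.prems b by auto
      then have "seq_prod G (map b zs) \<in> carrier G" by (rule seq_prod_closed)
      then show ?case using Cons b abz am by simp
    qed (simp add: a1)
    from this [OF word_letters [OF Y g]] show ?thesis using Y g by (simp add: ext_def)
  qed
  have mem: "sd z \<in> {\<one>, y, inv y}" "inv (sd z) \<in> {\<one>, y, inv y}" for z
    by (auto simp: sd_def cP_def cQ_def)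
  have "ext G Y \<phi> (ext G Y \<psi> g) = g" if "g \<in> carrier G" for g
  proof -
    have "\<exists>s\<in>{\<one>, y, inv y}. \<exists>t\<in>{\<one>, y, inv y}. \<psi> z = s \<otimes> z \<otimes> t \<and> s \<otimes> \<phi> z \<otimes> t = z"
      if z: "z \<in> letters G Y" for z
      using mem Y_closed [OF z]
      by (intro bexI [of _ "sd z"] bexI [of _ "inv (sd (inv z))"]) (auto simp: \<phi>_def \<psi>_def m_assoc)
    then show ?thesis
      by (intro * [of \<phi> \<psi>] that \<phi>_y) (simp_all add: \<phi>_closed \<phi>_inv \<psi>_closed)
  qed
  moreover have "ext G Y \<psi> (ext G Y \<phi> g) = g" if "g \<in> carrier G" for g
  proof -
    have "\<exists>s\<in>{\<one>, y, inv y}. \<exists>t\<in>{\<one>, y, inv y}. \<phi> z = s \<otimes> z \<otimes> t \<and> s \<otimes> \<psi> z \<otimes> t = z"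
      if z: "z \<in> letters G Y" for z
      using mem Y_closed [OF z]
      by (intro bexI [of _ "inv (sd z)"] bexI [of _ "sd (inv z)"]) (auto simp: \<phi>_def \<psi>_def m_assoc)
    then show ?thesis
      by (intro * [of \<psi> \<phi>] that \<psi>_y) (simp_all add: \<psi>_closed \<psi>_inv \<phi>_closed)
  qed
  ultimately show ?thesis
    using ext_closed [OF Y \<phi>_closed] ext_closed [OF Y \<psi>_closed]
    by (intro bij_betw_byWitness [where f' = "ext G Y \<psi>"]) auto
qed

lemma ext_\<phi>: "z \<in> letters G Y \<Longrightarrow> ext G Y \<phi> z = \<phi> z"
  by (rule ext_letter [OF Y]) (simp_all add: \<phi>_closed)

lemma Y'_basis: "F_basis G Y'" and letters_Y': "letters G Y' = \<phi> ` letters G Y"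
proof -
  show "F_basis G Y'" unfolding Y'_def
    by (rule basis_image [OF Y ext_bij]) (rule ext_mult [OF Y]; simp add: \<phi>_closed \<phi>_inv)
  have "letters G Y' = ext G Y \<phi> ` letters G Y" unfolding Y'_def
    by (rule basis_image [OF Y ext_bij]) (rule ext_mult [OF Y]; simp add: \<phi>_closed \<phi>_inv)
  then show "letters G Y' = \<phi> ` letters G Y"
    using ext_\<phi> by (metis image_cong)
qed

lemma whitehead: "whitehead_transform G Y Y'"
  unfolding whitehead_transform_def
proof (intro conjI Y Y'_basis)
  \<comment> \<open>The shift is trivial on the side of \<open>\<one>\<close>, so the only factors
    that occur are \<open>t\<close> on the left of a letter and \<open>inv t\<close> on its
    right.\<close>
  define t where "t = (if \<one> \<in> Q then y else inv y)"
  have mem: "inv (sd z) \<in> {\<one>, t}" "sd z \<in> {\<one>, inv t}" for z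
    by (auto simp: sd_def cP_def cQ_def t_def)
  have "Y' \<subseteq> {\<one>, t} <#> Y <#> {\<one>, inv t}"
  proof
    fix z' assume "z' \<in> Y'"
    then obtain z where z: "z \<in> Y" "z' = ext G Y \<phi> z" by (auto simp: Y'_def)
    then have "z' = inv (sd z) \<otimes> z \<otimes> sd (inv z)"
      using ext_\<phi> by (simp add: letters_def \<phi>_def)
    then show "z' \<in> {\<one>, t} <#> Y <#> {\<one>, inv t}"
      using mem z unfolding set_mult_def by blast
  qed
  moreover have "t \<in> letters G Y" using y inv_letter [OF Y y] by (simp add: t_def)
  ultimately show "\<exists>x\<in>letters G Y. Y' \<subseteq> {\<one>, x} <#> Y <#> {\<one>, inv x}" by blast
qed


section \<open>The new translator \<open>V'\<close>\<close>

lemma f_one: "f \<one> = \<one>"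
  by (simp add: f_def c_one)

lemma f_closed: "v \<in> V \<Longrightarrow> f v \<in> carrier G"
  using V_closed by (simp add: f_def)

lemma V'_subset: "V' \<subseteq> carrier G"
  using f_closed by (auto simp: V'_def)

lemma f_mem: "v \<in> V \<Longrightarrow> f v \<in> V'"
  by (simp add: V'_def)

lemma f_right:
  assumes v: "v \<in> V" and z: "z \<in> letters G Y" and vz: "v \<otimes> z \<in> V"
  shows "f (v \<otimes> z) = (if z = y \<and> v \<in> Q \<or> z = inv y \<and> v \<otimes> z \<in> Q then f v else f v \<otimes> \<phi> z)"
proof -
  have vc: "v \<in> carrier G" "z \<in> carrier G" using v z V_closed Y_closed by auto
  have "f (v \<otimes> z) = f v \<otimes> (inv (c v) \<otimes> z \<otimes> c (v \<otimes> z))"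
    using vc by (simp add: f_def m_assoc)
  then show ?thesis using right_edge [OF assms] f_closed [OF v] by auto
qed

lemma f_left:
  assumes v: "v \<in> V" and z: "z \<in> letters G X" and zv: "z \<otimes> v \<in> V"
    and "\<not> (v = w \<and> z = x)" "\<not> (v = x \<otimes> w \<and> z = inv x)"
  shows "f (z \<otimes> v) = z \<otimes> f v"
proof -
  have vc: "v \<in> carrier G" "z \<in> carrier G" using v V_closed letter_closed [OF X z] by auto
  have "inv (c v) \<otimes> c (z \<otimes> v) = \<one>" using cross_left_edge [OF assms(1-3)] assms(4,5) by auto
  then have "c (z \<otimes> v) = c v" by (metis closed(7) inv_closed inv_equality inv_inv)
  then show ?thesis using vc by (simp add: f_def m_assoc)
qed

lemma f_w: "f w \<otimes> y = w \<otimes> cQ" and f_xw: "f (x \<otimes> w) = x \<otimes> (w \<otimes> cQ)"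
  using w_notin_Q xw_Q by (simp_all add: f_def c_def m_assoc cP_cQ)

lemma f_e: "f (e \<otimes> y) = f e"
  using eQ ey_notin_Q by (simp add: f_def c_def m_assoc cP_cQ)

lemma conn_V'_right: "conn G Y' V'"
proof (rule conn_rootI [OF Y'_basis V'_subset])
  show one: "\<one> \<in> V'" using f_mem [OF oneV] by (simp add: f_one)
  have step: "(\<one>, f v) \<in> (adj G Y' V')\<^sup>*" if "v \<in> V" for v
  proof -
    have "(\<one>, v) \<in> (adj G Y V)\<^sup>*" using connY oneV that by (simp add: conn_def)
    then show ?thesis
    proof induction
      case (step u v)
      then obtain z where z: "u \<in> V" "z \<in> letters G Y" "v = u \<otimes> z" "v \<in> V" by (auto simp: adj_def)
      then have "f v = f u \<or> f v = f u \<otimes> \<phi> z" using f_right [of u z] by auto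
      then have "f v = f u \<or> (f u, f v) \<in> adj G Y' V'"
        using f_mem z letters_Y' by (auto simp: adj_def)
      then show ?case using step.IH by auto
    qed (simp add: f_one)
  qed
  fix v assume "v \<in> V'"
  then consider "v = w \<otimes> cQ" | u where "u \<in> V" "v = f u" by (auto simp: V'_def)
  then show "(\<one>, v) \<in> (adj G Y' V')\<^sup>*"
  proof cases
    case 1
    have "y \<in> letters G Y'" using letters_Y' y \<phi>_y by (metis imageI)
    moreover have "v = f w \<otimes> y" "v \<in> V'" using 1 f_w by (simp_all add: V'_def)
    ultimately have "(f w, v) \<in> adj G Y' V'" using f_mem [OF w] unfolding adj_def by blast
    then show ?thesis using step [OF w] by simp
  qed (use step in simp)
qed

text \<open>The roots are \<open>w\<close> and \<open>x \<otimes> w\<close>. Passing to the parent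
  could leave a side only through the cut edge, whose end on that side is the root.\<close>

lemma conn_sides: "conn G X (inverses (V - Q))" "conn G X (inverses Q)"
proof -
  have *: "\<exists>z\<in>letters G X. inv v \<otimes> inv (last (word G X (inv (inv r) \<otimes> inv v))) = inv (inv z \<otimes> v) \<and> inv z \<otimes> v \<in> V"
    if v: "v \<in> V" and r: "r \<in> V" and ne: "v \<noteq> r" for v r
  proof -
    have vc: "v \<in> carrier G" "r \<in> carrier G" using v r V_closed by auto
    have ne': "inv v \<noteq> inv r" using ne vc by (metis inv_inv)
    let ?l = "last (word G X (inv (inv r) \<otimes> inv v))"
    have sub: "inverses V \<subseteq> carrier G" using Vc by auto
    have g: "inv (inv r) \<otimes> inv v \<in> carrier G" "inv (inv r) \<otimes> inv v \<noteq> \<one>"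
      using vc ne' by (simp, metis inv_closed inv_equality inv_inv)
    have l: "?l \<in> letters G X" using length_word_parent(2) [OF X g] .
    then have lc: "?l \<in> carrier G" using letter_closed [OF X] by blast
    have "inv v \<otimes> inv ?l \<in> inverses V"
      using conn_last [OF X sub connX, of "inv r" "inv v"] v r ne' by auto
    then obtain u where u: "u \<in> V" "inv v \<otimes> inv ?l = inv u" by auto
    have "inv (inv u) = inv (inv v \<otimes> inv ?l)" using u(2) by simp
    then have "u = ?l \<otimes> v" using V_closed [OF u(1)] vc lc by (simp add: inv_mult_group)
    then show ?thesis using l lc u inv_letter [OF X l] by (intro bexI [of _ "inv ?l"]) auto
  qed
  have sub: "inverses (V - Q) \<subseteq> carrier G" "inverses Q \<subseteq> carrier G"
    using Vc Q_subset by auto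
  show "conn G X (inverses (V - Q))"
  proof (rule conn_parentI [OF X sub(1), of "inv w"])
    show "inv w \<in> inverses (V - Q)" using w w_notin_Q by auto
    fix v' assume "v' \<in> inverses (V - Q)" "v' \<noteq> inv w"
    then obtain v where v: "v \<in> V" "v \<notin> Q" "v' = inv v" "v \<noteq> w" by auto
    obtain z where z: "z \<in> letters G X" "inv z \<otimes> v \<in> V"
      "inv v \<otimes> inv (last (word G X (inv (inv w) \<otimes> inv v))) = inv (inv z \<otimes> v)"
      using * [OF v(1) w v(4)] by blast
    have vz: "v = z \<otimes> (inv z \<otimes> v)" using letter_closed [OF X z(1)] V_closed [OF v(1)] by simp
    have "inv z \<otimes> v \<notin> Q"
    proof
      assume q: "inv z \<otimes> v \<in> Q"
      have "z \<otimes> (inv z \<otimes> v) \<in> V" "z \<otimes> (inv z \<otimes> v) \<notin> Q" using vz v by simp_all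
      from far_crossing_back [OF X Vc w this(1) z(1) q [unfolded Q_def] this(2) [unfolded Q_def]]
      show False using vz v(4) by simp
    qed
    then show "v' \<otimes> inv (last (word G X (inv (inv w) \<otimes> v'))) \<in> inverses (V - Q)"
      using z v by auto
  qed
  show "conn G X (inverses Q)"
  proof (rule conn_parentI [OF X sub(2), of "inv (x \<otimes> w)"])
    show "inv (x \<otimes> w) \<in> inverses Q" using xw_Q by blast
    fix v' assume "v' \<in> inverses Q" "v' \<noteq> inv (x \<otimes> w)"
    then obtain v where v: "v \<in> V" "v \<in> Q" "v' = inv v" "v \<noteq> x \<otimes> w" using Q_subset by auto
    obtain z where z: "z \<in> letters G X" "inv z \<otimes> v \<in> V"
      "inv v \<otimes> inv (last (word G X (inv (inv (x \<otimes> w)) \<otimes> inv v))) = inv (inv z \<otimes> v)"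
      using * [OF v(1) xw v(4)] by blast
    have vz: "v = z \<otimes> (inv z \<otimes> v)" using letter_closed [OF X z(1)] V_closed [OF v(1)] by simp
    have "inv z \<otimes> v \<in> Q"
    proof (rule ccontr)
      assume q: "inv z \<otimes> v \<notin> Q"
      have "z \<otimes> (inv z \<otimes> v) \<in> Q" using vz v by simp
      then have "inv z \<otimes> v = w \<and> z = x" using far_crossing [OF X Vc w z(2) z(1)] q by (simp add: Q_def)
      then show False using vz v(4) by auto
    qed
    then show "v' \<otimes> inv (last (word G X (inv (inv (x \<otimes> w)) \<otimes> v'))) \<in> inverses Q"
      using z v by auto
  qed
qed

text \<open>Each side is moved as a whole by a translation, and the images meet because
  \<open>e\<close> and \<open>e \<otimes> y\<close> are identified.\<close>

lemma conn_f_image: "conn G X (inverses (f ` V))"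
proof -
  have P: "inverses (f ` (V - Q)) = (\<lambda>v. inv cP \<otimes> v) ` inverses (V - Q)"
    and Qe: "inverses (f ` Q) = (\<lambda>v. inv cQ \<otimes> v) ` inverses Q"
    using V_closed Q_subset by (auto simp: image_image f_def c_def inv_mult_group intro!: image_cong)
  have sub: "inverses (V - Q) \<subseteq> carrier G" "inverses Q \<subseteq> carrier G"
    using Vc Q_subset by auto
  have "conn G X (inverses (f ` (V - Q)) \<union> inverses (f ` Q))"
  proof (rule conn_Un)
    show "conn G X (inverses (f ` (V - Q)))"
      unfolding P by (rule conn_left_translate) (use sub conn_sides X in auto)
    show "conn G X (inverses (f ` Q))"
      unfolding Qe by (rule conn_left_translate) (use sub conn_sides X in auto)
    have "inv (f (e \<otimes> y)) \<in> inverses (f ` (V - Q))" using e ey_notin_Q by blast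
    moreover have "inv (f (e \<otimes> y)) \<in> inverses (f ` Q)" using f_e eQ by auto
    ultimately show "inverses (f ` (V - Q)) \<inter> inverses (f ` Q) \<noteq> {}" by blast
  qed
  moreover have "inverses (f ` (V - Q)) \<union> inverses (f ` Q) = inverses (f ` V)"
    using Q_subset by blast
  ultimately show ?thesis by simp
qed

text \<open>For generation, every letter of \<open>X\<close> must still label an edge: left edges
  other than the cut one survive under \<open>f\<close>, and the label of the cut edge returns at
  the new vertex.\<close>

lemma translator_V': "translator G X Y' V'"
proof -
  have fx: "f (x \<otimes> w) \<in> f ` V" using xw by blast
  have sub: "inverses (f ` V) \<subseteq> carrier G" using f_closed by auto
  have "inv (w \<otimes> cQ) = inv (f (x \<otimes> w)) \<otimes> x" by (simp add: f_xw inv_mult_group m_assoc)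
  then have "conn G X (insert (inv (w \<otimes> cQ)) (inverses (f ` V)))"
    using conn_insert [OF X conn_f_image sub _ x, of "inv (f (x \<otimes> w))"] fx by auto
  then have left: "conn G X (inverses V')" by (simp add: V'_def)
  have one: "\<one> \<in> V'" using f_mem [OF oneV] by (simp add: f_one)
  have subV: "inverses V \<subseteq> carrier G" "inverses V' \<subseteq> carrier G" using Vc V'_subset by auto
  have oneI: "\<one> \<in> inverses V" "\<one> \<in> inverses V'"
    using oneV one by (auto intro: image_eqI [of \<one> _ \<one>])
  have "generate G (inverses V') = carrier G"
    unfolding generate_iff_labels [OF X subV(2) left oneI(2)]
  proof
    fix z assume z: "z \<in> letters G X"
    have zc: "z \<in> carrier G" using letter_closed [OF X z] .
    have "ends G (inverses V) z \<noteq> {}"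
      using generate_iff_labels [OF X subV(1) connX oneI(1)] gen generate_inverses [OF Vc] z by blast
    then obtain v u where v: "v \<in> V" "u \<in> V" "inv v \<otimes> z = inv u" by (auto simp: ends_def)
    then have "u = inv (inv v \<otimes> z)" using V_closed by (metis inv_inv)
    also have "\<dots> = inv z \<otimes> v" using V_closed [OF v(1)] zc by (simp add: inv_mult_group)
    finally have u: "u = inv z \<otimes> v" .
    have "\<exists>v'\<in>V'. inv z \<otimes> v' \<in> V'"
    proof (cases "v = w \<and> inv z = x")
      case True
      then show ?thesis using f_xw f_mem [OF xw] by (auto simp: V'_def intro!: bexI [of _ "w \<otimes> cQ"])
    next
      case nD: False
      show ?thesis
      proof (cases "v = x \<otimes> w \<and> inv z = inv x")
        case True
        then have "inv z \<otimes> f (x \<otimes> w) = w \<otimes> cQ" by (simp add: f_xw)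
        moreover have "w \<otimes> cQ \<in> V'" by (simp add: V'_def)
        ultimately show ?thesis using f_mem [OF xw] by metis
      next
        case False
        then have "f (inv z \<otimes> v) = inv z \<otimes> f v"
          using f_left [OF v(1) inv_letter [OF X z]] v u nD by auto
        then show ?thesis using f_mem [OF v(1)] f_mem [OF v(2)] u by (intro bexI [of _ "f v"]) auto
      qed
    qed
    then obtain v' where v': "v' \<in> V'" "inv z \<otimes> v' \<in> V'" by blast
    then have "inv v' \<otimes> z = inv (inv z \<otimes> v')" using V'_subset zc by (auto simp: inv_mult_group)
    then have "inv v' \<in> ends G (inverses V') z" using v' by (auto simp: ends_def)
    then show "ends G (inverses V') z \<noteq> {}" by blast
  qed
  then have "generate G V' = carrier G" using generate_inverses [OF V'_subset] by simp
  then show ?thesis using V'_subset one conn_V'_right left by (simp add: translator_def)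
qed

lemma finite_V': "finite V'"
  using fin by (simp add: V'_def)

lemma card_f_image: "card (f ` V) < card V"
proof -
  have "e \<noteq> e \<otimes> y" using eQ ey_notin_Q by auto
  moreover have "e \<in> V" "e \<otimes> y \<in> V" using e by (auto simp: far_def)
  ultimately have "\<not> inj_on f V" using f_e by (metis inj_onD)
  then have "card (f ` V) \<noteq> card V" using eq_card_imp_inj_on [OF fin] by blast
  then show ?thesis using card_image_le [OF fin, of f] by simp
qed

text \<open>A word in \<open>Y'\<close> is written along the path, with the shifts at successive
  vertices telescoping. A right edge contributes its new label or, if collapsed, nothing; a crossing
  of the cut edge contributes \<open>y\<close> or \<open>inv y\<close>. Of the collapsed edges only
  the one at \<open>e\<close> is credited, hence an inequality.\<close>

lemma path_transform:
  assumes "is_path G X Y V u p v"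
  shows "\<exists>zs. set zs \<subseteq> letters G Y' \<and> seq_prod G zs = inv (c u) \<otimes> seq_prod G (rights p) \<otimes> c v \<and>
    length zs + cross_right G e y u p \<le> length (rights p) + cross_left G w x u p"
  using assms
proof (induction p arbitrary: u)
  case Nil
  then show ?case by (intro exI [of _ "[]"]) auto
next
  case (Cons s p)
  have u: "u \<in> V" "target G s u \<in> V" using Cons.prems is_path_mem [of X Y V "target G s u" p v] by auto
  have uc: "u \<in> carrier G" using u V_closed by auto
  obtain zs where zs: "set zs \<subseteq> letters G Y'"
    "seq_prod G zs = inv (c (target G s u)) \<otimes> seq_prod G (rights p) \<otimes> c v"
    "length zs + cross_right G e y (target G s u) p \<le> length (rights p) + cross_left G w x (target G s u) p"
    using Cons by auto
  have rl: "set (rights p) \<subseteq> letters G Y" using is_path_letters [of X Y V "target G s u" p v] Cons.prems by auto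
  then have rc: "set (rights p) \<subseteq> carrier G" using Y_closed by auto
  then have Bc: "seq_prod G (rights p) \<in> carrier G" by simp
  have yl: "y \<in> letters G Y'" "inv y \<in> letters G Y'"
    using letters_Y' y \<phi>_y \<phi>_inv [OF y] inv_letter [OF Y y] by (metis imageI)+
  show ?case
  proof (cases s)
    case (Lft z)
    then have z: "z \<in> letters G X" using Cons.prems by simp
    let ?d = "inv (c u) \<otimes> c (z \<otimes> u)"
    have cu: "inv (c u) = ?d \<otimes> inv (c (z \<otimes> u))" by (simp add: m_assoc)
    have "seq_prod G (rights (s # p)) = seq_prod G (rights p)" using Lft by simp
    then have eq: "inv (c u) \<otimes> seq_prod G (rights (s # p)) \<otimes> c v = ?d \<otimes> seq_prod G zs"
      using zs(2) Lft Bc by (subst cu) (simp add: m_assoc)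
    have d: "?d = (if u = w \<and> z = x then y else if u = x \<otimes> w \<and> z = inv x then inv y else \<one>)"
      using cross_left_edge [OF u(1) z] u(2) Lft by simp
    show ?thesis
    proof (cases "u = w \<and> z = x \<or> u = x \<otimes> w \<and> z = inv x")
      case True
      then have "?d \<in> letters G Y'" using d yl by auto
      then show ?thesis using eq zs True Lft by (intro exI [of _ "?d # zs"]) auto
    next
      case False
      then have "?d = \<one>" using d by auto
      moreover have "seq_prod G zs \<in> carrier G"
        using zs(1) letter_closed [OF Y'_basis] by (intro seq_prod_closed) auto
      ultimately show ?thesis using eq zs False Lft by (intro exI [of _ zs]) auto
    qed
  next
    case (Rgt z)
    then have z: "z \<in> letters G Y" using Cons.prems by simp
    have zc: "z \<in> carrier G" using Y_closed [OF z] .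
    let ?d = "inv (c u) \<otimes> z \<otimes> c (u \<otimes> z)"
    have dz: "inv (c u) \<otimes> z = ?d \<otimes> inv (c (u \<otimes> z))" using zc by (simp add: m_assoc)
    have "inv (c u) \<otimes> seq_prod G (rights (s # p)) \<otimes> c v = inv (c u) \<otimes> z \<otimes> (seq_prod G (rights p) \<otimes> c v)"
      using Rgt zc Bc by (simp add: m_assoc)
    also have "\<dots> = ?d \<otimes> seq_prod G zs" using zs(2) Rgt Bc zc by (subst dz) (simp add: m_assoc)
    finally have eq: "inv (c u) \<otimes> seq_prod G (rights (s # p)) \<otimes> c v = ?d \<otimes> seq_prod G zs" .
    have d: "?d = (if z = y \<and> u \<in> Q \<or> z = inv y \<and> u \<otimes> z \<in> Q then \<one> else \<phi> z)"
      using right_edge [OF u(1) z] u(2) Rgt by simp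
    show ?thesis
    proof (cases "z = y \<and> u \<in> Q \<or> z = inv y \<and> u \<otimes> z \<in> Q")
      case True
      then have "?d = \<one>" using d by auto
      moreover have "seq_prod G zs \<in> carrier G"
        using zs(1) letter_closed [OF Y'_basis] by (intro seq_prod_closed) auto
      ultimately show ?thesis using eq zs Rgt by (intro exI [of _ zs]) auto
    next
      case False
      then have "?d = \<phi> z" using d by auto
      moreover have "\<phi> z \<in> letters G Y'" using letters_Y' z by simp
      moreover have "\<not> (u = e \<and> z = y \<or> u = e \<otimes> y \<and> z = inv y)"
        using False eQ by (auto simp: m_assoc)
      ultimately show ?thesis using eq zs Rgt by (intro exI [of _ "\<phi> z # zs"]) auto
    qed
  qed
qed

lemma word_length_transform:
  assumes r: "r \<in> words G" and p: "loop G X Y V r u p"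
  shows "word_length G Y' r + cross_right G e y u p \<le> length (rights p) + cross_left G w x u p"
proof -
  have path: "is_path G X Y V u p u" using p by (simp add: loop_def)
  obtain zs where zs: "set zs \<subseteq> letters G Y'" "seq_prod G zs = inv (c u) \<otimes> seq_prod G (rights p) \<otimes> c u"
    "length zs + cross_right G e y u p \<le> length (rights p) + cross_left G w x u p"
    using path_transform [OF path] by blast
  have "set (rights p) \<subseteq> carrier G" using is_path_letters [OF path] Y_closed by blast
  then have Bc: "seq_prod G (rights p) \<in> carrier G" by simp
  consider g where "r = Straight g" "g \<in> carrier G"
    | g where "r = Cyclic (conjugacy_class G g)" "g \<in> carrier G"
    using r by (auto simp: words_def)
  then have "word_length G Y' r \<le> length zs"
  proof cases
    case 1
    then have "seq_prod G zs = g" using zs(2) p Bc by (auto simp: loop_def c_one)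
    then show ?thesis using length_seq_prod_le [OF Y'_basis zs(1)] 1
      by (simp add: word_length_Straight del: word_length.simps)
  next
    case 2
    then have "seq_prod G (rights p) \<in> conjugacy_class G g" using p by (simp add: loop_def)
    then have "seq_prod G zs \<in> conjugacy_class G g"
      using conj_conjugacy_class [OF 2(2), of "seq_prod G (rights p)" "c u"] zs(2) by simp
    then show ?thesis using word_length_Cyclic_le [OF Y'_basis 2(2) zs(1)] 2 by simp
  qed
  then show ?thesis using zs(3) by simp
qed

end

section \<open>Degrees and minimal translators\<close>

definition deg :: "('a, 'b) monoid_scheme \<Rightarrow> 'a set \<Rightarrow> 'a set \<Rightarrow> 'a set \<Rightarrow> 'a \<Rightarrow> nat" where
  "deg F X Y V v = card {x \<in> letters F X. x \<otimes>\<^bsub>F\<^esub> v \<in> V} + card {y \<in> letters F Y. v \<otimes>\<^bsub>F\<^esub> y \<in> V}"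

definition branch :: "('a, 'b) monoid_scheme \<Rightarrow> 'a set \<Rightarrow> 'a set \<Rightarrow> 'a set \<Rightarrow> 'a set" where
  "branch F X Y V = {v \<in> V - {\<one>\<^bsub>F\<^esub>}. 3 \<le> deg F X Y V v}"

lemma rtrancl_crossing:
  assumes "(a, b) \<in> r\<^sup>*" "a \<in> A" "b \<notin> A"
  obtains c d where "c \<in> A" "d \<notin> A" "(c, d) \<in> r"
  using assms by (induction) blast+

context group
begin

lemma valence_ge_3_eq:
  assumes "F_basis G X" "finite X" "F_basis G Y" "finite Y" "V \<subseteq> carrier G"
  shows "valence_ge_3 G X Y V = branch G X Y V"
  using valence_two_sided_graph [OF assms] by (auto simp: valence_ge_3_def branch_def deg_def)

lemma inv_mem_inverses: "V \<subseteq> carrier G \<Longrightarrow> v \<in> carrier G \<Longrightarrow> inv v \<in> inverses V \<longleftrightarrow> v \<in> V"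
  by (metis (no_types, lifting) imageE imageI inv_inv subsetD)

lemma inj_on_inv: "A \<subseteq> carrier G \<Longrightarrow> inj_on (\<lambda>v. inv v) A"
  using inj_on_subset [OF inv_inj] .

lemma deg_swap:
  assumes X: "F_basis G X" and Y: "F_basis G Y" and V: "V \<subseteq> carrier G" and v: "v \<in> carrier G"
  shows "deg G Y X (inverses V) (inv v) = deg G X Y V v"
proof -
  note inj = inj_on_inv
  have Xc: "x \<in> letters G X \<Longrightarrow> x \<in> carrier G" and Yc: "y \<in> letters G Y \<Longrightarrow> y \<in> carrier G" for x y
    using letter_closed X Y by auto
  have "{x \<in> letters G X. inv v \<otimes> x \<in> inverses V} = (\<lambda>z. inv z) ` {x \<in> letters G X. x \<otimes> v \<in> V}"
  proof (intro equalityI subsetI)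
    fix x assume "x \<in> {x \<in> letters G X. inv v \<otimes> x \<in> inverses V}"
    then have x: "x \<in> letters G X" "inv v \<otimes> x \<in> inverses V" by auto
    have "inv v \<otimes> x = inv (inv x \<otimes> v)" using Xc [OF x(1)] v by (simp add: inv_mult_group)
    then have "inv x \<otimes> v \<in> V" using x inv_mem_inverses [OF V, of "inv x \<otimes> v"] Xc v by simp
    then show "x \<in> (\<lambda>z. inv z) ` {x \<in> letters G X. x \<otimes> v \<in> V}"
      using inv_letter [OF X x(1)] Xc [OF x(1)] by (auto intro!: image_eqI [of _ _ "inv x"])
  next
    fix x' assume "x' \<in> (\<lambda>z. inv z) ` {x \<in> letters G X. x \<otimes> v \<in> V}"
    then obtain x where x: "x \<in> letters G X" "x \<otimes> v \<in> V" "x' = inv x" by auto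
    have "inv v \<otimes> x' = inv (x \<otimes> v)" using x Xc v by (simp add: inv_mult_group)
    then show "x' \<in> {x \<in> letters G X. inv v \<otimes> x \<in> inverses V}"
      using x inv_letter [OF X x(1)] by auto
  qed
  then have 1: "card {x \<in> letters G X. inv v \<otimes> x \<in> inverses V} = card {x \<in> letters G X. x \<otimes> v \<in> V}"
    using Xc by (simp add: card_image inj subset_iff)
  have "{y \<in> letters G Y. y \<otimes> inv v \<in> inverses V} = (\<lambda>z. inv z) ` {y \<in> letters G Y. v \<otimes> y \<in> V}"
  proof (intro equalityI subsetI)
    fix y assume "y \<in> {y \<in> letters G Y. y \<otimes> inv v \<in> inverses V}"
    then have y: "y \<in> letters G Y" "y \<otimes> inv v \<in> inverses V" by auto
    have "y \<otimes> inv v = inv (v \<otimes> inv y)" using Yc [OF y(1)] v by (simp add: inv_mult_group)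
    then have "v \<otimes> inv y \<in> V" using y inv_mem_inverses [OF V, of "v \<otimes> inv y"] Yc v by simp
    then show "y \<in> (\<lambda>z. inv z) ` {y \<in> letters G Y. v \<otimes> y \<in> V}"
      using inv_letter [OF Y y(1)] Yc [OF y(1)] by (auto intro!: image_eqI [of _ _ "inv y"])
  next
    fix y' assume "y' \<in> (\<lambda>z. inv z) ` {y \<in> letters G Y. v \<otimes> y \<in> V}"
    then obtain y where y: "y \<in> letters G Y" "v \<otimes> y \<in> V" "y' = inv y" by auto
    have "y' \<otimes> inv v = inv (v \<otimes> y)" using y Yc v by (simp add: inv_mult_group)
    then show "y' \<in> {y \<in> letters G Y. y \<otimes> inv v \<in> inverses V}"
      using y inv_letter [OF Y y(1)] by auto
  qed
  then have 2: "card {y \<in> letters G Y. y \<otimes> inv v \<in> inverses V} = card {y \<in> letters G Y. v \<otimes> y \<in> V}"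
    using Yc by (simp add: card_image inj subset_iff)
  show ?thesis using 1 2 by (simp add: deg_def)
qed

lemma branch_swap:
  assumes X: "F_basis G X" and Y: "F_basis G Y" and V: "V \<subseteq> carrier G"
  shows "branch G Y X (inverses V) = inverses (branch G X Y V)"
proof -
  have "inv v \<in> branch G Y X (inverses V) \<longleftrightarrow> v \<in> branch G X Y V" if "v \<in> V" for v
  proof -
    have "inv v = \<one> \<longleftrightarrow> v = \<one>" using that V by (metis inv_inv inv_one subsetD)
    then show ?thesis using deg_swap [OF X Y V, of v] that V by (auto simp: branch_def)
  qed
  then show ?thesis by (auto simp: branch_def)
qed

lemma translator_left_labels:
  assumes X: "F_basis G X" and V: "translator G X Y V" and z: "z \<in> letters G X"
  obtains v where "v \<in> V" "z \<otimes> v \<in> V"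
proof -
  have Vc: "V \<subseteq> carrier G" using V by (auto simp: translator_def)
  have c: "inverses V \<subseteq> carrier G" "\<one> \<in> inverses V"
    "conn G X (inverses V)" "generate G (inverses V) = carrier G"
    using V by (auto simp: translator_def generate_inverses intro: image_eqI [of \<one> _ \<one>])
  have "ends G (inverses V) (inv z) \<noteq> {}"
    using generate_iff_labels [OF X c(1,3,2)] c(4) inv_letter [OF X z] by blast
  then obtain v where v: "v \<in> V" "inv v \<otimes> inv z \<in> inverses V" by (auto simp: ends_def)
  have "inv v \<otimes> inv z = inv (z \<otimes> v)" "z \<otimes> v \<in> carrier G"
    using v(1) Vc letter_closed [OF X z] by (auto simp: inv_mult_group)
  then have "z \<otimes> v \<in> V" using v(2) inv_mem_inverses [OF Vc] by metis
  then show ?thesis using that v(1) by blast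
qed

lemma translator_right_labels:
  assumes Y: "F_basis G Y" and V: "translator G X Y V" and z: "z \<in> letters G Y"
  obtains v where "v \<in> V" "v \<otimes> z \<in> V"
proof -
  have "ends G V z \<noteq> {}" using generate_iff_labels [OF Y, of V] V z by (auto simp: translator_def)
  then show ?thesis using that by (auto simp: ends_def)
qed

text \<open>Every letter labels an edge, and a tree has one edge fewer than vertices.\<close>

lemma card_translator_ge:
  assumes Y: "F_basis G Y" "finite Y" and V: "translator G X Y V" "finite V"
  shows "card Y \<le> card (V - {\<one>})"
proof -
  have Vc: "V \<subseteq> carrier G" "conn G Y V" "\<one> \<in> V" using V by (auto simp: translator_def)
  have "1 \<le> card (ends G V z)" if "z \<in> Y" for z
  proof -
    have "z \<in> letters G Y" using that by (simp add: letters_def)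
    then obtain v where "v \<in> V" "v \<otimes> z \<in> V" using translator_right_labels [OF Y(1) V(1)] by metis
    then have "ends G V z \<noteq> {}" by (auto simp: ends_def)
    moreover have "finite (ends G V z)" using V(2) by (simp add: ends_def)
    ultimately show ?thesis by (simp add: Suc_le_eq card_gt_0_iff)
  qed
  then have "(\<Sum>z\<in>Y. 1) \<le> (\<Sum>z\<in>Y. card (ends G V z))" by (intro sum_mono) auto
  then show ?thesis using sum_card_ends [OF Y Vc V(2)] by simp
qed

text \<open>In the count behind \<open>card_translator_ge\<close>, equality forces each letter to
  label exactly one edge.\<close>

lemma ends_unique:
  assumes Y: "F_basis G Y" "finite Y" and V: "translator G X Y V" "finite V" "card (V - {\<one>}) = card Y"
    and z: "z \<in> letters G Y" and v: "v \<in> V" "v \<otimes> z \<in> V" and u: "u \<in> V" "u \<otimes> z \<in> V"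
  shows "u = v"
proof -
  have Vc: "V \<subseteq> carrier G" "conn G Y V" "\<one> \<in> V" using V by (auto simp: translator_def)
  have fin: "finite (ends G V a)" for a using V(2) by (simp add: ends_def)
  have ge: "1 \<le> card (ends G V a)" if "a \<in> Y" for a
  proof -
    have "a \<in> letters G Y" using that by (simp add: letters_def)
    then obtain v where "v \<in> V" "v \<otimes> a \<in> V" using translator_right_labels [OF Y(1) V(1)] by metis
    then have "ends G V a \<noteq> {}" by (auto simp: ends_def)
    then show ?thesis using fin [of a] by (simp add: Suc_le_eq card_gt_0_iff)
  qed
  have *: "card (ends G V a) = 1" if a: "a \<in> Y" for a
  proof (rule ccontr)
    assume "card (ends G V a) \<noteq> 1"
    then have "1 < card (ends G V a)" using ge [OF a] by simp
    then have "(\<Sum>a\<in>Y. 1) < (\<Sum>a\<in>Y. card (ends G V a))"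
      using ge a Y(2) by (intro sum_strict_mono_ex1) auto
    then show False using sum_card_ends [OF Y Vc V(2)] V(3) by simp
  qed
  have uniq: "u = v" if "a \<in> Y" "u \<in> ends G V a" "v \<in> ends G V a" for a u v
    using * [OF that(1)] that(2,3) by (auto simp: card_1_singleton_iff)
  show ?thesis
  proof (cases "z \<in> Y")
    case True
    then show ?thesis using uniq [OF True, of u v] u v by (simp add: ends_def)
  next
    case False
    then obtain a where a: "a \<in> Y" "z = inv a" using z by (auto simp: letters_def set_inv_iff)
    have ac: "a \<in> carrier G" "u \<in> carrier G" "v \<in> carrier G" using a basis_subset [OF Y(1)] u v Vc by auto
    then have "u \<otimes> z \<in> ends G V a" "v \<otimes> z \<in> ends G V a" using u v a by (auto simp: ends_def m_assoc)
    then have "u \<otimes> z = v \<otimes> z" using uniq a(1) by blast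
    then show ?thesis using ac a by simp
  qed
qed

lemma ends_unique_left:
  assumes X: "F_basis G X" "finite X" and Y: "F_basis G Y" and V: "translator G X Y V" "finite V" "card (V - {\<one>}) = card X"
    and z: "z \<in> letters G X" and v: "v \<in> V" "z \<otimes> v \<in> V" and u: "u \<in> V" "z \<otimes> u \<in> V"
  shows "u = v"
proof -
  have Vc: "V \<subseteq> carrier G" using V by (auto simp: translator_def)
  have c: "z \<in> carrier G" "u \<in> carrier G" "v \<in> carrier G" using letter_closed [OF X(1) z] u v Vc by auto
  have "inj_on (\<lambda>v. inv v) (V - {\<one>})" using Vc by (intro inj_on_inv) auto
  moreover have "inverses V - {\<one>} = inverses (V - {\<one>})"
    using Vc by (auto simp: subset_iff)
  ultimately have card: "card (inverses V - {\<one>}) = card X" using V(3) by (simp add: card_image)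
  have *: "inv a \<otimes> inv z \<in> inverses V" if "a \<in> V" "z \<otimes> a \<in> V" for a
  proof -
    have "a \<in> carrier G" using that Vc by auto
    then have "inv a \<otimes> inv z = inv (z \<otimes> a)" using c(1) by (simp add: inv_mult_group)
    then show ?thesis using that by auto
  qed
  have "inv u = inv v"
    using * [OF u] * [OF v] u(1) v(1) V(2)
    by (intro ends_unique [OF X translator_swap [OF V(1)] _ card inv_letter [OF X(1) z]]) auto
  then show ?thesis using c by (metis inv_inv)
qed

lemma right_neighbour:
  assumes Y: "F_basis G Y" and V: "translator G X Y V" and v: "v \<in> V" and u: "u \<in> V" "u \<noteq> v"
  obtains y where "y \<in> letters G Y" "v \<otimes> y \<in> V"
  using conn_hd [OF Y _ _ v u(1)] u(2) V that by (auto simp: translator_def)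

lemma left_neighbour:
  assumes X: "F_basis G X" and V: "translator G X Y V" and v: "v \<in> V" and u: "u \<in> V" "u \<noteq> v"
  obtains x where "x \<in> letters G X" "x \<otimes> v \<in> V"
proof -
  have Vc: "V \<subseteq> carrier G" using V by (simp add: translator_def)
  have c: "u \<in> carrier G" "v \<in> carrier G" using u v Vc by auto
  have "inv u \<noteq> inv v" using u(2) c by (metis inv_inv)
  then obtain x where x: "x \<in> letters G X" "inv v \<otimes> x \<in> inverses V"
    using right_neighbour [OF X translator_swap [OF V], of "inv v" "inv u"] u v by blast
  have "inv v \<otimes> x = inv (inv x \<otimes> v)" "inv x \<otimes> v \<in> carrier G"
    using c letter_closed [OF X x(1)] by (simp_all add: inv_mult_group)
  then have "inv x \<otimes> v \<in> V" using x(2) inv_mem_inverses [OF Vc] by metis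
  then show ?thesis using that inv_letter [OF X x(1)] by blast
qed

text \<open>The third edge is a left one: the left tree on \<open>V\<close> is connected and has a
  vertex other than \<open>v\<close>.\<close>

lemma deg_ge_3:
  assumes X: "F_basis G X" "finite X" and Y: "F_basis G Y" "finite Y" and V: "translator G X Y V" and v: "v \<in> V"
    and "a \<in> letters G Y" "b \<in> letters G Y" "a \<noteq> b" "v \<otimes> a \<in> V" "v \<otimes> b \<in> V"
  shows "3 \<le> deg G X Y V v"
proof -
  have c: "v \<in> carrier G" "a \<in> carrier G" using v V letter_closed [OF Y(1) assms(7)] by (auto simp: translator_def)
  have "a \<noteq> \<one>" using one_not_letter [OF Y(1)] assms(7) by blast
  then have "v \<otimes> a \<noteq> v" using c by simp
  then obtain x where x: "x \<in> letters G X" "x \<otimes> v \<in> V"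
    using left_neighbour [OF X(1) V v assms(10)] by blast
  have "card {a, b} \<le> card {y \<in> letters G Y. v \<otimes> y \<in> V}"
    using assms finite_letters [OF Y(2)] by (intro card_mono) auto
  moreover have "card {x} \<le> card {x \<in> letters G X. x \<otimes> v \<in> V}"
    using x finite_letters [OF X(2)] by (intro card_mono) auto
  ultimately show ?thesis using \<open>a \<noteq> b\<close> by (simp add: deg_def)
qed

text \<open>A parent other than \<open>\<one>\<close> has two right edges, to its child and to its
  own parent. So, apart from \<open>\<one>\<close>, only leaves of the right tree can fail to
  branch.\<close>

lemma deg_parent:
  assumes X: "F_basis G X" "finite X" and Y: "F_basis G Y" "finite Y" and V: "translator G X Y V" and v: "v \<in> V"
    and ne: "v \<noteq> \<one>" "v \<otimes> inv (last (word G Y v)) \<noteq> \<one>"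
  shows "3 \<le> deg G X Y V (v \<otimes> inv (last (word G Y v)))"
proof -
  have Vc: "V \<subseteq> carrier G" "conn G Y V" "\<one> \<in> V" using V by (auto simp: translator_def)
  have vc: "v \<in> carrier G" using v Vc by auto
  let ?l = "last (word G Y v)"
  let ?p = "v \<otimes> inv ?l"
  have l: "?l \<in> letters G Y" "word G Y ?p = butlast (word G Y v)"
    using length_word_parent [OF Y(1) vc ne(1)] by auto
  then have lc: "?l \<in> carrier G" using letter_closed [OF Y(1)] by blast
  have p: "?p \<in> V" using conn_last [OF Y(1) Vc(1,2,3) v] ne vc by simp
  have pc: "?p \<in> carrier G" using vc lc by simp
  let ?m = "last (word G Y ?p)"
  have m: "?m \<in> letters G Y" using length_word_parent [OF Y(1) pc ne(2)] by blast
  have mp: "?p \<otimes> inv ?m \<in> V" using conn_last [OF Y(1) Vc(1,2,3) p] ne(2) pc by simp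
  have "word G Y v \<noteq> []" "word G Y ?p \<noteq> []" using word_Nil_iff [OF Y(1)] vc pc ne by auto
  then have "?l \<noteq> inv ?m"
    using word_reduced [OF Y(1) vc] reduced_seq_snoc_iff [of Y "butlast (word G Y v)" ?l] l(2) by simp
  then show ?thesis
    using deg_ge_3 [OF X Y V p l(1) inv_letter [OF Y(1) m]] mp v vc lc by (simp add: m_assoc)
qed

lemma conn_branch:
  assumes X: "F_basis G X" "finite X" and Y: "F_basis G Y" "finite Y" and V: "translator G X Y V"
  shows "conn G Y (insert \<one> (branch G X Y V))"
proof (rule conn_parentI [OF Y(1), of _ \<one>])
  have Vc: "V \<subseteq> carrier G" "conn G Y V" "\<one> \<in> V" using V by (auto simp: translator_def)
  show "insert \<one> (branch G X Y V) \<subseteq> carrier G" using Vc by (auto simp: branch_def)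
  fix v assume "v \<in> insert \<one> (branch G X Y V)" and ne: "v \<noteq> \<one>"
  then have v: "v \<in> V" by (auto simp: branch_def)
  then have vc: "v \<in> carrier G" using Vc by auto
  have "v \<otimes> inv (last (word G Y v)) \<in> V" using conn_last [OF Y(1) Vc(1,2,3) v] ne vc by simp
  then show "v \<otimes> inv (last (word G Y (inv \<one> \<otimes> v))) \<in> insert \<one> (branch G X Y V)"
    using deg_parent [OF X Y V v ne] vc by (auto simp: branch_def)
qed simp

text \<open>Without branching, every vertex other than \<open>\<one>\<close> is adjacent to
  \<open>\<one>\<close> in both trees and so is a letter of both bases. An edge labelled
  \<open>y\<close> between two such vertices would give its start a second right edge. So
  \<open>y\<close> is one of these vertices or the inverse of one.\<close>

lemma branch_empty_letters:
  assumes X: "F_basis G X" "finite X" and Y: "F_basis G Y" "finite Y" and V: "translator G X Y V"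
    and empty: "branch G X Y V = {}"
  shows "letters G Y \<subseteq> letters G X"
proof -
  have Vc: "V \<subseteq> carrier G" "conn G Y V" "\<one> \<in> V" using V by (auto simp: translator_def)
  have lY: "v \<in> letters G B" if A: "F_basis G A" "finite A" and B: "F_basis G B" "finite B"
    and W: "translator G A B W" and emp: "branch G A B W = {}" and v: "v \<in> W" "v \<noteq> \<one>" for A B W v
  proof -
    have Wc: "W \<subseteq> carrier G" "conn G B W" "\<one> \<in> W" using W by (auto simp: translator_def)
    have vc: "v \<in> carrier G" using v Wc by auto
    have l: "last (word G B v) \<in> letters G B" using length_word_parent [OF B(1) vc v(2)] by blast
    have p: "v \<otimes> inv (last (word G B v)) \<in> W" using conn_last [OF B(1) Wc(1,2,3) v(1)] v vc by simp
    have "v \<otimes> inv (last (word G B v)) = \<one>"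
      using deg_parent [OF A B W v] p emp by (auto simp: branch_def)
    then have "v = last (word G B v)" using vc letter_closed [OF B(1) l]
      by (metis inv_closed inv_equality inv_inv)
    then show ?thesis using l by simp
  qed
  have emp': "branch G Y X (inverses V) = {}"
    using branch_swap [OF X(1) Y(1) Vc(1)] empty by simp
  have lX: "v \<in> letters G X" if "v \<in> V" "v \<noteq> \<one>" for v
  proof -
    have vc: "v \<in> carrier G" using that Vc by auto
    then have "inv v \<noteq> \<one>" using that by (metis inv_inv inv_one)
    then have "inv v \<in> letters G X" using lY [OF Y X translator_swap [OF V] emp', of "inv v"] that by blast
    then show ?thesis using inv_letter_iff [OF X(1) vc] by simp
  qed
  show ?thesis
  proof
    fix y assume y: "y \<in> letters G Y"
    then have yc: "y \<in> carrier G" using letter_closed [OF Y(1)] by blast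
    obtain v where v: "v \<in> V" "v \<otimes> y \<in> V" using translator_right_labels [OF Y(1) V y] by blast
    then have vc: "v \<in> carrier G" using Vc by auto
    consider "v = \<one>" | "v \<noteq> \<one>" "v \<otimes> y = \<one>" | "v \<noteq> \<one>" "v \<otimes> y \<noteq> \<one>" by blast
    then show "y \<in> letters G X"
    proof cases
      case 1
      then show ?thesis using lX [of y] v yc one_not_letter [OF Y(1)] y by auto
    next
      case 2
      then have "y = inv v" using vc yc by (metis inv_equality inv_inv inv_closed)
      then show ?thesis using lX [OF v(1) 2(1)] inv_letter [OF X(1)] by blast
    next
      case 3
      have "inv v \<in> letters G Y" using lY [OF X Y V empty v(1) 3(1)] inv_letter [OF Y(1)] by blast
      moreover have "y \<noteq> inv v" using 3(2) vc by auto
      ultimately have "3 \<le> deg G X Y V v"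
        using deg_ge_3 [OF X Y V v(1) y, of "inv v"] v vc Vc(3) by simp
      then show ?thesis using empty v(1) 3(1) by (auto simp: branch_def)
    qed
  qed
qed

end

section \<open>Exchanges in translators\<close>

text \<open>The case of \<open>1 + rank\<close> elements, before and after the exchange. As every
  letter labels a single edge in either translator, the edges at \<open>f v\<close> can be traced
  back to \<open>V\<close> by their labels.\<close>

locale base_exchange = exchange +
  assumes uniq_left: "\<And>z u v. z \<in> letters G X \<Longrightarrow> u \<in> V \<Longrightarrow> z \<otimes> u \<in> V \<Longrightarrow> v \<in> V \<Longrightarrow> z \<otimes> v \<in> V \<Longrightarrow> u = v"
    and uniq_right: "\<And>z u v. z \<in> letters G Y \<Longrightarrow> u \<in> V \<Longrightarrow> u \<otimes> z \<in> V \<Longrightarrow> v \<in> V \<Longrightarrow> v \<otimes> z \<in> V \<Longrightarrow> u = v"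
    and uniq_left': "\<And>z u v. z \<in> letters G X \<Longrightarrow> u \<in> V' \<Longrightarrow> z \<otimes> u \<in> V' \<Longrightarrow> v \<in> V' \<Longrightarrow> z \<otimes> v \<in> V' \<Longrightarrow> u = v"
    and uniq_right': "\<And>z u v. z \<in> letters G Y' \<Longrightarrow> u \<in> V' \<Longrightarrow> u \<otimes> z \<in> V' \<Longrightarrow> v \<in> V' \<Longrightarrow> v \<otimes> z \<in> V' \<Longrightarrow> u = v"
    and new: "w \<otimes> cQ \<notin> f ` V"
    and fin_X: "finite X" and fin_Y: "finite Y"
begin

lemma e_mem: "e \<in> V" and e_ne: "e \<otimes> y \<noteq> e"
  using eQ Q_subset ey_notin_Q by auto

text \<open>Vertices of different sides are identified only along a collapsed edge, and the edge at
  \<open>e\<close> is the only one labelled \<open>y\<close>.\<close>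

lemma f_inj:
  assumes a: "a \<in> V" and b: "b \<in> V" and eq: "f a = f b" and ne: "a \<noteq> e" "a \<noteq> e \<otimes> y"
  shows "a = b"
proof -
  have *: "u = e \<and> v = e \<otimes> y"
    if "u \<in> V" "v \<in> V" "u \<in> Q" "v \<notin> Q" "f u = f v" for u v
  proof -
    have "u \<otimes> cQ = v \<otimes> cP" using that by (simp add: f_def c_def)
    then have "(u \<otimes> y) \<otimes> cP = v \<otimes> cP" using V_closed [OF that(1)] by (simp add: m_assoc cP_cQ)
    then have v: "u \<otimes> y = v" using V_closed [OF that(1)] V_closed [OF that(2)] by simp
    then have "u = e" using uniq_right [OF y, of u e] that e e_mem by simp
    then show ?thesis using v by simp
  qed
  show ?thesis
  proof (cases "a \<in> Q"; cases "b \<in> Q")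
    assume "a \<in> Q" "b \<in> Q"
    then show ?thesis using eq V_closed a b by (simp add: f_def c_def)
  next
    assume "a \<notin> Q" "b \<notin> Q"
    then show ?thesis using eq V_closed a b by (simp add: f_def c_def)
  next
    assume "a \<in> Q" "b \<notin> Q"
    then show ?thesis using * [OF a b] eq ne by simp
  next
    assume "a \<notin> Q" "b \<in> Q"
    then show ?thesis using * [OF b a] eq ne by simp
  qed
qed

lemma new_mem: "w \<otimes> cQ \<in> V'"
  by (simp add: V'_def)

text \<open>The only edge labelled \<open>z\<close> in \<open>V'\<close> is the image of the one in
  \<open>V\<close>, or its replacement at the new vertex. If it starts at \<open>f v\<close>, then
  the edge in \<open>V\<close> starts at \<open>v\<close>, as \<open>f v\<close> has no other
  preimage.\<close>

lemma left_of_f: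
  assumes v: "v \<in> V" "v \<noteq> e" "v \<noteq> e \<otimes> y" and z: "z \<in> letters G X" and zfv: "z \<otimes> f v \<in> V'"
  shows "z \<otimes> v \<in> V \<and> \<not> (v = w \<and> z = x)"
proof -
  obtain v0 where v0: "v0 \<in> V" "z \<otimes> v0 \<in> V" using translator_left_labels [OF X translator z] by blast
  have zc: "z \<in> carrier G" using letter_closed [OF X z] .
  show ?thesis
  proof (cases "v0 = w \<and> z = x")
    case True
    then have "z \<otimes> (w \<otimes> cQ) \<in> V'" using f_xw f_mem [OF xw] by simp
    then have "f v = w \<otimes> cQ" using uniq_left' [OF z f_mem [OF v(1)] zfv new_mem] by simp
    then show ?thesis using new v(1) by (metis imageI)
  next
    case nD: False
    have "f v = f v0"
    proof (cases "v0 = x \<otimes> w \<and> z = inv x")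
      case True
      then have "z \<otimes> f v0 = w \<otimes> cQ" by (simp add: f_xw)
      then show ?thesis using uniq_left' [OF z f_mem [OF v(1)] zfv f_mem [OF v0(1)]] new_mem by simp
    next
      case False
      then have "z \<otimes> f v0 \<in> V'" using f_left [OF v0(1) z v0(2) nD False] f_mem [OF v0(2)] by simp
      then show ?thesis using uniq_left' [OF z f_mem [OF v(1)] zfv f_mem [OF v0(1)]] by simp
    qed
    then have "v = v0" using f_inj [OF v(1) v0(1)] v by simp
    then show ?thesis using v0 nD by simp
  qed
qed

lemma right_of_f:
  assumes v: "v \<in> V" "v \<noteq> e" "v \<noteq> e \<otimes> y" and z: "z \<in> letters G Y" and fvz: "f v \<otimes> \<phi> z \<in> V'"
  shows "v \<otimes> z \<in> V \<or> v = w \<and> z = y"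
proof -
  have z': "\<phi> z \<in> letters G Y'" using z letters_Y' by simp
  obtain v0 where v0: "v0 \<in> V" "v0 \<otimes> z \<in> V" using translator_right_labels [OF Y translator z] by blast
  consider "z = y" "v0 \<in> Q" | "z = inv y" "v0 \<otimes> z \<in> Q"
    | "\<not> (z = y \<and> v0 \<in> Q \<or> z = inv y \<and> v0 \<otimes> z \<in> Q)" by blast
  then show ?thesis
  proof cases
    case 1
    then have "f w \<otimes> \<phi> z \<in> V'" using f_w new_mem \<phi>_y by simp
    then have "f v = f w" using uniq_right' [OF z' f_mem [OF v(1)] fvz f_mem [OF w]] by simp
    then show ?thesis using f_inj [OF v(1) w] v 1 by simp
  next
    case 2
    have "(w \<otimes> cQ) \<otimes> \<phi> z = f w"
      using 2 \<phi>_inv [OF y] \<phi>_y f_w [symmetric] f_closed [OF w] by (simp add: m_assoc)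
    then have "f v = w \<otimes> cQ"
      using uniq_right' [OF z' f_mem [OF v(1)] fvz new_mem] f_mem [OF w] by simp
    then show ?thesis using new v(1) by (metis imageI)
  next
    case 3
    then have "f v0 \<otimes> \<phi> z \<in> V'" using f_right [OF v0(1) z v0(2)] f_mem [OF v0(2)] by metis
    then have "f v = f v0" using uniq_right' [OF z' f_mem [OF v(1)] fvz f_mem [OF v0(1)]] by simp
    then have "v = v0" using f_inj [OF v(1) v0(1)] v by simp
    then show ?thesis using v0 by simp
  qed
qed

text \<open>Only \<open>w\<close> can gain an edge, the one labelled \<open>y\<close> to the new
  vertex, and in return it loses the cut edge labelled \<open>x\<close>.\<close>

lemma deg_f:
  assumes v: "v \<in> V" "v \<noteq> e" "v \<noteq> e \<otimes> y"
  shows "deg G X Y' V' (f v) \<le> deg G X Y V v"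
proof -
  let ?A = "{z \<in> letters G X. z \<otimes> v \<in> V}" and ?A' = "{z \<in> letters G X. z \<otimes> f v \<in> V'}"
  let ?B = "{z \<in> letters G Y. v \<otimes> z \<in> V}" and ?B' = "{z \<in> letters G Y'. f v \<otimes> z \<in> V'}"
  have finA: "finite ?A" "finite ?B" using finite_letters fin_X fin_Y by auto
  have A: "?A' \<subseteq> ?A - (if v = w then {x} else {})" using left_of_f [OF v] by auto
  have B: "?B' \<subseteq> \<phi> ` ?B \<union> (if v = w then {\<phi> y} else {})"
  proof
    fix z' assume "z' \<in> ?B'"
    then obtain z where z: "z \<in> letters G Y" "z' = \<phi> z" "f v \<otimes> \<phi> z \<in> V'" using letters_Y' by auto
    then show "z' \<in> \<phi> ` ?B \<union> (if v = w then {\<phi> y} else {})" using right_of_f [OF v z(1,3)] by auto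
  qed
  have cB: "card (\<phi> ` ?B) \<le> card ?B" using card_image_le [OF finA(2)] .
  show ?thesis
  proof (cases "v = w")
    case True
    have "x \<in> ?A" using x xw True by simp
    then have "card (?A - {x}) + 1 = card ?A" using card_Suc_Diff1 [OF finA(1)] by simp
    moreover have "card ?A' \<le> card (?A - {x})" using A True finA by (intro card_mono) auto
    moreover have "card ?B' \<le> card (\<phi> ` ?B \<union> {\<phi> y})" using B True finA by (intro card_mono) auto
    moreover have "card (\<phi> ` ?B \<union> {\<phi> y}) \<le> card (\<phi> ` ?B) + 1"
      using card_Un_le [of "\<phi> ` ?B" "{\<phi> y}"] by simp
    ultimately show ?thesis using cB by (simp add: deg_def)
  next
    case False
    have "card ?A' \<le> card ?A" using A False finA by (intro card_mono) auto
    moreover have "card ?B' \<le> card (\<phi> ` ?B)" using B False finA by (intro card_mono) auto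
    ultimately show ?thesis using cB by (simp add: deg_def)
  qed
qed

lemma deg_new: "deg G X Y' V' (w \<otimes> cQ) \<le> 2"
proof -
  let ?u = "w \<otimes> cQ"
  have nf: "?u \<noteq> f v" if "v \<in> V" for v using new that by auto
  have "{z \<in> letters G X. z \<otimes> ?u \<in> V'} \<subseteq> {x}"
  proof clarify
    fix z assume z: "z \<in> letters G X" and zu: "z \<otimes> ?u \<in> V'"
    obtain v0 where v0: "v0 \<in> V" "z \<otimes> v0 \<in> V" using translator_left_labels [OF X translator z] by blast
    have "\<not> z \<otimes> f v0 \<in> V'" using uniq_left' [OF z new_mem zu f_mem [OF v0(1)]] nf v0 by auto
    moreover have "z \<otimes> f v0 = w \<otimes> cQ" if "v0 = x \<otimes> w \<and> z = inv x" using that by (simp add: f_xw)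
    ultimately show "z = x" using f_left [OF v0(1) z v0(2)] f_mem [OF v0(2)] new_mem by metis
  qed
  then have "card {z \<in> letters G X. z \<otimes> ?u \<in> V'} \<le> card {x}" by (intro card_mono) auto
  moreover have "{z \<in> letters G Y'. ?u \<otimes> z \<in> V'} \<subseteq> {inv y}"
  proof
    fix z' assume "z' \<in> {z \<in> letters G Y'. ?u \<otimes> z \<in> V'}"
    then obtain z where z: "z \<in> letters G Y" "z' = \<phi> z" "?u \<otimes> \<phi> z \<in> V'" using letters_Y' by auto
    have z': "\<phi> z \<in> letters G Y'" using z letters_Y' by simp
    obtain v0 where v0: "v0 \<in> V" "v0 \<otimes> z \<in> V" using translator_right_labels [OF Y translator z(1)] by blast
    have no: "f v \<otimes> \<phi> z \<notin> V'" if "v \<in> V" for v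
      using uniq_right' [OF z' new_mem z(3) f_mem [OF that]] nf that by auto
    consider "z = y" "v0 \<in> Q" | "z = inv y" "v0 \<otimes> z \<in> Q"
      | "\<not> (z = y \<and> v0 \<in> Q \<or> z = inv y \<and> v0 \<otimes> z \<in> Q)" by blast
    then show "z' \<in> {inv y}"
    proof cases
      case 1
      then show ?thesis using no [OF w] f_w new_mem \<phi>_y by simp
    next
      case 2
      then show ?thesis using z(2) \<phi>_inv [OF y] \<phi>_y by simp
    next
      case 3
      then show ?thesis using f_right [OF v0(1) z(1) v0(2)] f_mem [OF v0(2)] no [OF v0(1)] by metis
    qed
  qed
  then have "card {z \<in> letters G Y'. ?u \<otimes> z \<in> V'} \<le> card {inv y}" by (intro card_mono) auto
  ultimately show ?thesis by (simp add: deg_def)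
qed

text \<open>Merging \<open>e\<close> and \<open>e \<otimes> y\<close> turns two branch vertices into
  at most one, or makes a single one disappear into \<open>\<one>\<close>. By \<open>deg_f\<close>
  and \<open>deg_new\<close> no branch vertex arises elsewhere.\<close>

lemma branch_decreases:
  assumes "e \<in> insert \<one> (branch G X Y V)" "e \<otimes> y \<in> insert \<one> (branch G X Y V)"
  shows "card (branch G X Y' V') < card (branch G X Y V)"
proof -
  let ?K = "branch G X Y V" and ?K' = "branch G X Y' V'"
  have finK: "finite ?K" using fin by (simp add: branch_def)
  have sub: "?K' \<subseteq> f ` (?K - {e, e \<otimes> y}) \<union> (if e \<noteq> \<one> \<and> e \<otimes> y \<noteq> \<one> then {f e} else {})"
  proof
    fix v' assume v': "v' \<in> ?K'"
    then have "v' \<noteq> w \<otimes> cQ" using deg_new by (auto simp: branch_def)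
    then obtain v where v: "v \<in> V" "v' = f v" using v' by (auto simp: branch_def V'_def)
    have v1: "v \<noteq> \<one>" using v v' f_one by (auto simp: branch_def)
    show "v' \<in> f ` (?K - {e, e \<otimes> y}) \<union> (if e \<noteq> \<one> \<and> e \<otimes> y \<noteq> \<one> then {f e} else {})"
    proof (cases "v = e \<or> v = e \<otimes> y")
      case True
      then have "v' = f e" using v f_e by auto
      moreover from this have "e \<noteq> \<one>" "e \<otimes> y \<noteq> \<one>" using v' f_one f_e by (auto simp: branch_def)
      ultimately show ?thesis by simp
    next
      case False
      then have "v \<in> ?K" using deg_f [of v] v v' v1 by (auto simp: branch_def)
      then show ?thesis using False v by auto
    qed
  qed
  show ?thesis
  proof (cases "e \<noteq> \<one> \<and> e \<otimes> y \<noteq> \<one>")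
    case True
    then have K: "{e, e \<otimes> y} \<subseteq> ?K" using assms by auto
    have "card ?K' \<le> card (f ` (?K - {e, e \<otimes> y}) \<union> {f e})"
      using sub True finK by (intro card_mono) auto
    also have "\<dots> \<le> card (f ` (?K - {e, e \<otimes> y})) + 1"
      using card_Un_le [of "f ` (?K - {e, e \<otimes> y})" "{f e}"] by simp
    also have "\<dots> \<le> card (?K - {e, e \<otimes> y}) + 1"
      using card_image_le [of "?K - {e, e \<otimes> y}" f] finK by simp
    also have "card (?K - {e, e \<otimes> y}) = card ?K - 2"
      using K finK e_ne by (subst card_Diff_subset) auto
    finally show ?thesis using card_mono [OF finK K] e_ne by simp
  next
    case False
    have "e \<in> ?K \<or> e \<otimes> y \<in> ?K" using assms e_ne by fastforce
    then have "?K - {e, e \<otimes> y} \<subset> ?K" by blast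
    then have "card (?K - {e, e \<otimes> y}) < card ?K" using finK by (rule psubset_card_mono [rotated])
    moreover have "card ?K' \<le> card (f ` (?K - {e, e \<otimes> y}))"
      using sub False finK by (intro card_mono) auto
    moreover have "card (f ` (?K - {e, e \<otimes> y})) \<le> card (?K - {e, e \<otimes> y})"
      using finK by (intro card_image_le) simp
    ultimately show ?thesis by simp
  qed
qed

end

text \<open>What peak reduction uses of an exchange: the weight of the collapsed edge is traded for
  that of the cut edge. The bound concerns arbitrary loops, so that tight ones can be inserted
  later.\<close>

definition shifts :: "('a, 'b) monoid_scheme \<Rightarrow> 'a set \<Rightarrow> 'a set \<Rightarrow> 'a set \<Rightarrow> 'a \<Rightarrow> 'a \<Rightarrow> 'a \<Rightarrow> 'a \<Rightarrow> 'a set \<Rightarrow> bool" where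
  "shifts F X Y V w x e y Y' \<longleftrightarrow> whitehead_transform F Y Y' \<and>
    (\<forall>r\<in>words F. \<forall>u p. loop F X Y V r u p \<longrightarrow>
      word_length F Y' r + cross_right F e y u p \<le> length (rights p) + cross_left F w x u p)"

lemma (in exchange) shifts: "shifts G X Y V w x e y Y'"
  using whitehead word_length_transform by (simp add: shifts_def)

text \<open>The initial vertices of the left edges labelled \<open>x\<close> are the intersection of
  \<open>V\<close> with a translate, a subtree of the right tree, and \<open>w\<close> is to have
  exactly one neighbour in it. Read the other way, there is only one letter of \<open>Y\<close>
  whose edges start at both ends of the given left edge.\<close>

definition leaf :: "('a, 'b) monoid_scheme \<Rightarrow> 'a set \<Rightarrow> 'a set \<Rightarrow> 'a set \<Rightarrow> 'a \<Rightarrow> 'a \<Rightarrow> bool" where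
  "leaf F X Y V w x \<longleftrightarrow> x \<in> letters F X \<and> w \<in> V \<and> x \<otimes>\<^bsub>F\<^esub> w \<in> V \<and>
    (\<exists>!y. y \<in> letters F Y \<and> w \<otimes>\<^bsub>F\<^esub> y \<in> V \<and> x \<otimes>\<^bsub>F\<^esub> w \<otimes>\<^bsub>F\<^esub> y \<in> V)"

definition branch_edge :: "('a, 'b) monoid_scheme \<Rightarrow> 'a set \<Rightarrow> 'a set \<Rightarrow> 'a set \<Rightarrow> 'a \<Rightarrow> 'a \<Rightarrow> bool" where
  "branch_edge F X Y V w x \<longleftrightarrow> x \<in> letters F X \<and> w \<in> insert \<one>\<^bsub>F\<^esub> (branch F X Y V) \<and>
    x \<otimes>\<^bsub>F\<^esub> w \<in> insert \<one>\<^bsub>F\<^esub> (branch F X Y V)"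

context group
begin

text \<open>A right path from \<open>x \<otimes> w\<close> to \<open>w\<close> through branch
  vertices and \<open>\<one>\<close> has to leave the far side; the edge where it does so is
  collapsed. As each letter labels a single edge, the separation hypotheses of
  \<open>exchange\<close> hold.\<close>

lemma branch_exchange:
  assumes X: "F_basis G X" "finite X" and Y: "F_basis G Y" "finite Y" and rank: "card Y = card X"
    and V: "translator G X Y V" "finite V" "card (V - {\<one>}) = card X"
    and wx: "branch_edge G X Y V w x"
  obtains e y Y' V' where "e \<in> carrier G" "y \<in> carrier G" "branch_edge G Y X (inverses V) (inv e) (inv y)"
    "shifts G X Y V w x e y Y'" "translator G X Y' V'" "finite V'" "card (V' - {\<one>}) = card X"
    "card (branch G X Y' V') < card (branch G X Y V)"
proof -
  let ?K = "insert \<one> (branch G X Y V)" and ?Q = "far G X V w x"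
  have Vc: "V \<subseteq> carrier G" "\<one> \<in> V" using V by (auto simp: translator_def)
  have KV: "?K \<subseteq> V" using Vc by (auto simp: branch_def)
  have x: "x \<in> letters G X" and wK: "w \<in> ?K" and xwK: "x \<otimes> w \<in> ?K" using wx by (auto simp: branch_edge_def)
  have wV: "w \<in> V" "x \<otimes> w \<in> V" using wK xwK KV by auto
  have c: "w \<in> carrier G" "x \<in> carrier G" using wV Vc letter_closed [OF X(1) x] by auto
  have "x \<noteq> \<one>" using one_not_letter [OF X(1)] x by blast
  then have xwQ: "x \<otimes> w \<in> ?Q" using wV x X c by (simp add: far_def m_assoc)
  have wQ: "w \<notin> ?Q" by (simp add: far_def)
  have "(x \<otimes> w, w) \<in> (adj G Y ?K)\<^sup>*"
    using conn_branch [OF X Y V(1)] wK xwK unfolding conn_def by blast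
  then obtain e d where ed: "e \<in> ?Q" "d \<notin> ?Q" "(e, d) \<in> adj G Y ?K"
    using rtrancl_crossing [of _ _ _ ?Q] xwQ wQ by metis
  then obtain y where y: "y \<in> letters G Y" "d = e \<otimes> y" "e \<in> ?K" "e \<otimes> y \<in> ?K" by (auto simp: adj_def)
  have yc: "y \<in> carrier G" "e \<in> carrier G" using letter_closed [OF Y(1) y(1)] y(3) KV Vc by auto
  note uR = ends_unique [OF Y V(1,2) V(3) [folded rank]]
  note uL = ends_unique_left [OF X Y(1) V]
  have single: "ends G V z \<subseteq> ?Q \<or> ends G V z \<inter> ?Q = {}" if "z \<in> letters G Y" for z
  proof (rule ccontr)
    assume "\<not> ?thesis"
    then obtain u u' where "u \<in> ends G V z" "u \<in> ?Q" "u' \<in> ends G V z" "u' \<notin> ?Q" by blast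
    moreover from this have "u = u'" using uR [OF that, of u' u] by (simp add: ends_def)
    ultimately show False by simp
  qed
  have "ends G V (inv y) \<inter> ?Q = {}"
  proof -
    have "e \<otimes> y \<in> ends G V (inv y)" using y yc KV by (auto simp: ends_def m_assoc)
    then show ?thesis using single [OF inv_letter [OF Y(1) y(1)]] ed y by auto
  qed
  then interpret E: exchange G X Y V w x y e
    using X Y V x wV y ed single KV by unfold_locales auto
  \<comment> \<open>The map \<open>f\<close> loses a vertex and at most one is added. The lower
    bound by the rank forces equality, so the added vertex is not in the image of
    \<open>f\<close>.\<close>
  have le: "card E.V' \<le> card V"
    using E.card_f_image card_insert_le_m1 card_insert_if [of "E.f ` V" "w \<otimes> E.cQ"] V(2)
    by (auto simp: E.V'_def)
  have one: "\<one> \<in> E.V'" using E.translator_V' by (simp add: translator_def)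
  have fY': "finite E.Y'" using Y(2) by (simp add: E.Y'_def)
  have rank': "card E.Y' = card X"
    using card_homs_order_two [OF E.Y'_basis fY'] card_homs_order_two [OF X] by simp
  have card': "card (E.V' - {\<one>}) = card X"
  proof -
    have "card X \<le> card (E.V' - {\<one>})"
      using card_translator_ge [OF E.Y'_basis fY' E.translator_V' E.finite_V'] rank' by simp
    moreover have "card (E.V' - {\<one>}) = card E.V' - 1" "card (V - {\<one>}) = card V - 1"
      using one Vc by simp_all
    ultimately show ?thesis using le V(3) by simp
  qed
  have new: "w \<otimes> E.cQ \<notin> E.f ` V"
  proof
    assume "w \<otimes> E.cQ \<in> E.f ` V"
    then have "card E.V' < card V" using E.card_f_image by (simp add: E.V'_def insert_absorb)
    moreover have "card (E.V' - {\<one>}) = card E.V' - 1" "card (V - {\<one>}) = card V - 1" "card E.V' > 0"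
      using one Vc E.finite_V' by (auto simp: card_gt_0_iff)
    ultimately show False using card' V(3) by simp
  qed
  interpret B: base_exchange G X Y V w x y e
  proof unfold_locales
    show "finite X" "finite Y" by fact+
    show "w \<otimes> E.cQ \<notin> E.f ` V" by (fact new)
    fix z u v
    show "u = v" if "z \<in> letters G X" "u \<in> V" "z \<otimes> u \<in> V" "v \<in> V" "z \<otimes> v \<in> V" using uL that by blast
    show "u = v" if "z \<in> letters G Y" "u \<in> V" "u \<otimes> z \<in> V" "v \<in> V" "v \<otimes> z \<in> V" using uR that by blast
    show "u = v" if "z \<in> letters G X" "u \<in> E.V'" "z \<otimes> u \<in> E.V'" "v \<in> E.V'" "z \<otimes> v \<in> E.V'"
      using ends_unique_left [OF X E.Y'_basis E.translator_V' E.finite_V' card'] that by blast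
    show "u = v" if "z \<in> letters G E.Y'" "u \<in> E.V'" "u \<otimes> z \<in> E.V'" "v \<in> E.V'" "v \<otimes> z \<in> E.V'"
      using ends_unique [OF E.Y'_basis fY' E.translator_V' E.finite_V' card' [folded rank']] that by blast
  qed
  have "insert \<one> (branch G Y X (inverses V)) = inverses ?K"
    using branch_swap [OF X(1) Y(1) Vc(1)] by simp
  then have "branch_edge G Y X (inverses V) (inv e) (inv y)"
    unfolding branch_edge_def
    using y(1,3,4) yc inv_letter [OF Y(1) y(1)] by (simp only: inv_mult_group [symmetric]) blast
  then show ?thesis
    using that E.shifts E.translator_V' E.finite_V' card' B.branch_decreases y yc by blast
qed

text \<open>Take a vertex of \<open>S\<close> farthest from \<open>r\<close>: by
  \<open>away\<close>, a neighbour other than its parent would lie in \<open>S\<close> and be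
  farther still.\<close>

lemma tree_leaf:
  assumes Z: "F_basis G Z" and W: "W \<subseteq> carrier G" "conn G Z W" "finite W" and r: "r \<in> W"
    and S: "S \<subseteq> W" "S \<noteq> {}" "r \<notin> S"
    and away: "\<And>v z. v \<in> S \<Longrightarrow> z \<in> letters G Z \<Longrightarrow> v \<otimes> z \<in> W \<Longrightarrow>
      z \<noteq> inv (last (word G Z (inv r \<otimes> v))) \<Longrightarrow> v \<otimes> z \<in> S"
  obtains v where "v \<in> S" "\<exists>!z. z \<in> letters G Z \<and> v \<otimes> z \<in> W"
proof -
  let ?len = "\<lambda>v. length (word G Z (inv r \<otimes> v))"
  have "finite S" using S(1) W(3) finite_subset by blast
  then obtain v where v: "v \<in> S" and max: "\<And>u. u \<in> S \<Longrightarrow> ?len u \<le> ?len v"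
    using S(2) obtains_MAX [of S ?len] by (metis Max_ge finite_imageI imageI)
  have vW: "v \<in> W" "v \<noteq> r" using v S by auto
  have c: "v \<in> carrier G" "r \<in> carrier G" using vW r W by auto
  have g: "inv r \<otimes> v \<in> carrier G" "inv r \<otimes> v \<noteq> \<one>"
    using c vW by (simp, metis inv_closed inv_equality inv_inv)
  let ?l = "last (word G Z (inv r \<otimes> v))"
  have l: "?l \<in> letters G Z" using length_word_parent(2) [OF Z g] .
  have "\<exists>!z. z \<in> letters G Z \<and> v \<otimes> z \<in> W"
  proof (rule ex1I [of _ "inv ?l"])
    show "inv ?l \<in> letters G Z \<and> v \<otimes> inv ?l \<in> W"
      using inv_letter [OF Z l] conn_last [OF Z W(1,2) r vW(1)] vW(2) by auto
    fix z assume z: "z \<in> letters G Z \<and> v \<otimes> z \<in> W"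
    show "z = inv ?l"
    proof (rule ccontr)
      assume ne: "z \<noteq> inv ?l"
      have zc: "z \<in> carrier G" "?l \<in> carrier G" using z l letter_closed [OF Z] by auto
      have "v \<otimes> z \<in> S" using away [OF v] z ne by blast
      then have "?len (v \<otimes> z) \<le> ?len v" by (rule max)
      moreover have "?l \<noteq> inv z" using ne zc by auto
      then have "word G Z (inv r \<otimes> v \<otimes> z) = word G Z (inv r \<otimes> v) @ [z]"
        using word_mult_letter [OF Z g(1)] z by simp
      ultimately show False using c zc by (simp add: m_assoc)
    qed
  qed
  then show ?thesis using that v by blast
qed

text \<open>This set is the intersection of \<open>V\<close> with its left translate by
  \<open>inv x\<close>, that is, of two subtrees of the right tree.\<close>

lemma conn_left_ends:
  assumes Y: "F_basis G Y" and V: "V \<subseteq> carrier G" "conn G Y V" and x: "x \<in> carrier G"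
  shows "conn G Y {v \<in> V. x \<otimes> v \<in> V}"
proof -
  have "{v \<in> V. x \<otimes> v \<in> V} = V \<inter> (\<lambda>v. inv x \<otimes> v) ` V"
  proof (intro equalityI subsetI)
    fix v assume "v \<in> {v \<in> V. x \<otimes> v \<in> V}"
    then show "v \<in> V \<inter> (\<lambda>v. inv x \<otimes> v) ` V"
      using V x by (auto intro!: image_eqI [of _ _ "x \<otimes> v"])
  qed (use V x in auto)
  moreover have "conn G Y (V \<inter> (\<lambda>v. inv x \<otimes> v) ` V)"
    using V x Y by (intro conn_Int conn_left_translate) auto
  ultimately show ?thesis by simp
qed

text \<open>Through inversion, \<open>conn_left_ends\<close> now says that the initial vertices of
  the edges of a letter of \<open>Y\<close> span a subtree of the left tree.\<close>

lemma inv_ends: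
  assumes V: "V \<subseteq> carrier G" and y: "y \<in> carrier G"
  shows "inverses (ends G V y) = {g \<in> inverses V. inv y \<otimes> g \<in> inverses V}"
proof -
  have "inv y \<otimes> inv v \<in> inverses V \<longleftrightarrow> v \<otimes> y \<in> V" if "v \<in> V" for v
  proof -
    have vc: "v \<in> carrier G" using that V by auto
    then have "inv y \<otimes> inv v = inv (v \<otimes> y)" using y by (simp add: inv_mult_group)
    then show ?thesis using inv_mem_inverses [OF V, of "v \<otimes> y"] vc y by simp
  qed
  then show ?thesis by (auto simp: ends_def)
qed

text \<open>Otherwise a reduced word would end in \<open>inv x\<close> followed by
  \<open>x\<close>.\<close>

lemma far_disjoint:
  assumes X: "F_basis G X" and V: "V \<subseteq> carrier G" and w: "w \<in> V" and x: "x \<in> letters G X"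
    and v: "v \<in> far G X V w x"
  shows "v \<notin> far G X V (x \<otimes> w) (inv x)"
proof
  assume v': "v \<in> far G X V (x \<otimes> w) (inv x)"
  have c: "v \<in> carrier G" "w \<in> carrier G" "x \<in> carrier G"
    using v w V letter_closed [OF X x] by (auto simp: far_def)
  let ?g = "v \<otimes> inv w"
  have g: "?g \<in> carrier G" using c by simp
  have "?g \<noteq> \<one>" using v c by (auto simp: far_def) (metis inv_closed inv_equality inv_inv)
  then have ne: "word G X ?g \<noteq> []" using word_Nil_iff [OF X g] by simp
  have last: "last (word G X ?g) = x" using v by (simp add: far_def)
  have eq: "v \<otimes> inv (x \<otimes> w) = ?g \<otimes> inv x" using c by (simp add: inv_mult_group m_assoc)
  have b: "word G X (?g \<otimes> inv x) = butlast (word G X ?g)"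
    using word_mult_letter [OF X g inv_letter [OF X x]] ne last c by simp
  have "?g \<otimes> inv x \<noteq> \<one>"
  proof
    assume "?g \<otimes> inv x = \<one>"
    then have "v \<otimes> inv (x \<otimes> w) = \<one>" using eq by simp
    then have "v = x \<otimes> w" using c by (metis inv_closed inv_equality inv_inv m_closed)
    then show False using v' by (simp add: far_def)
  qed
  then have "butlast (word G X ?g) \<noteq> []" using b word_Nil_iff [OF X] g c by (metis inv_closed m_closed)
  then have "x \<noteq> inv (last (butlast (word G X ?g)))"
    using word_reduced [OF X g] reduced_seq_snoc_iff [of X "butlast (word G X ?g)" x] ne last
    by (metis append_butlast_last_id)
  moreover have "last (butlast (word G X ?g)) = inv x" using v' b eq by (simp add: far_def)
  ultimately show False using c by simp
qed

text \<open>A path in \<open>U\<close> between the two sides has to use the edge between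
  \<open>w\<close> and \<open>x \<otimes> w\<close>, by \<open>far_crossing_back\<close>.\<close>

lemma crossing_edge:
  assumes X: "F_basis G X" and V: "V \<subseteq> carrier G" and w: "w \<in> V"
    and U: "U \<subseteq> V" "conn G X (inverses U)"
    and u: "u \<in> U" "u \<in> far G X V w x" and u': "u' \<in> U" "u' \<notin> far G X V w x" and x: "x \<in> carrier G"
  shows "w \<in> U \<and> x \<otimes> w \<in> U"
proof -
  let ?Q = "inverses (far G X V w x)"
  have Q: "far G X V w x \<subseteq> carrier G" using V by (auto simp: far_def)
  have out: "inv u' \<notin> ?Q" using inv_mem_inverses [OF Q, of u'] u' U V by auto
  have into: "inv u \<in> ?Q" using u by blast
  have path: "(inv u, inv u') \<in> (adj G X (inverses U))\<^sup>*" using U(2) u u' by (simp add: conn_def)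
  obtain c d where cd: "c \<in> ?Q" "d \<notin> ?Q" "(c, d) \<in> adj G X (inverses U)"
    using rtrancl_crossing [OF path into out] by blast
  from cd(3) obtain a b z where abz: "a \<in> U" "c = inv a" "b \<in> U" "d = inv b" "z \<in> letters G X" "d = c \<otimes> z"
    unfolding adj_def by blast
  then have ab: "a \<in> U" "b \<in> U" "inv a \<in> ?Q" "inv b \<notin> ?Q" "z \<in> letters G X" "inv b = inv a \<otimes> z"
    using cd by simp_all
  have c: "a \<in> carrier G" "b \<in> carrier G" "z \<in> carrier G" using ab U V letter_closed [OF X] by auto
  have b: "b = inv z \<otimes> a" using ab(6) c by (metis inv_closed inv_inv inv_mult_group)
  have "a \<in> far G X V w x" "b \<notin> far G X V w x" 
    using ab(3,4) inv_mem_inverses [OF Q c(1)] inv_mem_inverses [OF Q c(2)] by blast+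
  then have "inv z \<otimes> a = w \<and> inv z = inv x"
    using far_crossing_back [OF X V w _ inv_letter [OF X ab(5)], of a x] b ab U by auto
  then have bw: "b = w" and "inv z = inv x" using b by blast+
  then have zx: "z = x" using c x by (metis inv_inv)
  have "a = z \<otimes> b" using b c by simp
  then show ?thesis using ab bw zx by simp
qed

text \<open>By the leaf condition, the subtree of a letter other than \<open>y\<close> does not
  contain the cut edge and so lies on one side. In contrast to \<open>branch_exchange\<close>, the
  vertex \<open>w \<otimes> cQ\<close> is the image of \<open>w \<otimes> y\<close>, which is in
  \<open>V\<close>. So nothing is added, and the collapse makes the translator smaller.\<close>

lemma leaf_exchange_aux:
  assumes X: "F_basis G X" and Y: "F_basis G Y" and V: "translator G X Y V" "finite V"
    and leaf: "leaf G X Y V w x" and y: "y \<in> letters G Y" "w \<otimes> y \<in> V" "x \<otimes> w \<otimes> y \<in> V"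
    and inv_y: "ends G V (inv y) \<inter> far G X V w x = {}"
  obtains e Y' V' where "e \<in> carrier G" "leaf G Y X (inverses V) (inv e) (inv y)"
    "shifts G X Y V w x e y Y'" "translator G X Y' V'" "finite V'" "card V' < card V"
proof -
  let ?Q = "far G X V w x"
  have Vc: "V \<subseteq> carrier G" "conn G X (inverses V)" using V by (auto simp: translator_def)
  have x: "x \<in> letters G X" and w: "w \<in> V" and xw: "x \<otimes> w \<in> V"
    and uniq: "\<And>z. z \<in> letters G Y \<Longrightarrow> w \<otimes> z \<in> V \<Longrightarrow> x \<otimes> w \<otimes> z \<in> V \<Longrightarrow> z = y"
    using leaf y by (auto simp: leaf_def)
  have c: "x \<in> carrier G" "w \<in> carrier G" "y \<in> carrier G"
    using x w y Vc letter_closed X Y by auto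
  have "x \<noteq> \<one>" using one_not_letter [OF X] x by blast
  then have xwQ: "x \<otimes> w \<in> ?Q" using xw x X c by (simp add: far_def m_assoc)
  have wQ: "w \<notin> ?Q" by (simp add: far_def)
  have ends: "conn G X (inverses (ends G V z))" if "z \<in> letters G Y" for z
    unfolding inv_ends [OF Vc(1) letter_closed [OF Y that]]
    using Vc letter_closed [OF Y that] by (intro conn_left_ends X) auto
  have sep: "ends G V z \<subseteq> ?Q \<or> ends G V z \<inter> ?Q = {}" if z: "z \<in> letters G Y" "z \<noteq> y" for z
  proof (rule ccontr)
    assume "\<not> ?thesis"
    then obtain u u' where "u \<in> ends G V z" "u \<in> ?Q" "u' \<in> ends G V z" "u' \<notin> ?Q" by blast
    then have "w \<in> ends G V z \<and> x \<otimes> w \<in> ends G V z"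
      using crossing_edge [OF X Vc(1) w _ ends [OF z(1)]] c by (auto simp: ends_def)
    then show False using uniq [OF z(1)] z(2) by (auto simp: ends_def)
  qed
  let ?W = "inverses (ends G V y)" and ?S = "inverses (ends G V y \<inter> ?Q)"
  have Ec: "ends G V y \<subseteq> carrier G" "ends G V y \<inter> ?Q \<subseteq> carrier G" using Vc by (auto simp: ends_def)
  have wE: "w \<in> ends G V y" "x \<otimes> w \<in> ends G V y" using w xw y by (auto simp: ends_def)
  \<comment> \<open>The tree of the edges labelled \<open>y\<close> has a leaf beyond the cut edge.
    Collapsing the right edge that starts there makes the collapsed edge admissible again with
    \<open>X\<close> and \<open>Y\<close> exchanged.\<close>
  obtain v' where v': "v' \<in> ?S" "\<exists>!z. z \<in> letters G X \<and> v' \<otimes> z \<in> ?W"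
  proof (rule tree_leaf [OF X _ ends [OF y(1)], of "inv w" ?S])
    show "?W \<subseteq> carrier G" using Ec by auto
    show "finite ?W" using V(2) by (simp add: ends_def)
    show "inv w \<in> ?W" using wE by blast
    show "?S \<subseteq> ?W" "?S \<noteq> {}" using wE xwQ by auto
    show "inv w \<notin> ?S" using inv_mem_inverses [OF Ec(2) c(2)] wQ by simp
    fix v' z assume v': "v' \<in> ?S" and z: "z \<in> letters G X" and vz: "v' \<otimes> z \<in> ?W"
      and ne: "z \<noteq> inv (last (word G X (inv (inv w) \<otimes> v')))"
    obtain v u where v: "v \<in> ends G V y" "v \<in> ?Q" "v' = inv v" and u: "u \<in> ends G V y" "v' \<otimes> z = inv u"
      using v' vz by auto
    have vc: "v \<in> carrier G" "u \<in> carrier G" "z \<in> carrier G" using v u Ec letter_closed [OF X z] by auto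
    have u_eq: "u = inv z \<otimes> v" using u(2) v(3) vc by (metis inv_closed inv_inv inv_mult_group)
    have "u \<in> ?Q"
    proof (rule ccontr)
      assume "u \<notin> ?Q"
      then have "inv z \<otimes> v = w \<and> inv z = inv x"
        using far_crossing_back [OF X Vc(1) w _ inv_letter [OF X z] v(2)] u(1) u_eq by (auto simp: ends_def)
      then have zx': "inv z = inv x" and vw: "inv z \<otimes> v = w" by blast+
      then have zx: "z = x" using vc c by (metis inv_inv)
      have "v = z \<otimes> (inv z \<otimes> v)" using vc by simp
      then have "v = x \<otimes> w" using zx vw by simp
      then have "inv (inv w) \<otimes> v' = inv x" using v(3) c by (simp add: inv_mult_group)
      then show False using ne zx X c inv_letter [OF X x] by simp
    qed
    then show "v' \<otimes> z \<in> ?S" using u by auto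
  qed auto
  then obtain e where e: "e \<in> ends G V y" "e \<in> ?Q" "v' = inv e" by auto
  then have ec: "e \<in> carrier G" "e \<in> V" "e \<otimes> y \<in> V" using Ec by (auto simp: ends_def)
  interpret E: exchange G X Y V w x y e
    using X Y V x w xw y e ec sep inv_y by unfold_locales auto
  have "leaf G Y X (inverses V) (inv e) (inv y)"
  proof -
    have "inv y \<otimes> inv e = inv (e \<otimes> y)" using ec c by (simp add: inv_mult_group)
    moreover have "v' \<otimes> z \<in> ?W \<longleftrightarrow> inv e \<otimes> z \<in> inverses V \<and> inv y \<otimes> inv e \<otimes> z \<in> inverses V"
      if "z \<in> letters G X" for z
      unfolding inv_ends [OF Vc(1) c(3)] e(3) using ec c letter_closed [OF X that] by (simp add: m_assoc)
    then have "\<exists>!z. z \<in> letters G X \<and> inv e \<otimes> z \<in> inverses V \<and> inv y \<otimes> inv e \<otimes> z \<in> inverses V"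
      using v'(2) by (metis (no_types, lifting))
    ultimately show ?thesis using inv_letter [OF Y y(1)] ec unfolding leaf_def by auto
  qed
  moreover have "w \<otimes> E.cQ = E.f (w \<otimes> y)"
  proof -
    have "w \<otimes> y \<in> ends G V (inv y)" using y w c by (auto simp: ends_def m_assoc)
    then have "w \<otimes> y \<notin> E.Q" using inv_y by (auto simp: E.Q_def)
    then show ?thesis using c by (simp add: E.f_def E.c_def m_assoc E.cP_cQ)
  qed
  then have "card E.V' < card V" using y(2) E.card_f_image by (simp add: E.V'_def insert_absorb)
  ultimately show ?thesis using that ec(1) E.shifts E.translator_V' E.finite_V' by blast
qed

text \<open>If some edge labelled \<open>y\<close> ends on the far side, then all of them do, since
  otherwise the tree of \<open>inv y\<close> would contain the cut edge as well. In this case the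
  edge is cut with the opposite orientation, which exchanges the sides and leaves its weight
  unchanged.\<close>

lemma leaf_exchange:
  assumes X: "F_basis G X" and Y: "F_basis G Y" and V: "translator G X Y V" "finite V"
    and leaf: "leaf G X Y V w x"
  obtains e y Y' V' where "e \<in> carrier G" "y \<in> carrier G" "leaf G Y X (inverses V) (inv e) (inv y)"
    "shifts G X Y V w x e y Y'" "translator G X Y' V'" "finite V'" "card V' < card V"
proof -
  have Vc: "V \<subseteq> carrier G" "conn G X (inverses V)" using V by (auto simp: translator_def)
  obtain y where y: "y \<in> letters G Y" "w \<otimes> y \<in> V" "x \<otimes> w \<otimes> y \<in> V"
    using leaf by (auto simp: leaf_def)
  have x: "x \<in> letters G X" and w: "w \<in> V" and xw: "x \<otimes> w \<in> V"
    and uniq: "\<And>z. z \<in> letters G Y \<Longrightarrow> w \<otimes> z \<in> V \<Longrightarrow> x \<otimes> w \<otimes> z \<in> V \<Longrightarrow> z = y"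
    using leaf y by (auto simp: leaf_def)
  have c: "x \<in> carrier G" "w \<in> carrier G" "y \<in> carrier G"
    using x w y Vc letter_closed X Y by auto
  show ?thesis
  proof (cases "ends G V (inv y) \<inter> far G X V w x = {}")
    case True
    then show ?thesis using leaf_exchange_aux [OF X Y V leaf y] that c by metis
  next
    case False
    have iy: "inv y \<in> letters G Y" "inv y \<in> carrier G" using inv_letter [OF Y y(1)] c by auto
    have "conn G X (inverses (ends G V (inv y)))"
      unfolding inv_ends [OF Vc(1) iy(2)] using Vc iy by (intro conn_left_ends X) auto
    then have "ends G V (inv y) \<subseteq> far G X V w x"
    proof -
      assume conn: "conn G X (inverses (ends G V (inv y)))"
      have False if "u' \<in> ends G V (inv y)" "u' \<notin> far G X V w x" for u'
      proof -
        have "w \<in> ends G V (inv y) \<and> x \<otimes> w \<in> ends G V (inv y)"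
          using crossing_edge [OF X Vc(1) w _ conn _ _ that c(1)] False by (auto simp: ends_def)
        then have "inv y = y" using uniq [OF iy(1)] by (auto simp: ends_def)
        then show False using inv_letter_neq [OF Y y(1)] by simp
      qed
      then show ?thesis by blast
    qed
    then have disj: "ends G V (inv y) \<inter> far G X V (x \<otimes> w) (inv x) = {}"
      using far_disjoint [OF X Vc(1) w x] by blast
    have wx: "inv x \<otimes> (x \<otimes> w) = w" using c by simp
    have leaf': "leaf G X Y V (x \<otimes> w) (inv x)"
      using leaf c wx inv_letter [OF X x] unfolding leaf_def by (auto; metis)
    have y': "x \<otimes> w \<otimes> y \<in> V" "inv x \<otimes> (x \<otimes> w) \<otimes> y \<in> V" using y wx by auto
    obtain e Y' V' where E: "e \<in> carrier G" "leaf G Y X (inverses V) (inv e) (inv y)"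
      "shifts G X Y V (x \<otimes> w) (inv x) e y Y'" "translator G X Y' V'" "finite V'" "card V' < card V"
      using leaf_exchange_aux [OF X Y V leaf' y(1) y' disj] by blast
    have "shifts G X Y V w x e y Y'"
      using E(3) cross_left_inv [OF Vc(1), of X Y _ _ _ w x] c
      unfolding shifts_def loop_def by metis
    then show ?thesis using that E c by blast
  qed
qed

lemma leaf_exists:
  assumes X: "F_basis G X" "finite X" and Y: "F_basis G Y" and V: "translator G X Y V" "finite V"
    and big: "card X < card (V - {\<one>})"
  obtains w x where "leaf G X Y V w x"
proof -
  have Vc: "V \<subseteq> carrier G" "conn G X (inverses V)" "\<one> \<in> V" "conn G Y V" using V by (auto simp: translator_def)
  have Ic: "inverses V \<subseteq> carrier G" "\<one> \<in> inverses V" "finite (inverses V)"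
    using Vc V(2) by (auto intro: image_eqI [of \<one> _ \<one>])
  have "card (inverses V) = card V" using inj_on_inv [OF Vc(1)] by (rule card_image)
  then have "(\<Sum>z\<in>X. card (ends G (inverses V) z)) = card (V - {\<one>})"
    using sum_card_ends [OF X Ic(1) Vc(2) Ic(2,3)] Ic(2) Vc(3) by simp
  then have "(\<Sum>z\<in>X. 1) < (\<Sum>z\<in>X. card (ends G (inverses V) z))" using big by simp
  then obtain z where z: "z \<in> X" "1 < card (ends G (inverses V) z)" by (meson not_less sum_mono)
  have zc: "z \<in> carrier G" "z \<in> letters G X" using z basis_subset [OF X(1)] by (auto simp: letters_def)
  \<comment> \<open>Edges labelled \<open>z\<close> among the inverses are the left edges labelled
    \<open>inv z\<close> on \<open>V\<close>.\<close>
  let ?W = "{g \<in> V. inv z \<otimes> g \<in> V}"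
  have W: "inverses (ends G (inverses V) z) = ?W" using inv_ends [OF Ic(1) zc(1)] Vc(1) by simp
  have "ends G (inverses V) z \<subseteq> carrier G" using Ic by (auto simp: ends_def)
  then have "card ?W = card (ends G (inverses V) z)" using card_image [OF inj_on_inv] W by metis
  then have "1 < card ?W" using z by simp
  then have "\<not> card ?W \<le> Suc 0" by simp
  moreover have "finite ?W" using V(2) by simp
  ultimately obtain r u where ru: "r \<in> ?W" "u \<in> ?W" "u \<noteq> r"
    using card_le_Suc0_iff_eq [of ?W] by blast
  have Wc: "?W \<subseteq> carrier G" "conn G Y ?W" "finite ?W"
    using Vc conn_left_ends [OF Y Vc(1,4)] zc V(2) by auto
  \<comment> \<open>The vertices other than an arbitrary root \<open>r\<close> are closed under
    moving away from \<open>r\<close>, so one of them is a leaf.\<close>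
  obtain v where v: "v \<in> ?W - {r}" "\<exists>!y. y \<in> letters G Y \<and> v \<otimes> y \<in> ?W"
  proof (rule tree_leaf [OF Y Wc ru(1), of "?W - {r}"])
    fix v y assume v: "v \<in> ?W - {r}" and y: "y \<in> letters G Y" "v \<otimes> y \<in> ?W"
      and ne: "y \<noteq> inv (last (word G Y (inv r \<otimes> v)))"
    have c: "v \<in> carrier G" "y \<in> carrier G" "r \<in> carrier G" using v y ru Vc letter_closed [OF Y] by auto
    have g: "inv r \<otimes> v \<in> carrier G" "inv r \<otimes> v \<noteq> \<one>"
      using c v by (simp, metis DiffD2 inv_closed inv_equality inv_inv singletonI)
    have "last (word G Y (inv r \<otimes> v)) \<in> carrier G"
      using length_word_parent(2) [OF Y g] letter_closed [OF Y] by blast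
    then have "last (word G Y (inv r \<otimes> v)) \<noteq> inv y" using ne c by auto
    then have "word G Y (inv r \<otimes> v \<otimes> y) \<noteq> []" using word_mult_letter [OF Y g(1) y(1)] by simp
    then have "v \<otimes> y \<noteq> r" using c Y by (auto simp: m_assoc)
    then show "v \<otimes> y \<in> ?W - {r}" using y by blast
  qed (use ru in auto)
  have vc: "v \<in> carrier G" using v Vc by auto
  have "v \<otimes> y \<in> ?W \<longleftrightarrow> v \<otimes> y \<in> V \<and> inv z \<otimes> v \<otimes> y \<in> V" if "y \<in> letters G Y" for y
    using letter_closed [OF Y that] vc zc by (simp add: m_assoc)
  then have "\<exists>!y. y \<in> letters G Y \<and> v \<otimes> y \<in> V \<and> inv z \<otimes> v \<otimes> y \<in> V"
    using v(2) by (metis (no_types, lifting))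
  then have "leaf G X Y V v (inv z)" using v inv_letter [OF X(1) zc(2)] by (auto simp: leaf_def)
  then show ?thesis by (rule that)
qed

end

section \<open>Peak reduction\<close>

lemma Inf_enat_attained:
  assumes "A \<noteq> {}"
  obtains a where "a \<in> A" "(INF x\<in>A. f x :: enat) = f a"
proof -
  obtain b where "b \<in> f ` A" using assms by blast
  then have "Inf (f ` A) \<in> f ` A" by (rule wellorder_InfI)
  then show ?thesis using that by auto
qed

context group
begin

text \<open>
  Choose an admissible edge of least weight for \<open>X\<close>. Its exchange trades it for an admissible edge
  for \<open>Y\<close> which, as \<open>Y\<close> is a local minimum, weighs no more, and the exchange of the latter leads to
  an admissible edge for \<open>X\<close> which weighs no more either. So all three weights agree, and the first
  exchange preserves the total length.
\<close>

lemma peak_reduction: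
  assumes X: "F_basis G X" and Y: "F_basis G Y" and V: "translator G X Y V" and R: "finite R" "R \<subseteq> words G"
    and min_X: "local_minimum_point G (total_length G R) X"
    and min_Y: "local_minimum_point G (total_length G R) Y"
    and start: "adm w0 x0" "\<And>w x. adm w x \<Longrightarrow> w \<in> carrier G \<and> x \<in> carrier G"
    and exch: "\<And>w x. adm w x \<Longrightarrow> \<exists>e y Y'. e \<in> carrier G \<and> y \<in> carrier G \<and> adm' (inv e) (inv y) \<and>
      shifts G X Y V w x e y Y' \<and> good Y'"
    and exch': "\<And>w x. adm' w x \<Longrightarrow> \<exists>e y X'. e \<in> carrier G \<and> y \<in> carrier G \<and> adm (inv e) (inv y) \<and>
      shifts G Y X (inverses V) w x e y X'"
  obtains Y' where "whitehead_transform G Y Y'" "total_length G R Y' = total_length G R Y" "good Y'"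
proof -
  have Vc: "V \<subseteq> carrier G" using V by (simp add: translator_def)
  \<comment> \<open>One tight loop per word is fixed here, and the weights of left and of right
    edges are both counted along these loops.\<close>
  have "\<forall>r. \<exists>z. r \<in> R \<longrightarrow> loop G X Y V r (fst z) (snd z) \<and> length (rights (snd z)) = word_length G Y r \<and>
      length (lefts (snd z)) = word_length G X r"
    using tight_loop_exists [OF X Y V] R(2) by (metis fst_conv snd_conv subsetD)
  then obtain L where L: "\<And>r. r \<in> R \<Longrightarrow> loop G X Y V r (fst (L r)) (snd (L r))"
    "\<And>r. r \<in> R \<Longrightarrow> length (rights (snd (L r))) = word_length G Y r"
    "\<And>r. r \<in> R \<Longrightarrow> length (lefts (snd (L r))) = word_length G X r" by metis
  define wl where "wl w x = (\<Sum>r\<in>R. cross_left G w x (fst (L r)) (snd (L r)))" for w x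
  define wr where "wr e y = (\<Sum>r\<in>R. cross_right G e y (fst (L r)) (snd (L r)))" for e y
  have 1: "total_length G R Y' + wr e y \<le> total_length G R Y + wl w x"
    if "shifts G X Y V w x e y Y'" for w x e y Y'
  proof -
    have "word_length G Y' r + cross_right G e y (fst (L r)) (snd (L r)) \<le>
        word_length G Y r + cross_left G w x (fst (L r)) (snd (L r))" if r: "r \<in> R" for r
      using \<open>shifts G X Y V w x e y Y'\<close> L [OF r] r R(2) unfolding shifts_def by (metis subsetD)
    then show ?thesis
      unfolding total_length_def wl_def wr_def sum.distrib [symmetric] by (intro sum_mono)
  qed
  \<comment> \<open>The exchange that replaces \<open>X\<close> acts on the mirrored loops.
    Mirroring turns left crossings into right ones, so the bound can be read in the same
    weights.\<close>
  have 2: "total_length G R X' + wl (inv e) (inv y) \<le> total_length G R X + wr w x"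
    if sh: "shifts G Y X (inverses V) (inv w) (inv x) e y X'"
      and c: "w \<in> carrier G" "x \<in> carrier G" "e \<in> carrier G" "y \<in> carrier G" for w x e y X'
  proof -
    have "word_length G X' r + cross_left G (inv e) (inv y) (fst (L r)) (snd (L r)) \<le>
        word_length G X r + cross_right G w x (fst (L r)) (snd (L r))" if r: "r \<in> R" for r
    proof -
      let ?u = "fst (L r)" and ?p = "snd (L r)"
      let ?p' = "map (swap_step G) ?p"
      have path: "is_path G X Y V ?u ?p ?u" using L(1) [OF r] by (simp add: loop_def)
      have uc: "?u \<in> carrier G" using is_path_mem [OF path] Vc by auto
      have path': "is_path G Y X (inverses V) (inv ?u) ?p' (inv ?u)"
        by (rule is_path_swap [OF X Y Vc path])
      have Vc': "inverses V \<subseteq> carrier G" using Vc by auto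
      have rw: "r \<in> words G" using r R(2) by blast
      have "word_length G X' r + cross_right G e y (inv ?u) ?p' \<le>
          length (rights ?p') + cross_left G (inv w) (inv x) (inv ?u) ?p'"
        using sh loop_swap [OF X Y Vc rw L(1) [OF r]] rw unfolding shifts_def by blast
      moreover have "cross_right G e y (inv ?u) ?p' = cross_left G (inv e) (inv y) ?u ?p"
        using cross_left_swap [OF X Y Vc path, of "inv e" "inv y"] c by simp
      moreover have "cross_left G (inv w) (inv x) (inv ?u) ?p' = cross_right G w x ?u ?p"
        using cross_left_swap [OF Y X Vc' path', of "inv w" "inv x"] c uc
          swap_swap_path [OF X Y path] by (simp del: map_map)
      ultimately show ?thesis using L(3) [OF r] by (simp add: rights_swap)
    qed
    then show ?thesis
      unfolding total_length_def wl_def wr_def sum.distrib [symmetric] by (intro sum_mono)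
  qed
  obtain z where z: "adm (fst z) (snd z)"
    and least: "\<And>z'. adm (fst z') (snd z') \<Longrightarrow> wl (fst z) (snd z) \<le> wl (fst z') (snd z')"
    using ex_has_least_nat [of "\<lambda>z. adm (fst z) (snd z)" "(w0, x0)" "\<lambda>z. wl (fst z) (snd z)"] start(1)
    by auto
  obtain e y Y' where E: "e \<in> carrier G" "y \<in> carrier G" "adm' (inv e) (inv y)"
    "shifts G X Y V (fst z) (snd z) e y Y'" "good Y'" using exch [OF z] by blast
  obtain e' y' X' where E': "e' \<in> carrier G" "y' \<in> carrier G" "adm (inv e') (inv y')"
    "shifts G Y X (inverses V) (inv e) (inv y) e' y' X'" using exch' [OF E(3)] by blast
  have "total_length G R Y \<le> total_length G R Y'"
    using min_Y E(4) by (auto simp: local_minimum_point_def shifts_def)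
  moreover have "total_length G R X \<le> total_length G R X'"
    using min_X E'(4) by (auto simp: local_minimum_point_def shifts_def)
  moreover have "wl (fst z) (snd z) \<le> wl (inv e') (inv y')" using least [of "(inv e', inv y')"] E' by simp
  ultimately have "total_length G R Y' = total_length G R Y"
    using 1 [OF E(4)] 2 [OF E'(4) E(1,2) E'(1,2)] by linarith
  then show ?thesis using that E by (auto simp: shifts_def)
qed

section \<open>The distance and its decrease\<close>

lemma min_translator_card_le:
  assumes X: "F_basis G X" and Y: "F_basis G Y" and V: "translator G X Y V" "finite V"
  shows "min_translator_card G X Y \<le> enat (card (V - {\<one>}))"
proof -
  have "min_translator_card G X Y \<le> cardinal (V - {\<one>})"
    unfolding min_translator_card_def
    using translators_iff [OF X Y] V(1) by (intro INF_lower) blast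
  then show ?thesis using V(2) by (simp add: cardinal_def)
qed

lemma min_translator_card_ge:
  assumes X: "F_basis G X" and Y: "F_basis G Y" "finite Y"
  shows "enat (card Y) \<le> min_translator_card G X Y"
  unfolding min_translator_card_def
proof (rule INF_greatest)
  fix V assume "V \<in> translators G X Y"
  then have "translator G X Y V" using translators_iff [OF X Y(1)] by blast
  then show "enat (card Y) \<le> cardinal (V - {\<one>})"
    using card_translator_ge [OF Y] by (auto simp: cardinal_def)
qed

lemma minimal_translator:
  assumes X: "F_basis G X" "finite X" and Y: "F_basis G Y" "finite Y"
  obtains V where "translator G X Y V" "finite V" "min_translator_card G X Y = enat (card (V - {\<one>}))"
proof -
  obtain W where W: "translator G X Y W" "finite W" using finite_translator_exists [OF X Y] by blast
  then have "W \<in> translators G X Y" using translators_iff [OF X(1) Y(1)] by blast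
  then have "translators G X Y \<noteq> {}" by blast
  then obtain V where V: "V \<in> translators G X Y" "min_translator_card G X Y = cardinal (V - {\<one>})"
    unfolding min_translator_card_def
    using Inf_enat_attained [of "translators G X Y" "\<lambda>V. cardinal (V - {\<one>})"] by blast
  have "cardinal (V - {\<one>}) \<le> enat (card (W - {\<one>}))"
    using min_translator_card_le [OF X(1) Y(1) W] V(2) by simp
  then have "finite (V - {\<one>})" by (auto simp: cardinal_def split: if_splits)
  then show ?thesis using that [of V] V translators_iff [OF X(1) Y(1)] by (simp add: cardinal_def)
qed

lemma cardinal_eq_Suc_iff:
  assumes "\<one> \<in> V"
  shows "cardinal V = enat (1 + n) \<longleftrightarrow> finite V \<and> card (V - {\<one>}) = n"
proof -
  have "finite V \<Longrightarrow> card V = Suc (card (V - {\<one>}))" using card.remove [OF _ assms] .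
  then show ?thesis by (auto simp: cardinal_def)
qed

lemma translator_dist_small:
  assumes X: "F_basis G X" "finite X" and Y: "F_basis G Y" "finite Y"
    and V: "translator G X Y V" "finite V" "card (V - {\<one>}) = card Y"
  shows "translator_dist G X Y \<le> enat (card (branch G X Y V))"
proof -
  have "min_translator_card G X Y = enat (card Y)"
    using min_translator_card_le [OF X(1) Y(1) V(1,2)] min_translator_card_ge [OF X(1) Y] V(3) by simp
  then have "translator_dist G X Y = (INF V \<in> {V \<in> translators G X Y. cardinal V = enat (1 + card Y)}.
      cardinal (valence_ge_3 G X Y V))"
    using free_rank_eq [OF Y] by (simp add: translator_dist_def)
  moreover have "V \<in> {V \<in> translators G X Y. cardinal V = enat (1 + card Y)}"
    using V translators_iff [OF X(1) Y(1)] cardinal_eq_Suc_iff [of V "card Y"] by (auto simp: translator_def)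
  moreover have "cardinal (valence_ge_3 G X Y V) = enat (card (branch G X Y V))"
  proof -
    have "valence_ge_3 G X Y V = branch G X Y V" using V valence_ge_3_eq X Y by (auto simp: translator_def)
    moreover have "finite (branch G X Y V)" using V(2) by (simp add: branch_def)
    ultimately show ?thesis by (simp add: cardinal_def)
  qed
  ultimately show ?thesis by (metis (no_types, lifting) INF_lower)
qed

text \<open>Branch vertices are among the elements other than \<open>\<one>\<close>, so the bound
  holds in either branch of the definition. Hence a smaller translator lowers the distance even if
  the new minimum drops to the rank and the definition switches to counting branch vertices.\<close>

lemma translator_dist_le:
  assumes X: "F_basis G X" "finite X" and Y: "F_basis G Y" "finite Y"
    and V: "translator G X Y V" "finite V"
  shows "translator_dist G X Y \<le> enat (card (V - {\<one>}))"
proof (cases "min_translator_card G X Y = enat (free_rank G)")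
  case True
  obtain W where W: "translator G X Y W" "finite W" "min_translator_card G X Y = enat (card (W - {\<one>}))"
    using minimal_translator [OF X Y] by blast
  then have card: "card (W - {\<one>}) = card Y" using True free_rank_eq [OF Y] by simp
  have "card (branch G X Y W) \<le> card (W - {\<one>})"
    using W(2) by (intro card_mono) (auto simp: branch_def)
  moreover have "card (W - {\<one>}) \<le> card (V - {\<one>})"
    using card_translator_ge [OF Y V] card by simp
  moreover have "translator_dist G X Y \<le> enat (card (branch G X Y W))"
    by (rule translator_dist_small [OF X Y W(1,2) card])
  ultimately show ?thesis by (meson enat_ord_simps(1) order_trans)
next
  case False
  then show ?thesis using min_translator_card_le [OF X(1) Y(1) V] by (simp add: translator_dist_def)
qed

lemma translator_dist_decrease:
  assumes X: "F_basis G X" "finite X" and Y: "F_basis G Y" "finite Y" and R: "finite R" "R \<subseteq> words G"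
    and min_X: "local_minimum_point G (total_length G R) X"
    and min_Y: "local_minimum_point G (total_length G R) Y"
    and ne: "letters G X \<noteq> letters G Y"
  obtains Y' where "whitehead_transform G Y Y'" "total_length G R Y' = total_length G R Y"
    "translator_dist G X Y' < translator_dist G X Y"
proof -
  have rank: "card Y = card X" using free_rank_eq [OF X] free_rank_eq [OF Y] by simp
  have W_fin: "finite Z" "F_basis G Z" "card Z = card X" if "whitehead_transform G Y Z" for Z
  proof -
    show Z: "F_basis G Z" using that by (simp add: whitehead_transform_def)
    show fZ: "finite Z"
      using basis_finite [OF Z basis_subset [OF X(1)] generate_basis [OF X(1)] X(2)] .
    show "card Z = card X" using free_rank_eq [OF X] free_rank_eq [OF Z fZ] by simp
  qed
  obtain W where W: "translator G X Y W" "finite W" "min_translator_card G X Y = enat (card (W - {\<one>}))"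
    using minimal_translator [OF X Y] by blast
  show ?thesis
  proof (cases "card (W - {\<one>}) = card X")
    case False
    have big: "card X < card (W - {\<one>})" using card_translator_ge [OF Y W(1,2)] rank False by simp
    then have dist: "translator_dist G X Y = enat (card (W - {\<one>}))"
      using W(3) free_rank_eq [OF X] by (simp add: translator_dist_def)
    obtain w0 x0 where start: "leaf G X Y W w0 x0" using leaf_exists [OF X Y(1) W(1,2) big] by blast
    have Wc: "W \<subseteq> carrier G" "\<one> \<in> W" using W(1) by (auto simp: translator_def)
    obtain Y' where "whitehead_transform G Y Y'" "total_length G R Y' = total_length G R Y"
      "\<exists>V'. translator G X Y' V' \<and> finite V' \<and> card V' < card W"
    proof (rule peak_reduction [OF X(1) Y(1) W(1) R min_X min_Y, where adm = "leaf G X Y W" and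
          adm' = "leaf G Y X (inverses W)" and good = "\<lambda>Y'. \<exists>V'. translator G X Y' V' \<and> finite V' \<and> card V' < card W"])
      show "w \<in> carrier G \<and> x \<in> carrier G" if "leaf G X Y W w x" for w x
        using that Wc letter_closed [OF X(1)] by (auto simp: leaf_def)
      show "\<exists>e y Y'. e \<in> carrier G \<and> y \<in> carrier G \<and> leaf G Y X (inverses W) (inv e) (inv y) \<and>
          shifts G X Y W w x e y Y' \<and> (\<exists>V'. translator G X Y' V' \<and> finite V' \<and> card V' < card W)"
        if "leaf G X Y W w x" for w x
        by (rule leaf_exchange [OF X(1) Y(1) W(1,2) that]) blast
      show "\<exists>e y X'. e \<in> carrier G \<and> y \<in> carrier G \<and> leaf G X Y W (inv e) (inv y) \<and>
          shifts G Y X (inverses W) w x e y X'" if "leaf G Y X (inverses W) w x" for w x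
        by (rule leaf_exchange [OF Y(1) X(1) translator_swap [OF W(1)] finite_imageI [OF W(2)] that])
          (use inverses_inverses [OF Wc(1)] in auto)
    qed (use start in blast)+
    then obtain V' where Y': "whitehead_transform G Y Y'" "total_length G R Y' = total_length G R Y"
      and V': "translator G X Y' V'" "finite V'" "card V' < card W" by blast
    have one: "\<one> \<in> V'" using V'(1) by (simp add: translator_def)
    have "card (V' - {\<one>}) < card (W - {\<one>})"
      using V'(3) card.remove [OF V'(2) one] card.remove [OF W(2) Wc(2)] by simp
    then have "translator_dist G X Y' < translator_dist G X Y"
      using translator_dist_le [OF X W_fin(2,1) [OF Y'(1)] V'(1,2)] dist
      by (metis enat_ord_simps(2) le_less_trans)
    then show ?thesis using that Y' by blast
  next
    case True
    then have min_eq: "min_translator_card G X Y = enat (free_rank G)"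
      using W(3) free_rank_eq [OF X] by simp
    let ?S = "{V \<in> translators G X Y. cardinal V = enat (1 + free_rank G)}"
    have S: "V \<in> ?S \<longleftrightarrow> translator G X Y V \<and> finite V \<and> card (V - {\<one>}) = card X" for V
      using translators_iff [OF X(1) Y(1), of V] cardinal_eq_Suc_iff [of V "card X"] free_rank_eq [OF X]
      by (auto simp: translator_def)
    have "W \<in> ?S" using W True S by blast
    then have "?S \<noteq> {}" by blast
    then obtain V where V: "V \<in> ?S"
      "(INF V \<in> ?S. cardinal (valence_ge_3 G X Y V)) = cardinal (valence_ge_3 G X Y V)"
      using Inf_enat_attained [of ?S "\<lambda>V. cardinal (valence_ge_3 G X Y V)"] by blast
    have tV: "translator G X Y V" "finite V" "card (V - {\<one>}) = card X" using V(1) S by blast+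
    have Vc: "V \<subseteq> carrier G" "\<one> \<in> V" using tV(1) by (auto simp: translator_def)
    have "finite (branch G X Y V)" using tV(2) by (simp add: branch_def)
    then have "translator_dist G X Y = enat (card (branch G X Y V))"
      using V(2) valence_ge_3_eq [OF X Y Vc(1)] min_eq
      by (simp add: translator_dist_def cardinal_def)
    note dist = this
    \<comment> \<open>Without branch vertices both bases would have the same letters, by
      \<open>branch_empty_letters\<close> in both directions.\<close>
    have "branch G X Y V \<noteq> {}"
    proof
      assume empty: "branch G X Y V = {}"
      then have "branch G Y X (inverses V) = {}" using branch_swap [OF X(1) Y(1) Vc(1)] by simp
      then show False
        using branch_empty_letters [OF X Y tV(1) empty] branch_empty_letters [OF Y X translator_swap [OF tV(1)]] ne
        by blast
    qed
    then obtain v where v: "v \<in> branch G X Y V" by blast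
    \<comment> \<open>Branch vertices and \<open>\<one>\<close> also span a subtree of the left
      tree, and the first edge on the way from \<open>\<one>\<close> to \<open>v\<close> in it is
      admissible.\<close>
    obtain w0 x0 where start: "branch_edge G X Y V w0 x0"
    proof -
      let ?K = "insert \<one> (branch G X Y V)"
      have KV: "?K \<subseteq> carrier G" using Vc by (auto simp: branch_def)
      have "insert \<one> (branch G Y X (inverses V)) = inverses ?K"
        using branch_swap [OF X(1) Y(1) Vc(1)] by simp
      then have conn: "conn G X (inverses ?K)" using conn_branch [OF Y X translator_swap [OF tV(1)]] by simp
      have "v \<noteq> \<one>" "v \<in> carrier G" using v KV by (auto simp: branch_def)
      then have "inv v \<noteq> \<one>" by simp
      then have "inv \<one> \<noteq> inv v" unfolding inv_one by (rule not_sym)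
      have I: "inverses ?K \<subseteq> carrier G" using KV by auto
      have m: "inv \<one> \<in> inverses ?K" "inv v \<in> inverses ?K" using v by blast+
      let ?z = "hd (word G X (inv (inv \<one>) \<otimes> inv v))"
      have z: "?z \<in> letters G X" "inv \<one> \<otimes> ?z \<in> inverses ?K"
        using conn_hd [OF X(1) I conn m \<open>inv \<one> \<noteq> inv v\<close>] by auto
      have "inv ?z \<in> ?K"
      proof -
        have "?z \<in> inverses ?K" using z letter_closed [OF X(1) z(1)] by simp
        then have "inv (inv ?z) \<in> inverses ?K" using letter_closed [OF X(1) z(1)] by simp
        then show ?thesis using inv_mem_inverses [OF KV, of "inv ?z"] letter_closed [OF X(1) z(1)] by blast
      qed
      then have "branch_edge G X Y V \<one> (inv ?z)"
        using inv_letter [OF X(1) z(1)] letter_closed [OF X(1) z(1)] by (simp add: branch_edge_def)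
      then show ?thesis by (rule that)
    qed
    let ?good = "\<lambda>Y'. \<exists>V'. translator G X Y' V' \<and> finite V' \<and> card (V' - {\<one>}) = card X \<and>
        card (branch G X Y' V') < card (branch G X Y V)"
    obtain Y' where "whitehead_transform G Y Y'" "total_length G R Y' = total_length G R Y" "?good Y'"
    proof (rule peak_reduction [OF X(1) Y(1) tV(1) R min_X min_Y, where adm = "branch_edge G X Y V" and
          adm' = "branch_edge G Y X (inverses V)" and good = ?good])
      show "w \<in> carrier G \<and> x \<in> carrier G" if "branch_edge G X Y V w x" for w x
        using that Vc letter_closed [OF X(1)] by (auto simp: branch_edge_def branch_def)
      show "\<exists>e y Y'. e \<in> carrier G \<and> y \<in> carrier G \<and> branch_edge G Y X (inverses V) (inv e) (inv y) \<and>
          shifts G X Y V w x e y Y' \<and> ?good Y'" if "branch_edge G X Y V w x" for w x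
        by (rule branch_exchange [OF X Y rank tV that]) blast
      have fI: "finite (inverses V)" using tV(2) by simp
      have cI: "card (inverses V - {\<one>}) = card Y"
      proof -
        have "\<one> \<in> inverses V" using Vc(2) by (auto intro: image_eqI [of \<one> _ \<one>])
        then show ?thesis
          using card_image [OF inj_on_inv [OF Vc(1)]] tV Vc(2) fI rank by simp
      qed
      show "\<exists>e y X'. e \<in> carrier G \<and> y \<in> carrier G \<and> branch_edge G X Y V (inv e) (inv y) \<and>
          shifts G Y X (inverses V) w x e y X'" if "branch_edge G Y X (inverses V) w x" for w x
        by (rule branch_exchange [OF Y X rank [symmetric] translator_swap [OF tV(1)] fI cI that])
          (use inverses_inverses [OF Vc(1)] in auto)
    qed (use start in blast)+
    then obtain V' where Y': "whitehead_transform G Y Y'" "total_length G R Y' = total_length G R Y"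
      and V': "translator G X Y' V'" "finite V'" "card (V' - {\<one>}) = card X"
        "card (branch G X Y' V') < card (branch G X Y V)" by blast
    have "card (V' - {\<one>}) = card Y'" using V'(3) W_fin(3) [OF Y'(1)] by simp
    then have "translator_dist G X Y' < translator_dist G X Y"
      using translator_dist_small [OF X W_fin(2,1) [OF Y'(1)] V'(1,2)] V'(4) dist
      by (metis enat_ord_simps(2) le_less_trans)
    then show ?thesis using that Y' by blast
  qed
qed

end

theorem theorem3p3:
  fixes F :: "('a, 'b) monoid_scheme"
    and R :: "'a fword set"
    and X Y :: "'a set"
    and h :: "'a set \<Rightarrow> nat"
  assumes "free_group_of_finite_rank F"
    and "finite R" and "R \<subseteq> words F"
    and "F_basis F X" and "F_basis F Y"
    and "h = total_length F R"
    and "local_minimum_point F h X" and "local_minimum_point F h Y"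
  shows "letters F X = letters F Y \<or>
    (\<exists>Y'. whitehead_transform F Y Y' \<and> h Y' = h Y \<and>
       translator_dist F X Y' < translator_dist F X Y)"
proof -
  interpret group F using assms(1) by (simp add: free_group_of_finite_rank_def)
  obtain B where B: "finite B" "F_basis F B"
    using assms(1) by (auto simp: free_group_of_finite_rank_def)
  have "finite Z" if "F_basis F Z" for Z
    using basis_finite [OF that basis_subset [OF B(2)] generate_basis [OF B(2)] B(1)] .
  then have fin: "finite X" "finite Y" using assms(4,5) by blast+
  show ?thesis
  proof (cases "letters F X = letters F Y")
    case False
    then show ?thesis
      using translator_dist_decrease [OF assms(4) fin(1) assms(5) fin(2) assms(2,3)] assms(6-8)
      by metis
  qed simp
qed

end
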